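(* Let $(W,S)$ be an arbitrary Coxeter system and $I\subseteq S$ an arbitrary subset; use the notation of the context. There is an exact sequence of group homomorphisms $$1\to C_I\hookrightarrow Z_W(W_I)\overset{\mathsf A}{\to}\widetilde{\mathcal A}\to 1$$ and a map $g:\widetilde{\mathcal A}\to Z_W(W_I)$ with $\mathsf A\circ g=\mathrm{id}_{\widetilde{\mathcal A}}$, where $$\mathsf A(w)=\{\lambda\in\Lambda\mid w\cdot\alpha_{(x_I)_\lambda}=-\alpha_{(x_I)_\lambda}\},\qquad g(A)=g_A=p_{x_I,x_I{}^A}\,w_0((x_I)_A).$$ If $\widetilde B_I=\{w\in Z_W(W_I)\mid(\Phi^{\perp I})^+=w\cdot(\Phi^{\perp I})^+\}$, then $g(\widetilde{\mathcal A})\subseteq\widetilde B_I$, the sequence $1\to Y_I\hookrightarrow\widetilde B_I\overset{\mathsf A}{\to}\widetilde{\mathcal A}\to1$ is exact, and $Z_W(W_I)=W^{\perp I}\rtimes\widetilde B_I$, where $\widetilde B_I$ acts on $W^{\perp I}$ as automorphisms of the Coxeter system $(W^{\perp I},R^I)$. Moreover, for every $p\in\pi_1(\mathcal Y^1;x_I)$ and $A,A'\in\widetilde{\mathcal A}$ (with $AA'$ the symmetric difference), the following equalities hold in $W$: $$g_A\,p\,g_A^{-1}=\tau_A(p)_{(x_I)},\qquad g_Ag_{A'}=\tau_A(p_{x_I,x_I{}^{A'}})_{(x_I)}\,g_{AA'},$$ $$g_A^2=\tau_A(p_{x_I,x_I{}^A})_{(x_I)},\qquad g_Ag_{A'}g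_A^{-1}g_{A'}^{-1}=\tau_A(p_{x_I,x_I{}^{A'}})_{(x_I)}\,\tau_{A'}(p_{x_I{}^A,x_I})_{(x_I)}.$$
   Context: **Coxeter groups.** $(W,S)$ is a Coxeter system, $S$ possibly infinite; $m_{s,t}$ is the order of $st$; $\Gamma$ is the Coxeter graph ($s\ne t$ adjacent iff $m_{s,t}\ge 3$, including $\infty$). $V$ is the real space with basis $\{\alpha_s\mid s\in S\}$ and form $\langle\alpha_s,\alpha_t\rangle=-\cos(\pi/m_{s,t})$ ($=-1$ if $m_{s,t}=\infty$); $W$ acts by $s\cdot v=v-2\langle\alpha_s,v\rangle\alpha_s$. $\Phi=\{w\cdot\alpha_s\}$ is the root system, $\Phi^+$ the positive roots, $\Phi^-=-\Phi^+$, $\Psi^{\pm}=\Psi\cap\Phi^{\pm}$ for $\Psi\subseteq\Phi$; $s_\gamma=wsw^{-1}$ for $\gamma=w\cdot\alpha_s$. For $J\subseteq S$, $W_J=\langle J\rangle$; $J$ is of finite type if $W_J$ is finite, and then $w_0(J)$ is the longest element of $W_J$. Irreducible components of $J$ are the vertex sets of the connected components of the full subgraph of $\Gamma$ on $J$. For $J,K\subseteq S$, $J_{\sim K}$ is the union of those connected components of the full subgraph of $\Gamma$ on $J\cup K$ which meet $K$; $J_{\sim s}=J_{\sim\{s\}}$. **Orthogonal part.** For $J\subseteq S$, $\Phi^{\perp J}=\{\gamma\in\Phi\mid\langle\gamma,\alpha_s\rangle=0\ \forall s\in J\}$, $W^{\perp J}=\langle s_\gamma\mid\gamma\in\Phi^{\perp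 J}\rangle$. It is known that $(W^{\perp J},R^J)$ is a Coxeter system, where $R^J$ consists of the $s_\gamma$ with $\gamma\in(\Phi^{\perp J})^+$ such that in any expression $\gamma=\sum_i c_i\beta_i$ with $c_i>0$, $\beta_i\in(\Phi^{\perp J})^+$, all $\beta_i=\gamma$. **Groupoids.** Fix a set $\Lambda$ with $|\Lambda|=|I|$. $S^{(\Lambda)}$ is the set of injections $x:\Lambda\to S$, $x_\lambda=x(\lambda)$, $x_A=\{x_\lambda\mid\lambda\in A\}$, $[x]=x_\Lambda$. Fix $x_I\in S^{(\Lambda)}$ with $[x_I]=I$. For $x,y\in S^{(\Lambda)}$ put $C_{x,y}=\{w\in W\mid\alpha_{x_\lambda}=w\cdot\alpha_{y_\lambda}\ \forall\lambda\}$, and $\mathcal V(C)=\{x\mid C_{x,x_I}\ne\emptyset\}$; if $w\in C_{x,y}$ write $x=w\cdot y$. $Y_{x,y}=\{w\in C_{x,y}\mid w\cdot(\Phi^{\perp[y]})^+\subseteq\Phi^+\}$, $C_I=C_{x_I,x_I}$, $Y_I=Y_{x_I,x_I}$. **Graph and tree.** For $x\in\mathcal V(C)$ and $s\in S\smallsetminus[x]$ with $[x]_{\sim s}$ of finite type, let $w_x^s=w_0([x]_{\sim s})w_0([x]_{\sim s}\smallsetminus\{s\})$; there is a unique $y\in\mathcal V(C)$ with $w_x^s\in C_{y,x}$. $\mathcal C$ is the graph with vertex set $\mathcal V(C)$ and edges $w_x^s$ from $x$ to $w_x^s\cdot x$, where $w_x^s$ and its inverse $w_y^t$ ($y=w_x^s\cdot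 x$, $\{t\}=([x]\cup\{s\})\smallsetminus[y]$) are identified as the two orientations of one edge. $\mathcal Y^1$ is $\mathcal C$ with all loops deleted; it is connected. Fix a maximal tree $\mathcal T$ of $\mathcal Y^1$; $p_{z,y}$ is the non-backtracking path in $\mathcal T$ from $y$ to $z$. Paths are written from right to left; a path from $y$ to $z$ represents an element of $C_{z,y}\subseteq W$, and paths are used to denote the elements they represent. For a path $q$ in $\mathcal Y^1$ from $y$ to $z$, $q_{(x)}=p_{x,z}\,q\,p_{y,x}$. **The group $\widetilde{\mathcal A}$ and the maps $\tau_A$.** Say $A\subseteq\Lambda$ is of finite type, or a union of irreducible components of $\Lambda$, if $(x_I)_A$ is of finite type, or a union of irreducible components of $I$ (the same then holds with $x_I$ replaced by any $x\in\mathcal V(C)$). For such $A$ (both properties) and $x\in\mathcal V(C)$ define $x^A\in S^{(\Lambda)}$ by $(x^A)_\lambda=w_0(x_A)x_\lambda w_0(x_A)$. $\widetilde{\mathcal A}$ is the set of such $A$ with $x_I{}^A\in\mathcal V(C)$; it is an elementary abelian $2$-group under symmetric difference. Each $A\in\widetilde{\mathcal A}$ induces an automorphism $\tau_A$ of the graph $\mathcal C$ by $y\mapsto y^A$, $w_y^s\mapsto w_{y^A}^s$, acting also on paths; if a path $p$ from $y$ to $z$ represents $w\in C_{z,y}$, then $\tau_A(p)$ represents $w_0(z_A)\,w\,w_0(y_A)\in C_{z^A,y^A}$. *)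

theory Defs
  imports
    "HOL-Algebra.Algebra"
    "Graph_Theory.Arc_Walk"
    "Graph_Theory.Digraph_Component"
    Complex_Main
begin

section \<open>Coxeter systems and their geometric representation\<close>

context
  fixes G :: "('a, 'b) monoid_scheme" (structure)
    and S :: "'a set"
begin

text \<open>The order of \<open>s t\<close>, where the value 0 stands for infinite order.\<close>

definition cox_order :: "'a \<Rightarrow> 'a \<Rightarrow> nat" where
  "cox_order s t = group.ord G (s \<otimes> t)"

definition word_prod :: "'a list \<Rightarrow> 'a" where
  "word_prod ss = foldr (\<otimes>) ss \<one>"

definition relator_step :: "'a list \<Rightarrow> 'a list \<Rightarrow> bool" where
  "relator_step u v \<longleftrightarrow> (\<exists>a b s t. s \<in> S \<and> t \<in> S \<and> cox_order s t \<noteq> 0 \<and>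
     u = a @ concat (replicate (cox_order s t) [s, t]) @ b \<and> v = a @ b)"

text \<open>\<open>S\<close> is a set of elements of order 2 which generates the group and, together with the
  relations \<open>(s t)\<^sup>m = 1\<close>, \<open>m\<close> the order of \<open>s t\<close>, for all \<open>s, t \<in> S\<close> with \<open>m\<close> finite,
  presents it.  The relations with \<open>s = t\<close> are \<open>s s = 1\<close>, so no formal inverses are needed and
  the consequences of the relations can be described by words in \<open>S\<close>.\<close>

definition coxeter_system :: bool where
  "coxeter_system \<longleftrightarrow> group G \<and> S \<subseteq> carrier G \<and> generate G S = carrier G \<and>
     (\<forall>s\<in>S. group.ord G s = 2) \<and>
     (\<forall>u. set u \<subseteq> S \<longrightarrow> word_prod u = \<one> \<longrightarrow> equivclp relator_step u [])"

definition cox_length :: "'a \<Rightarrow> nat" where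
  "cox_length w = (LEAST n. \<exists>ss. set ss \<subseteq> S \<and> word_prod ss = w \<and> length ss = n)"

definition finite_type :: "'a set \<Rightarrow> bool" where
  "finite_type J \<longleftrightarrow> finite (generate G J)"

definition w0 :: "'a set \<Rightarrow> 'a" where
  "w0 J = (ARG_MAX cox_length w. w \<in> generate G J)"

definition cox_adj :: "'a \<Rightarrow> 'a \<Rightarrow> bool" where
  "cox_adj s t \<longleftrightarrow> s \<noteq> t \<and> (cox_order s t \<ge> 3 \<or> cox_order s t = 0)"

definition cox_connected :: "'a set \<Rightarrow> 'a rel" where
  "cox_connected J =
     {(s, t). s \<in> J \<and> t \<in> J \<and> (s, t) \<in> {(u, v). u \<in> J \<and> v \<in> J \<and> cox_adj u v}\<^sup>*}"

definition irreducible_components :: "'a set \<Rightarrow> 'a set set" where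
  "irreducible_components J = J // cox_connected J"

definition union_of_components :: "'a set \<Rightarrow> 'a set \<Rightarrow> bool" where
  "union_of_components K J \<longleftrightarrow> (\<exists>F \<subseteq> irreducible_components J. K = \<Union>F)"

text \<open>The set written \<open>J\<close> with subscript \<open>\<sim>K\<close>.\<close>

definition components_meeting :: "'a set \<Rightarrow> 'a set \<Rightarrow> 'a set" where
  "components_meeting J K = \<Union>{C \<in> irreducible_components (J \<union> K). C \<inter> K \<noteq> {}}"

text \<open>Vectors of \<open>V\<close> are the functions of finite support contained in \<open>S\<close>, a function listing the
  coordinates with respect to the basis of simple roots.\<close>

definition simple_root :: "'a \<Rightarrow> 'a \<Rightarrow> real" where
  "simple_root s = (\<lambda>t. if t = s then 1 else 0)"

definition cox_matrix_entry :: "'a \<Rightarrow> 'a \<Rightarrow> real" where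
  "cox_matrix_entry s t =
     (if cox_order s t = 0 then - 1 else - cos (pi / real (cox_order s t)))"

definition form :: "('a \<Rightarrow> real) \<Rightarrow> ('a \<Rightarrow> real) \<Rightarrow> real" where
  "form u v = (\<Sum>s | u s \<noteq> 0. \<Sum>t | v t \<noteq> 0. u s * v t * cox_matrix_entry s t)"

definition simple_reflection :: "'a \<Rightarrow> ('a \<Rightarrow> real) \<Rightarrow> 'a \<Rightarrow> real" where
  "simple_reflection s v = (\<lambda>t. v t - 2 * form (simple_root s) v * simple_root s t)"

text \<open>For a Coxeter system the action does not depend on the choice of the word.\<close>

definition act :: "'a \<Rightarrow> ('a \<Rightarrow> real) \<Rightarrow> 'a \<Rightarrow> real" where
  "act w v = foldr simple_reflection (SOME ss. set ss \<subseteq> S \<and> word_prod ss = w) v"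

definition roots :: "('a \<Rightarrow> real) set" where
  "roots = {act w (simple_root s) | w s. w \<in> carrier G \<and> s \<in> S}"

definition pos_roots :: "('a \<Rightarrow> real) set" where
  "pos_roots = {\<gamma> \<in> roots. \<forall>t. 0 \<le> \<gamma> t}"

definition root_reflection :: "('a \<Rightarrow> real) \<Rightarrow> 'a" where
  "root_reflection \<gamma> =
     (THE r. \<exists>w\<in>carrier G. \<exists>s\<in>S. \<gamma> = act w (simple_root s) \<and> r = w \<otimes> s \<otimes> inv w)"


section \<open>The orthogonal part\<close>

definition perp_roots :: "'a set \<Rightarrow> ('a \<Rightarrow> real) set" where
  "perp_roots J = {\<gamma> \<in> roots. \<forall>s\<in>J. form \<gamma> (simple_root s) = 0}"

definition perp_pos_roots :: "'a set \<Rightarrow> ('a \<Rightarrow> real) set" where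
  "perp_pos_roots J = perp_roots J \<inter> pos_roots"

definition perp_group :: "'a set \<Rightarrow> 'a set" where
  "perp_group J = generate G (root_reflection ` perp_roots J)"

text \<open>The set \<open>R\<^sup>J\<close>.\<close>

definition perp_gens :: "'a set \<Rightarrow> 'a set" where
  "perp_gens J = root_reflection `
     {\<gamma> \<in> perp_pos_roots J. \<forall>(n::nat) c \<beta>.
        (\<forall>i<n. c i > (0::real) \<and> \<beta> i \<in> perp_pos_roots J) \<and> \<gamma> = (\<lambda>t. \<Sum>i<n. c i * \<beta> i t)
        \<longrightarrow> (\<forall>i<n. \<beta> i = \<gamma>)}"

definition parabolic_centralizer :: "'a set \<Rightarrow> 'a set" where
  "parabolic_centralizer J = {w \<in> carrier G. \<forall>u \<in> generate G J. w \<otimes> u = u \<otimes> w}"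

text \<open>The set \<open>B\<^sub>I\<close> with a tilde.\<close>

definition B_tilde :: "'a set \<Rightarrow> 'a set" where
  "B_tilde J = {w \<in> parabolic_centralizer J. perp_pos_roots J = act w ` perp_pos_roots J}"


section \<open>Groupoids\<close>

context
  fixes \<Lambda> :: "'l set"
begin

text \<open>Injections are normalised outside \<open>\<Lambda>\<close>, so that equality of functions is equality of maps
  on \<open>\<Lambda>\<close>.\<close>

definition injections :: "('l \<Rightarrow> 'a) set" where
  "injections = {x \<in> \<Lambda> \<rightarrow>\<^sub>E S. inj_on x \<Lambda>}"

definition C_hom :: "('l \<Rightarrow> 'a) \<Rightarrow> ('l \<Rightarrow> 'a) \<Rightarrow> 'a set" where
  "C_hom x y = {w \<in> carrier G. \<forall>l\<in>\<Lambda>. simple_root (x l) = act w (simple_root (y l))}"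

definition Y_hom :: "('l \<Rightarrow> 'a) \<Rightarrow> ('l \<Rightarrow> 'a) \<Rightarrow> 'a set" where
  "Y_hom x y = {w \<in> C_hom x y. act w ` perp_pos_roots (y ` \<Lambda>) \<subseteq> pos_roots}"

text \<open>The tuple \<open>x\<^sup>A\<close>.\<close>

definition twist :: "'l set \<Rightarrow> ('l \<Rightarrow> 'a) \<Rightarrow> 'l \<Rightarrow> 'a" where
  "twist A x = (\<lambda>l\<in>\<Lambda>. w0 (x ` A) \<otimes> x l \<otimes> w0 (x ` A))"

text \<open>An oriented edge is a pair \<open>(x, s)\<close>; it stands for \<open>w\<^sub>x\<^sup>s\<close>.\<close>

definition edge_elt :: "('l \<Rightarrow> 'a) \<times> 'a \<Rightarrow> 'a" where
  "edge_elt = (\<lambda>(x, s). let J = components_meeting (x ` \<Lambda>) {s} in w0 J \<otimes> w0 (J - {s}))"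

text \<open>A path is a start vertex with the list of the edges in the order in which they are
  traversed, so the last edge contributes the leftmost factor to the element represented.\<close>

definition path_elt :: "('l \<Rightarrow> 'a) \<times> (('l \<Rightarrow> 'a) \<times> 'a) list \<Rightarrow> 'a" where
  "path_elt p = foldl (\<lambda>w e. edge_elt e \<otimes> w) \<one> (snd p)"

definition tau ::
  "'l set \<Rightarrow> ('l \<Rightarrow> 'a) \<times> (('l \<Rightarrow> 'a) \<times> 'a) list \<Rightarrow> ('l \<Rightarrow> 'a) \<times> (('l \<Rightarrow> 'a) \<times> 'a) list" where
  "tau A p = (twist A (fst p), map (\<lambda>(y, s). (twist A y, s)) (snd p))"

context
  fixes x\<^sub>I :: "'l \<Rightarrow> 'a"
begin

definition C_verts :: "('l \<Rightarrow> 'a) set" where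
  "C_verts = {x \<in> injections. C_hom x x\<^sub>I \<noteq> {}}"

definition edge_head :: "('l \<Rightarrow> 'a) \<times> 'a \<Rightarrow> 'l \<Rightarrow> 'a" where
  "edge_head e = (THE y. y \<in> C_verts \<and> edge_elt e \<in> C_hom y (fst e))"

definition C_graph :: "('l \<Rightarrow> 'a, ('l \<Rightarrow> 'a) \<times> 'a) pre_digraph" where
  "C_graph = \<lparr>verts = C_verts,
     arcs = {(x, s). x \<in> C_verts \<and> s \<in> S - x ` \<Lambda> \<and> finite_type (components_meeting (x ` \<Lambda>) {s})},
     tail = fst, head = edge_head\<rparr>"

definition edge_rev :: "('l \<Rightarrow> 'a) \<times> 'a \<Rightarrow> ('l \<Rightarrow> 'a) \<times> 'a" where
  "edge_rev e = (edge_head e, THE t. {t} = (fst e ` \<Lambda> \<union> {snd e}) - edge_head e ` \<Lambda>)"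

text \<open>The graph \<open>\<Y>\<^sup>1\<close>.\<close>

definition Y_graph :: "('l \<Rightarrow> 'a, ('l \<Rightarrow> 'a) \<times> 'a) pre_digraph" where
  "Y_graph = C_graph\<lparr>arcs := {e \<in> arcs C_graph. tail C_graph e \<noteq> head C_graph e}\<rparr>"

definition non_backtracking :: "(('l \<Rightarrow> 'a) \<times> 'a) list \<Rightarrow> bool" where
  "non_backtracking es \<longleftrightarrow> (\<forall>i. Suc i < length es \<longrightarrow> es ! Suc i \<noteq> edge_rev (es ! i))"

text \<open>Trees as undirected graphs: each edge is present in both orientations, and traversing an
  edge back and forth is not counted as a cycle.\<close>

definition undirected_tree :: "('l \<Rightarrow> 'a, ('l \<Rightarrow> 'a) \<times> 'a) pre_digraph \<Rightarrow> bool" where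
  "undirected_tree H \<longleftrightarrow> (\<forall>e\<in>arcs H. edge_rev e \<in> arcs H) \<and> strongly_connected H \<and>
     \<not> (\<exists>p. pre_digraph.cycle H p \<and> non_backtracking p)"

definition maximal_tree :: "('l \<Rightarrow> 'a, ('l \<Rightarrow> 'a) \<times> 'a) pre_digraph \<Rightarrow> bool" where
  "maximal_tree T \<longleftrightarrow> pre_digraph.max_subgraph Y_graph undirected_tree T"

definition paths ::
  "('l \<Rightarrow> 'a) \<Rightarrow> ('l \<Rightarrow> 'a) \<Rightarrow> (('l \<Rightarrow> 'a) \<times> (('l \<Rightarrow> 'a) \<times> 'a) list) set" where
  "paths z y = {p. fst p = y \<and> pre_digraph.awalk Y_graph y (snd p) z}"

definition path_end :: "('l \<Rightarrow> 'a) \<times> (('l \<Rightarrow> 'a) \<times> 'a) list \<Rightarrow> 'l \<Rightarrow> 'a" where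
  "path_end p = last (pre_digraph.awalk_verts Y_graph (fst p) (snd p))"

definition backtrack_step ::
  "('l \<Rightarrow> 'a) \<Rightarrow> ('l \<Rightarrow> 'a) \<times> (('l \<Rightarrow> 'a) \<times> 'a) list \<Rightarrow>
     ('l \<Rightarrow> 'a) \<times> (('l \<Rightarrow> 'a) \<times> 'a) list \<Rightarrow> bool" where
  "backtrack_step x p q \<longleftrightarrow> p \<in> paths x x \<and> q \<in> paths x x \<and>
     (\<exists>a e b. snd p = a @ [e, edge_rev e] @ b \<and> snd q = a @ b)"

text \<open>\<open>\<pi>\<^sub>1(\<Y>\<^sup>1; x)\<close>; all intermediate steps of a homotopy are closed paths at \<open>x\<close>.\<close>

definition pi1 :: "('l \<Rightarrow> 'a) \<Rightarrow> (('l \<Rightarrow> 'a) \<times> (('l \<Rightarrow> 'a) \<times> 'a) list) set set" where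
  "pi1 x = paths x x // {(p, q). p \<in> paths x x \<and> q \<in> paths x x \<and> equivclp (backtrack_step x) p q}"

text \<open>The group \<open>\<A>\<close> with a tilde.\<close>

definition A_tilde :: "'l set monoid" where
  "A_tilde = \<lparr>carrier = {A. A \<subseteq> \<Lambda> \<and> finite_type (x\<^sub>I ` A) \<and>
       union_of_components (x\<^sub>I ` A) (x\<^sub>I ` \<Lambda>) \<and> twist A x\<^sub>I \<in> C_verts},
     monoid.mult = (\<lambda>A B. sym_diff A B), one = {}\<rparr>"

definition A_map :: "'a \<Rightarrow> 'l set" where
  "A_map w = {l \<in> \<Lambda>. act w (simple_root (x\<^sub>I l)) = (\<lambda>t. - simple_root (x\<^sub>I l) t)}"

context
  fixes T :: "('l \<Rightarrow> 'a, ('l \<Rightarrow> 'a) \<times> 'a) pre_digraph"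
begin

text \<open>The path \<open>p\<^bsub>z,y\<^esub>\<close> from \<open>y\<close> to \<open>z\<close>.\<close>

definition tree_path :: "('l \<Rightarrow> 'a) \<Rightarrow> ('l \<Rightarrow> 'a) \<Rightarrow> ('l \<Rightarrow> 'a) \<times> (('l \<Rightarrow> 'a) \<times> 'a) list" where
  "tree_path z y = (y, THE es. pre_digraph.awalk T y es z \<and> non_backtracking es)"

text \<open>The closed path \<open>q\<^bsub>(x)\<^esub>\<close>: first to the start of \<open>q\<close>, then along \<open>q\<close>, then back to \<open>x\<close>.\<close>

definition based_loop ::
  "('l \<Rightarrow> 'a) \<Rightarrow> ('l \<Rightarrow> 'a) \<times> (('l \<Rightarrow> 'a) \<times> 'a) list \<Rightarrow>
     ('l \<Rightarrow> 'a) \<times> (('l \<Rightarrow> 'a) \<times> 'a) list" where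
  "based_loop x q = (x, snd (tree_path (fst q) x) @ snd q @ snd (tree_path x (path_end q)))"

definition g_elt :: "'l set \<Rightarrow> 'a" where
  "g_elt A = path_elt (tree_path x\<^sub>I (twist A x\<^sub>I)) \<otimes> w0 (x\<^sub>I ` A)"

end

end

end

end


section \<open>Exact sequences, semidirect products, automorphisms\<close>

text \<open>\<open>1 \<rightarrow> N \<rightarrow> H \<rightarrow> Q \<rightarrow> 1\<close> with maps \<open>i\<close> and \<open>p\<close>; the library's \<^const>\<open>exact_seq\<close> requires all
  groups to have elements of the same type.\<close>

definition short_exact ::
  "('a, 'b) monoid_scheme \<Rightarrow> ('a \<Rightarrow> 'c) \<Rightarrow> ('c, 'd) monoid_scheme \<Rightarrow> ('c \<Rightarrow> 'e) \<Rightarrow>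
     ('e, 'f) monoid_scheme \<Rightarrow> bool" where
  "short_exact N i H p Q \<longleftrightarrow> group N \<and> group H \<and> group Q \<and> i \<in> mon N H \<and> p \<in> epi H Q \<and>
     kernel H Q p = i ` carrier N"

definition internal_semidirect :: "('a, 'b) monoid_scheme \<Rightarrow> 'a set \<Rightarrow> 'a set \<Rightarrow> bool" where
  "internal_semidirect H N K \<longleftrightarrow> N \<lhd> H \<and> subgroup K H \<and> N \<inter> K = {\<one>\<^bsub>H\<^esub>} \<and>
     N <#>\<^bsub>H\<^esub> K = carrier H"

definition coxeter_automorphism ::
  "('a, 'b) monoid_scheme \<Rightarrow> 'a set \<Rightarrow> ('a \<Rightarrow> 'a) \<Rightarrow> bool" where
  "coxeter_automorphism H R f \<longleftrightarrow> f \<in> iso H H \<and> f ` R = R"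

end

theory Submission
  imports Defs
begin

text \<open>
  An element of the centralizer of \<open>W\<^sub>I\<close> sends every \<open>\<alpha>\<^sub>s\<close>, \<open>s \<in> I\<close>, to \<open>\<plusminus>\<alpha>\<^sub>s\<close>; the set of
  negative signs is a union of components, and it is of finite type because an element has only
  finitely many inversions.  Since \<open>w\<^sub>0(x\<^sub>A)\<close> is carried to \<open>w\<^sub>0(y\<^sub>A)\<close> by the elements of
  \<open>C\<^bsub>y,x\<^esub>\<close>, the automorphism \<open>\<tau>\<^sub>A\<close> does not change the group element represented by a path, and
  \<open>w\<^sub>0(x\<^sub>A)\<close> commutes with all tree paths between twists of \<open>x\<^sub>I\<close>; this makes the equalities for
  \<open>g\<^sub>A\<close> computations with commuting factors.  For the tree to reach all twists the graph must be
  connected: if \<open>w\<close> is in \<open>C\<^bsub>x,y\<^esub>\<close> and \<open>w \<alpha>\<^sub>s\<close> is negative, then the parabolic factor of \<open>w\<close> in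
  \<open>W\<close> of \<open>[y] \<union> {s}\<close> is \<open>w\<^sub>y\<^sup>s\<close>, and one inducts on the length.  The semidirect decomposition needs
  that an element of a reflection subgroup without inversions among its own roots is trivial, which
  follows from the exchange argument for Dyer's canonical generators.
\<close>

text \<open>Elements of W are mostly identified by one device: an element without inversions is the
  identity. For parabolic subgroups and for reflection subgroups it comes from the single exchange
  argument \<open>refl_exchange\<close>.

  Its main use is a characterization of \<open>w_y^s\<close>: this is the only element of the
  parabolic subgroup of [y] and s that sends the simple roots of [y] to simple roots and makes
  \<alpha>_s negative (\<open>edge_conj_unique\<close>). The splitting of edges, their reversal and
  the following point rest on it.

  Deleting loops is what puts g_A into \<open>B_tilde\<close>. If \<open>w_y^s\<close> makes a
  positive root \<gamma> orthogonal to [y] negative, then the reflection in \<gamma> lies in that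
  parabolic subgroup and has the characterizing properties; so \<open>w_y^s\<close> is this
  reflection, it fixes the entries of y, and the edge is a loop. The remaining edges, and with them
  all tree paths, keep orthogonal positive roots positive.\<close>

locale coxeter =
  fixes G :: "('a, 'b) monoid_scheme" (structure) and S :: "'a set"
  assumes coxeter_system: "coxeter_system G S"

sublocale coxeter \<subseteq> group G
  using coxeter_system by (simp add: coxeter_system_def)

section \<open>Words, parity and length\<close>

context coxeter
begin

lemma gen_closed [simp]: "s \<in> S \<Longrightarrow> s \<in> carrier G"
  using coxeter_system by (auto simp: coxeter_system_def)

lemma S_subset_carrier: "S \<subseteq> carrier G"
  by auto

lemma generate_S: "generate G S = carrier G"
  using coxeter_system by (simp add: coxeter_system_def)

lemma gen_square [simp]: "s \<in> S \<Longrightarrow> s \<otimes> s = \<one>"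
proof -
  assume s: "s \<in> S"
  then have "ord s = 2"
    using coxeter_system by (simp add: coxeter_system_def)
  then have "s [^] (2::nat) = \<one>"
    using s pow_eq_id[of s 2] by simp
  then show ?thesis
    using s by (simp add: numeral_2_eq_2)
qed

lemma gen_inv [simp]: "s \<in> S \<Longrightarrow> inv s = s"
  by (simp add: inv_equality)

lemma gen_cancel_left [simp]: "s \<in> S \<Longrightarrow> w \<in> carrier G \<Longrightarrow> s \<otimes> (s \<otimes> w) = w"
  by (simp add: m_assoc[symmetric])

lemma gen_cancel_right [simp]: "s \<in> S \<Longrightarrow> w \<in> carrier G \<Longrightarrow> w \<otimes> s \<otimes> s = w"
  by (simp add: m_assoc)

lemma inv_cancel_left [simp]:
  "w \<in> carrier G \<Longrightarrow> u \<in> carrier G \<Longrightarrow> inv w \<otimes> (w \<otimes> u) = u"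
  "w \<in> carrier G \<Longrightarrow> u \<in> carrier G \<Longrightarrow> w \<otimes> (inv w \<otimes> u) = u"
  by (simp_all add: m_assoc[symmetric])

lemma word_prod_Nil [simp]: "word_prod G [] = \<one>"
  by (simp add: word_prod_def)

lemma word_prod_Cons [simp]: "word_prod G (s # ss) = s \<otimes> word_prod G ss"
  by (simp add: word_prod_def)

lemma word_prod_closed [simp]: "set ss \<subseteq> carrier G \<Longrightarrow> word_prod G ss \<in> carrier G"
  by (induction ss) auto

lemma word_prod_closed_S [simp]: "set ss \<subseteq> S \<Longrightarrow> word_prod G ss \<in> carrier G"
  using S_subset_carrier by (intro word_prod_closed) blast

lemma word_prod_append [simp]:
  "set ss \<subseteq> carrier G \<Longrightarrow> set ts \<subseteq> carrier G \<Longrightarrow>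
     word_prod G (ss @ ts) = word_prod G ss \<otimes> word_prod G ts"
  by (induction ss) (auto simp: m_assoc)

lemma word_prod_append_S [simp]:
  "set ss \<subseteq> S \<Longrightarrow> set ts \<subseteq> S \<Longrightarrow> word_prod G (ss @ ts) = word_prod G ss \<otimes> word_prod G ts"
  using S_subset_carrier by (intro word_prod_append) blast+

lemma word_prod_rev: "set ss \<subseteq> S \<Longrightarrow> word_prod G (rev ss) = inv (word_prod G ss)"
  by (induction ss) (auto simp: inv_mult_group)

text \<open>Any set of involutions is allowed, since sets of reflections are described by words in
  the same way (\<open>generate_refl\<close>).\<close>

lemma generate_involution_words:
  assumes J: "J \<subseteq> carrier G" "\<And>s. s \<in> J \<Longrightarrow> s \<otimes> s = \<one>"
  shows "generate G J = word_prod G ` {ss. set ss \<subseteq> J}"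
proof (intro equalityI subsetI)
  fix w assume "w \<in> generate G J"
  then show "w \<in> word_prod G ` {ss. set ss \<subseteq> J}"
  proof induction
    case one
    show ?case by (rule image_eqI[of _ _ "[]"]) auto
  next
    case (incl h)
    then show ?case using J by (intro image_eqI[of _ _ "[h]"]) auto
  next
    case (inv h)
    then have "inv h = h" using J inv_equality[of h h] by blast
    then show ?case using inv J by (intro image_eqI[of _ _ "[h]"]) auto
  next
    case (eng h1 h2)
    then obtain u v where uv: "h1 = word_prod G u" "h2 = word_prod G v" "set u \<subseteq> J" "set v \<subseteq> J"
      by blast
    then have "set u \<subseteq> carrier G" "set v \<subseteq> carrier G" using J by auto
    then show ?case using uv by (intro image_eqI[of _ _ "u @ v"]) auto
  qed
next
  fix w assume "w \<in> word_prod G ` {ss. set ss \<subseteq> J}"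
  then obtain ss where "w = word_prod G ss" "set ss \<subseteq> J" by blast
  then show "w \<in> generate G J"
    by (induction ss arbitrary: w) (auto intro: generate.intros)
qed

lemma generate_words: "J \<subseteq> S \<Longrightarrow> generate G J = word_prod G ` {ss. set ss \<subseteq> J}"
  by (intro generate_involution_words) auto

lemma word_of:
  assumes "w \<in> carrier G"
  obtains ss where "set ss \<subseteq> S" "word_prod G ss = w"
  using assms generate_words[of S] generate_S by auto

lemma word_induct [consumes 1, case_names one mult]:
  assumes "w \<in> carrier G" "P \<one>" "\<And>s w. s \<in> S \<Longrightarrow> w \<in> carrier G \<Longrightarrow> P w \<Longrightarrow> P (s \<otimes> w)"
  shows "P w"
proof -
  obtain ss where "set ss \<subseteq> S" "word_prod G ss = w" using assms(1) word_of by blast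
  then show ?thesis
    by (induction ss arbitrary: w) (use assms(2,3) in auto)
qed

text \<open>A relator has length 2m, so deleting one keeps the parity.\<close>

lemma relator_step_parity: "relator_step G S u v \<Longrightarrow> even (length u) = even (length v)"
  unfolding relator_step_def by (auto simp: length_concat sum_list_replicate)

text \<open>The sign character in terms of words: the presentation connects the word
  \<open>u @ rev v\<close> for the identity with the empty word by steps that preserve
  parity.\<close>

lemma word_prod_parity:
  assumes "set u \<subseteq> S" "set v \<subseteq> S" "word_prod G u = word_prod G v"
  shows "even (length u) = even (length v)"
proof -
  have "word_prod G (u @ rev v) = \<one>"
    using assms by (simp add: word_prod_rev)
  then have "equivclp (relator_step G S) (u @ rev v) []"
    using coxeter_system assms by (auto simp: coxeter_system_def)
  then have "even (length (u @ rev v)) = even (length ([] :: 'a list))"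
    by (induction rule: equivclp_induct) (use relator_step_parity in blast)+
  then show ?thesis by simp
qed

abbreviation len :: "'a \<Rightarrow> nat" where
  "len \<equiv> cox_length G S"

lemma len_le: "set ss \<subseteq> S \<Longrightarrow> len (word_prod G ss) \<le> length ss"
  unfolding cox_length_def by (rule Least_le) blast

lemma reduced_word:
  assumes "w \<in> carrier G"
  obtains ss where "set ss \<subseteq> S" "word_prod G ss = w" "length ss = len w"
proof -
  obtain ss where "set ss \<subseteq> S" "word_prod G ss = w" using assms word_of by blast
  then have "\<exists>n ss. set ss \<subseteq> S \<and> word_prod G ss = w \<and> length ss = n" by blast
  from LeastI_ex[OF this] show ?thesis
    using that unfolding cox_length_def by blast
qed

lemma len_mult_le:
  assumes "u \<in> carrier G" "v \<in> carrier G"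
  shows "len (u \<otimes> v) \<le> len u + len v"
proof -
  obtain a b where "set a \<subseteq> S" "word_prod G a = u" "length a = len u"
    "set b \<subseteq> S" "word_prod G b = v" "length b = len v"
    using assms reduced_word by metis
  then show ?thesis using len_le[of "a @ b"] by simp
qed

lemma len_gen: "s \<in> S \<Longrightarrow> len s \<le> 1"
  using len_le[of "[s]"] by simp

lemma len_one [simp]: "len \<one> = 0"
  using len_le[of "[]"] by simp

lemma len_mult_gen_le: "w \<in> carrier G \<Longrightarrow> s \<in> S \<Longrightarrow> len (w \<otimes> s) \<le> Suc (len w)"
  using len_mult_le[of w s] len_gen[of s] by simp

text \<open>Equality would give two words for one element with lengths of different parity.\<close>

lemma len_mult_gen_ne:
  assumes "w \<in> carrier G" "s \<in> S"
  shows "len (w \<otimes> s) \<noteq> len w"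
proof -
  obtain a b where a: "set a \<subseteq> S" "word_prod G a = w" "length a = len w"
    and b: "set b \<subseteq> S" "word_prod G b = w \<otimes> s" "length b = len (w \<otimes> s)"
    using assms reduced_word[of w] reduced_word[of "w \<otimes> s"] by (metis gen_closed m_closed)
  have "even (length (a @ [s])) = even (length b)"
    using a b assms by (intro word_prod_parity) auto
  then show ?thesis using a b by auto
qed

lemma descent_exists:
  assumes "w \<in> carrier G" "w \<noteq> \<one>"
  obtains v t where "v \<in> carrier G" "t \<in> S" "w = v \<otimes> t" "len w = Suc (len v)"
proof -
  obtain ss where ss: "set ss \<subseteq> S" "word_prod G ss = w" "length ss = len w"
    using assms reduced_word by blast
  then have "ss \<noteq> []" using assms by auto
  then obtain a t where a: "ss = a @ [t]" by (cases ss rule: rev_exhaust) auto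
  then have v: "word_prod G a \<in> carrier G" "t \<in> S" "w = word_prod G a \<otimes> t"
    using ss by auto
  have "len (word_prod G a) \<le> length a" using ss a by (intro len_le) auto
  moreover have "len w \<le> Suc (len (word_prod G a))" using v len_mult_gen_le by simp
  ultimately show ?thesis using that[of "word_prod G a" t] v ss a by simp
qed

lemma cox_order_self [simp]: "s \<in> S \<Longrightarrow> cox_order G s s = 1"
  by (simp add: cox_order_def ord_eq_1 del: One_nat_def)

lemma cox_order_commute:
  assumes "s \<in> S" "t \<in> S"
  shows "cox_order G s t = cox_order G t s"
proof -
  have "inv (s \<otimes> t) = t \<otimes> s" using assms by (simp add: inv_mult_group)
  then show ?thesis unfolding cox_order_def using ord_inv[of "s \<otimes> t"] assms by simp
qed

lemma cox_order_eq_1_iff: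
  assumes "s \<in> S" "t \<in> S"
  shows "cox_order G s t = 1 \<longleftrightarrow> s = t"
proof
  assume "cox_order G s t = 1"
  then have "s \<otimes> t = \<one>" using assms by (simp add: cox_order_def ord_eq_1 del: One_nat_def)
  then have "s = inv t" using assms inv_equality[of s t] by simp
  then show "s = t" using assms by simp
qed (use assms in simp)

lemma cox_pow:
  assumes "s \<in> S" "t \<in> S"
  shows "(s \<otimes> t) [^] cox_order G s t = \<one>"
  using assms by (simp add: cox_order_def)

end

section \<open>The geometric representation\<close>

text \<open>Vectors are arbitrary functions, and a \<open>sum\<close> over an infinite set is 0;
  bilinearity of \<open>form\<close> and linearity of the action therefore carry finite support as a
  hypothesis.\<close>

definition fin_supp :: "('a \<Rightarrow> real) \<Rightarrow> bool" where
  "fin_supp v \<longleftrightarrow> finite {t. v t \<noteq> 0}"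

text \<open>Together with \<open>fin_supp\<close> this is the span of the simple roots indexed by
  \<open>J\<close>: for \<open>J = S\<close> the space on which \<open>form\<close> is shown to be
  symmetric, for smaller \<open>J\<close> the space preserved by the parabolic subgroup.\<close>

definition supp_in :: "'a set \<Rightarrow> ('a \<Rightarrow> real) \<Rightarrow> bool" where
  "supp_in J v \<longleftrightarrow> (\<forall>t. v t \<noteq> 0 \<longrightarrow> t \<in> J)"

lemma fin_supp_simple_root [simp]: "fin_supp (simple_root s)"
  by (simp add: fin_supp_def simple_root_def)

lemma supp_in_simple_root [simp]: "s \<in> J \<Longrightarrow> supp_in J (simple_root s)"
  by (simp add: supp_in_def simple_root_def)

lemma simple_root_inject [simp]: "simple_root s = simple_root t \<longleftrightarrow> s = t"
  by (auto simp: simple_root_def fun_eq_iff split: if_splits)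

lemma simple_root_self [simp]: "simple_root s s = 1"
  by (simp add: simple_root_def)

lemma simple_root_nonneg [simp]: "0 \<le> simple_root s t"
  by (simp add: simple_root_def)

lemma fin_supp_lin:
  assumes "fin_supp u" "fin_supp v"
  shows "fin_supp (\<lambda>t. a * u t + b * v t)"
  unfolding fin_supp_def
  by (rule finite_subset[of _ "{t. u t \<noteq> 0} \<union> {t. v t \<noteq> 0}"])
    (use assms in \<open>auto simp: fin_supp_def\<close>)

lemma fin_supp_neg [simp]: "fin_supp (\<lambda>t. - v t) \<longleftrightarrow> fin_supp v"
  by (simp add: fin_supp_def)

lemma supp_in_neg [simp]: "supp_in J (\<lambda>t. - v t) \<longleftrightarrow> supp_in J v"
  by (simp add: supp_in_def)

lemma fin_supp_sum:
  assumes "finite F" "\<And>i. i \<in> F \<Longrightarrow> fin_supp (f i)"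
  shows "fin_supp (\<lambda>t. \<Sum>i\<in>F. c i * f i t)"
proof -
  have "{t. (\<Sum>i\<in>F. c i * f i t) \<noteq> 0} \<subseteq> (\<Union>i\<in>F. {t. f i t \<noteq> 0})"
  proof
    fix t assume "t \<in> {t. (\<Sum>i\<in>F. c i * f i t) \<noteq> 0}"
    then obtain i where "i \<in> F" "c i * f i t \<noteq> 0"
      using sum.not_neutral_contains_not_neutral[of "\<lambda>i. c i * f i t" F] by auto
    then show "t \<in> (\<Union>i\<in>F. {t. f i t \<noteq> 0})" by auto
  qed
  then show ?thesis
    using assms finite_subset unfolding fin_supp_def by blast
qed

lemma fin_supp_expand:
  assumes "finite F" "\<And>t. v t \<noteq> 0 \<Longrightarrow> t \<in> F"
  shows "v = (\<lambda>x. \<Sum>t\<in>F. v t * simple_root t x)"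
proof
  fix x
  have "(\<Sum>t\<in>F. v t * simple_root t x) = (\<Sum>t\<in>F. if t = x then v x else 0)"
    by (rule sum.cong) (auto simp: simple_root_def)
  also have "\<dots> = v x"
    using assms by (auto simp: sum.delta)
  finally show "v x = (\<Sum>t\<in>F. v t * simple_root t x)" ..
qed

text \<open>Two vectors and their sum have different supports; enlarged index sets let all the sums
  in a linearity proof range over the same set.\<close>

lemma form_eq_sum:
  assumes "finite F" "\<And>s. u s \<noteq> 0 \<Longrightarrow> s \<in> F" "finite F'" "\<And>s. v s \<noteq> 0 \<Longrightarrow> s \<in> F'"
  shows "form G u v = (\<Sum>s\<in>F. \<Sum>t\<in>F'. u s * v t * cox_matrix_entry G s t)"
proof -
  have "form G u v = (\<Sum>s | u s \<noteq> 0. \<Sum>t\<in>F'. u s * v t * cox_matrix_entry G s t)"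
    unfolding form_def using assms
    by (intro sum.cong sum.mono_neutral_left) auto
  also have "\<dots> = (\<Sum>s\<in>F. \<Sum>t\<in>F'. u s * v t * cox_matrix_entry G s t)"
    using assms by (intro sum.mono_neutral_left) auto
  finally show ?thesis .
qed

lemma form_lin_right:
  assumes "fin_supp u" "fin_supp v" "fin_supp v'"
  shows "form G u (\<lambda>t. a * v t + b * v' t) = a * form G u v + b * form G u v'"
proof -
  let ?F = "{t. u t \<noteq> 0}" and ?F' = "{t. v t \<noteq> 0} \<union> {t. v' t \<noteq> 0}"
  have f: "finite ?F" "finite ?F'" using assms by (auto simp: fin_supp_def)
  show ?thesis
    by (subst (1 2 3) form_eq_sum[where F = ?F and F' = ?F'])
      (use f in \<open>auto simp: sum_distrib_left sum.distrib[symmetric] algebra_simps\<close>)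
qed

lemma form_lin_left:
  assumes "fin_supp u" "fin_supp v" "fin_supp v'"
  shows "form G (\<lambda>t. a * v t + b * v' t) u = a * form G v u + b * form G v' u"
proof -
  let ?F = "{t. u t \<noteq> 0}" and ?F' = "{t. v t \<noteq> 0} \<union> {t. v' t \<noteq> 0}"
  have f: "finite ?F" "finite ?F'" using assms by (auto simp: fin_supp_def)
  show ?thesis
    by (subst (1 2 3) form_eq_sum[where F = ?F' and F' = ?F])
      (use f in \<open>auto simp: sum_distrib_left sum.distrib[symmetric] algebra_simps\<close>)
qed

lemma form_neg_right: "form G u (\<lambda>t. - v t) = - form G u v"
  by (simp add: form_def sum_negf)

lemma form_neg_left: "form G (\<lambda>t. - v t) u = - form G v u"
  by (simp add: form_def sum_negf)

lemma form_simple [simp]: "form G (simple_root s) (simple_root t) = cox_matrix_entry G s t"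
  by (subst form_eq_sum[where F = "{s}" and F' = "{t}"])
    (auto simp: simple_root_def split: if_splits)

lemma fin_supp_reflection [simp]: "fin_supp v \<Longrightarrow> fin_supp (simple_reflection G s v)"
  using fin_supp_lin[of v "simple_root s" 1 "- 2 * form G (simple_root s) v"]
  by (simp add: simple_reflection_def)

lemma reflection_lin:
  assumes "fin_supp u" "fin_supp v"
  shows "simple_reflection G s (\<lambda>t. a * u t + b * v t) =
    (\<lambda>t. a * simple_reflection G s u t + b * simple_reflection G s v t)"
  using assms by (simp add: simple_reflection_def form_lin_right algebra_simps)

lemma supp_in_reflection: "s \<in> J \<Longrightarrow> supp_in J v \<Longrightarrow> supp_in J (simple_reflection G s v)"
  unfolding supp_in_def simple_reflection_def simple_root_def by auto

text \<open>\<open>act\<close> picks a word by \<open>SOME\<close>. Facts are shown for arbitrary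
  words first and carried over to group elements by \<open>act_word_prod\<close>.\<close>

definition refl_word :: "('a, 'b) monoid_scheme \<Rightarrow> 'a list \<Rightarrow> ('a \<Rightarrow> real) \<Rightarrow> 'a \<Rightarrow> real" where
  "refl_word G ss v = foldr (simple_reflection G) ss v"

lemma refl_word_simps [simp]:
  "refl_word G [] v = v"
  "refl_word G (s # ss) v = simple_reflection G s (refl_word G ss v)"
  "refl_word G (ss @ ts) v = refl_word G ss (refl_word G ts v)"
  by (auto simp: refl_word_def)

lemma fin_supp_refl_word [simp]: "fin_supp v \<Longrightarrow> fin_supp (refl_word G ss v)"
  by (induction ss) auto

lemma refl_word_lin:
  assumes "fin_supp u" "fin_supp v"
  shows "refl_word G ss (\<lambda>t. a * u t + b * v t) =
    (\<lambda>t. a * refl_word G ss u t + b * refl_word G ss v t)"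
  using assms by (induction ss) (auto simp: reflection_lin)

lemma supp_in_refl_word: "set ss \<subseteq> J \<Longrightarrow> supp_in J v \<Longrightarrow> supp_in J (refl_word G ss v)"
  by (induction ss) (auto simp: supp_in_reflection)

text \<open>Read \<open>e\<close> and \<open>d\<close> as exp(i\<theta>) and exp(-i\<theta>), so
  that \<open>e + d\<close> is 2 cos \<theta>: the left side is the value of a + e b after one
  application of the product of two simple reflections, the right side its multiple by
  exp(2i\<theta>).\<close>

lemma braid_identity:
  fixes e d a b :: complex
  assumes "e * d = 1"
  shows "- a - (e + d) * b + e * ((e + d) * a + ((e + d)\<^sup>2 - 1) * b) = e * e * (a + e * b)"
proof -
  have "- a - (e + d) * b + e * ((e + d) * a + ((e + d)\<^sup>2 - 1) * b) =
      e * e * (a + e * b) + (e * d - 1) * (a + 2 * e * b + d * b)"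
    by (simp add: power2_eq_square algebra_simps)
  then show ?thesis using assms by simp
qed

section \<open>The defining relations act trivially; the action and the invariance of the
  form\<close>

context coxeter
begin

abbreviation B :: "'a \<Rightarrow> ('a \<Rightarrow> real) \<Rightarrow> real" where
  "B s v \<equiv> form G (simple_root s) v"

lemma entry_self [simp]: "s \<in> S \<Longrightarrow> cox_matrix_entry G s s = 1"
  by (simp add: cox_matrix_entry_def)

lemma entry_commute: "s \<in> S \<Longrightarrow> t \<in> S \<Longrightarrow> cox_matrix_entry G s t = cox_matrix_entry G t s"
  by (simp add: cox_matrix_entry_def cox_order_commute)

lemma form_commute:
  assumes "fin_supp u" "fin_supp v" "supp_in S u" "supp_in S v"
  shows "form G u v = form G v u"
proof -
  have "form G u v = (\<Sum>s | u s \<noteq> 0. \<Sum>t | v t \<noteq> 0. v t * u s * cox_matrix_entry G t s)"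
    unfolding form_def using assms
    by (intro sum.cong refl) (auto simp: supp_in_def entry_commute)
  also have "\<dots> = form G v u"
    unfolding form_def by (rule sum.swap)
  finally show ?thesis .
qed

lemma B_reflection:
  "fin_supp v \<Longrightarrow> B t (simple_reflection G s v) = B t v - 2 * B s v * cox_matrix_entry G t s"
  using form_lin_right[of "simple_root t" v "simple_root s" G 1 "- 2 * B s v"]
  by (simp add: simple_reflection_def)

lemma reflection_invol:
  assumes "s \<in> S" "fin_supp v"
  shows "simple_reflection G s (simple_reflection G s v) = v"
  by (subst simple_reflection_def)
    (use assms in \<open>simp add: B_reflection\<close>, simp add: simple_reflection_def)

lemma reflection_simple: "s \<in> S \<Longrightarrow> simple_reflection G s (simple_root s) = (\<lambda>t. - simple_root s t)"
  by (simp add: simple_reflection_def)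

text \<open>With \<open>a = \<langle>\<alpha>\<^sub>s, v\<rangle>\<close>, \<open>b = \<langle>\<alpha>\<^sub>t, v\<rangle>\<close> the number \<open>a + exp (i\<theta>) b\<close> is multiplied by
  \<open>exp (2i\<theta>)\<close> by \<open>\<sigma>\<^sub>s \<sigma>\<^sub>t\<close>, so its sum over a full period vanishes.\<close>

lemma reflection_braid:
  assumes s: "s \<in> S" and t: "t \<in> S" and ne: "cox_order G s t \<noteq> 0" and v: "fin_supp v"
  shows "refl_word G (concat (replicate (cox_order G s t) [s, t])) v = v"
proof (cases "s = t")
  case True
  then show ?thesis using assms by (simp add: reflection_invol)
next
  case False
  define m where "m = cox_order G s t"
  have m2: "m \<ge> 2"
    using False ne cox_order_eq_1_iff[OF s t] unfolding m_def by linarith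
  define \<theta> where "\<theta> = pi / real m"
  define c where "c = cos \<theta>"
  have st: "cox_matrix_entry G s t = - c" "cox_matrix_entry G t s = - c"
    using ne entry_commute[OF s t] by (auto simp: cox_matrix_entry_def c_def \<theta>_def m_def)
  define f where "f k = refl_word G (concat (replicate k [s, t])) v" for k
  define a where "a k = B s (f k)" for k
  define b where "b k = B t (f k)" for k
  have fs: "fin_supp (f k)" for k unfolding f_def using v by simp
  have f0: "f 0 = v" by (simp add: f_def)
  have "replicate (Suc k) [s, t] = [s, t] # replicate k [s, t]" for k by simp
  then have fS: "f (Suc k) = simple_reflection G s (simple_reflection G t (f k))" for k
    by (simp add: f_def)
  have fS': "f (Suc k) = (\<lambda>x. f k x - 2 * b k * simple_root t x
      - 2 * (a k + 2 * c * b k) * simple_root s x)" for k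
    unfolding fS using fs[of k]
    by (subst simple_reflection_def)
      (simp add: B_reflection st, simp add: simple_reflection_def a_def b_def algebra_simps)
  have aS: "a (Suc k) = - a k - 2 * c * b k" for k
    using fs s t by (simp add: a_def b_def fS B_reflection st)
  have bS: "b (Suc k) = 2 * c * a k + (4 * c\<^sup>2 - 1) * b k" for k
    using fs s t by (simp add: a_def b_def fS B_reflection st power2_eq_square algebra_simps)
  \<comment> \<open>Only partial sums of \<open>a\<close> and \<open>b\<close> enter, so it remains
    to see that both sums vanish for \<open>n = m\<close>.\<close>
  have fn: "f n = (\<lambda>x. v x - 2 * (\<Sum>k<n. b k) * simple_root t x
      - 2 * ((\<Sum>k<n. a k) + 2 * c * (\<Sum>k<n. b k)) * simple_root s x)" for n
  proof (induction n)
    case (Suc n)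
    show ?case by (subst fS', subst Suc) (simp add: algebra_simps)
  qed (simp add: f0)
  define z where "z k = complex_of_real (a k) + cis \<theta> * complex_of_real (b k)" for k
  have c_cis: "2 * complex_of_real c = cis \<theta> + cis (- \<theta>)"
    by (simp add: complex_eq_iff c_def)
  have zS: "z (Suc k) = cis (2 * \<theta>) * z k" for k
  proof -
    let ?e = "cis \<theta>" and ?d = "cis (- \<theta>)"
    have ed: "?e * ?d = 1" "?d * ?e = 1" by (simp_all add: cis_mult)
    have e2: "cis (2 * \<theta>) = ?e * ?e" by (simp add: cis_mult)
    have "z (Suc k) = - a k - (2 * complex_of_real c) * b k
        + ?e * ((2 * complex_of_real c) * a k + ((2 * complex_of_real c)\<^sup>2 - 1) * b k)"
      by (simp add: z_def aS bS power2_eq_square algebra_simps)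
    also have "\<dots> = ?e * ?e * z k"
      unfolding c_cis z_def using braid_identity[OF ed(1), of "a k" "b k"] by simp
    finally show ?thesis using e2 by simp
  qed
  have zn: "z k = cis (2 * \<theta>) ^ k * z 0" for k
    by (induction k) (auto simp: zS)
  have "cis (2 * \<theta>) ^ m = 1"
    using m2 by (simp add: DeMoivre \<theta>_def) 
  moreover have "cis (2 * \<theta>) \<noteq> 1"
  proof
    assume "cis (2 * \<theta>) = 1"
    then have "cos (2 * \<theta>) = 1" by (simp add: complex_eq_iff)
    then have "sin \<theta> = 0" by (simp add: cos_double_sin)
    moreover have "0 < \<theta>" "\<theta> < pi"
      using m2 by (auto simp: \<theta>_def field_simps)
    ultimately show False using sin_gt_zero[of \<theta>] by simp
  qed
  ultimately have "(\<Sum>k<m. cis (2 * \<theta>) ^ k) = 0"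
    by (simp add: geometric_sum)
  then have "(\<Sum>k<m. z k) = 0"
    by (subst zn) (simp add: sum_distrib_right[symmetric])
  \<comment> \<open>The imaginary part makes the sum of \<open>b\<close> vanish, because sin
    \<theta> is nonzero; the real part then does the same for \<open>a\<close>.\<close>
  then have z0: "complex_of_real (\<Sum>k<m. a k) + cis \<theta> * complex_of_real (\<Sum>k<m. b k) = 0"
    by (simp add: z_def sum.distrib sum_distrib_left)
  have "0 < \<theta>" "\<theta> < pi"
    using m2 by (auto simp: \<theta>_def field_simps)
  then have "sin \<theta> \<noteq> 0" using sin_gt_zero[of \<theta>] by simp
  then have bsum: "(\<Sum>k<m. b k) = 0"
    using z0 by (simp add: complex_eq_iff)
  then have asum: "(\<Sum>k<m. a k) = 0"
    using z0 by (simp add: complex_eq_iff)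
  show ?thesis
    using fn[of m] asum bsum by (simp add: f_def m_def)
qed

lemma relator_step_refl_word:
  assumes "relator_step G S u v" "fin_supp x"
  shows "refl_word G u x = refl_word G v x"
  using assms unfolding relator_step_def by (auto simp: reflection_braid)

lemma refl_word_one:
  assumes "set u \<subseteq> S" "word_prod G u = \<one>" "fin_supp x"
  shows "refl_word G u x = x"
proof -
  have "equivclp (relator_step G S) u []"
    using assms coxeter_system by (simp add: coxeter_system_def)
  then have "refl_word G u x = refl_word G [] x"
    by (induction rule: equivclp_induct) (use relator_step_refl_word assms(3) in metis)+
  then show ?thesis by simp
qed

lemma refl_word_rev: "set ss \<subseteq> S \<Longrightarrow> fin_supp v \<Longrightarrow> refl_word G (rev ss) (refl_word G ss v) = v"
  by (induction ss) (auto simp: reflection_invol)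

abbreviation act_on :: "'a \<Rightarrow> ('a \<Rightarrow> real) \<Rightarrow> 'a \<Rightarrow> real"  (infixr "\<bullet>" 75) where
  "w \<bullet> v \<equiv> act G S w v"

text \<open>Independence of the word: \<open>ss\<close> followed by the reverse of the chosen word
  represents the identity, and by the presentation such a word acts trivially.\<close>

lemma act_word_prod:
  assumes ss: "set ss \<subseteq> S" and v: "fin_supp v"
  shows "word_prod G ss \<bullet> v = refl_word G ss v"
proof -
  define ts where "ts = (SOME ts. set ts \<subseteq> S \<and> word_prod G ts = word_prod G ss)"
  have ts: "set ts \<subseteq> S \<and> word_prod G ts = word_prod G ss"
    unfolding ts_def by (rule someI[of _ ss]) (use ss in simp)
  have "word_prod G (ss @ rev ts) = \<one>"
    using ss ts by (simp add: word_prod_rev)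
  then have "refl_word G (ss @ rev ts) (refl_word G ts v) = refl_word G ts v"
    using ss ts v by (intro refl_word_one) auto
  moreover have "refl_word G (ss @ rev ts) (refl_word G ts v) = refl_word G ss v"
    using ts v by (simp add: refl_word_rev)
  moreover have "word_prod G ss \<bullet> v = refl_word G ts v"
    by (simp add: act_def ts_def refl_word_def)
  ultimately show ?thesis by simp
qed

lemma act_one [simp]: "fin_supp v \<Longrightarrow> \<one> \<bullet> v = v"
  using act_word_prod[of "[]" v] by simp

lemma act_gen: "s \<in> S \<Longrightarrow> fin_supp v \<Longrightarrow> s \<bullet> v = simple_reflection G s v"
  using act_word_prod[of "[s]" v] by simp

lemma fin_supp_act [simp]: "w \<in> carrier G \<Longrightarrow> fin_supp v \<Longrightarrow> fin_supp (w \<bullet> v)"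
  by (metis act_word_prod fin_supp_refl_word word_of)

lemma act_mult:
  assumes "w \<in> carrier G" "u \<in> carrier G" "fin_supp v"
  shows "(w \<otimes> u) \<bullet> v = w \<bullet> u \<bullet> v"
proof -
  obtain a b where ab: "set a \<subseteq> S" "word_prod G a = w" "set b \<subseteq> S" "word_prod G b = u"
    using assms word_of by metis
  have "word_prod G (a @ b) \<bullet> v = refl_word G (a @ b) v"
    using ab assms(3) by (intro act_word_prod) auto
  then show ?thesis using ab assms act_word_prod[of a] act_word_prod[of b] by simp
qed

lemma act_inv [simp]:
  assumes "w \<in> carrier G" "fin_supp v"
  shows "inv w \<bullet> w \<bullet> v = v" "w \<bullet> inv w \<bullet> v = v"
  using act_mult[of "inv w" w v] act_mult[of w "inv w" v] assms by simp_all

lemma act_inject: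
  assumes "w \<in> carrier G" "fin_supp u" "fin_supp v" "w \<bullet> u = w \<bullet> v"
  shows "u = v"
  using act_inv(1) assms by metis

lemma act_lin:
  assumes "w \<in> carrier G" "fin_supp u" "fin_supp v"
  shows "w \<bullet> (\<lambda>t. a * u t + b * v t) = (\<lambda>t. a * (w \<bullet> u) t + b * (w \<bullet> v) t)"
proof -
  obtain ss where ss: "set ss \<subseteq> S" "word_prod G ss = w" using assms word_of by blast
  show ?thesis
    using ss assms act_word_prod[of ss] fin_supp_lin[of u v a b] refl_word_lin[of u v G ss a b] by simp
qed

lemma act_neg: "w \<in> carrier G \<Longrightarrow> fin_supp v \<Longrightarrow> w \<bullet> (\<lambda>t. - v t) = (\<lambda>t. - (w \<bullet> v) t)"
  using act_lin[of w v v "-1" 0] by simp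

lemma act_sum:
  assumes "finite F" "w \<in> carrier G" "\<And>i. i \<in> F \<Longrightarrow> fin_supp (f i)"
  shows "w \<bullet> (\<lambda>t. \<Sum>i\<in>F. c i * f i t) = (\<lambda>t. \<Sum>i\<in>F. c i * (w \<bullet> f i) t)"
  using assms(1,3)
proof (induction F)
  case empty
  have "fin_supp (\<lambda>t::'a. 0::real)" by (simp add: fin_supp_def)
  from act_lin[OF assms(2) this this, of 0 0] show ?case by simp
next
  case (insert i F)
  have "w \<bullet> (\<lambda>t. c i * f i t + 1 * (\<Sum>i\<in>F. c i * f i t)) =
      (\<lambda>t. c i * (w \<bullet> f i) t + 1 * (w \<bullet> (\<lambda>t. \<Sum>i\<in>F. c i * f i t)) t)"
    using insert assms(2) by (intro act_lin fin_supp_sum) auto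
  then show ?case using insert by simp
qed

lemma act_expand:
  assumes "w \<in> carrier G" "finite F" "\<And>t. v t \<noteq> 0 \<Longrightarrow> t \<in> F"
  shows "w \<bullet> v = (\<lambda>x. \<Sum>t\<in>F. v t * (w \<bullet> simple_root t) x)"
  using act_sum[OF assms(2,1), of simple_root v] fin_supp_expand[of F v] assms by simp

lemma supp_in_act:
  assumes "w \<in> generate G J" "J \<subseteq> S" "supp_in J v" "fin_supp v"
  shows "supp_in J (w \<bullet> v)"
proof -
  obtain ss where "set ss \<subseteq> J" "w = word_prod G ss"
    using assms generate_words by blast
  then show ?thesis
    using assms supp_in_refl_word[of ss J v] act_word_prod[of ss v] by auto
qed

lemma supp_in_act_S: "w \<in> carrier G \<Longrightarrow> supp_in S v \<Longrightarrow> fin_supp v \<Longrightarrow> supp_in S (w \<bullet> v)"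
  using supp_in_act[of w S v] generate_S by simp

lemma form_act_gen:
  assumes "s \<in> S" "fin_supp u" "fin_supp v" "supp_in S u" "supp_in S v"
  shows "form G (s \<bullet> u) (s \<bullet> v) = form G u v"
proof -
  have 1: "form G (simple_reflection G s x) y = form G x y - 2 * B s x * B s y"
    if "fin_supp x" "fin_supp y" for x y
    using form_lin_left[of y x "simple_root s" G 1 "- 2 * B s x"] that
    by (simp add: simple_reflection_def)
  have "form G u (simple_reflection G s v) = form G (simple_reflection G s v) u"
    using assms by (intro form_commute) (auto simp: supp_in_reflection)
  then show ?thesis
    using assms form_commute[of u v] by (simp add: act_gen 1 B_reflection)
qed

lemma form_act:
  assumes "w \<in> carrier G" "fin_supp u" "fin_supp v" "supp_in S u" "supp_in S v"
  shows "form G (w \<bullet> u) (w \<bullet> v) = form G u v"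
  using assms(1)
  by (induction rule: word_induct) (use assms in \<open>auto simp: act_mult form_act_gen supp_in_act_S\<close>)

end

section \<open>Positive and negative roots\<close>

definition nonneg_vec :: "('a \<Rightarrow> real) \<Rightarrow> bool" where
  "nonneg_vec v \<longleftrightarrow> (\<forall>t. 0 \<le> v t)"

definition nonpos_vec :: "('a \<Rightarrow> real) \<Rightarrow> bool" where
  "nonpos_vec v \<longleftrightarrow> (\<forall>t. v t \<le> 0)"

lemma nonneg_vec_neg [simp]: "nonneg_vec (\<lambda>t. - v t) \<longleftrightarrow> nonpos_vec v"
  by (simp add: nonneg_vec_def nonpos_vec_def)

lemma nonpos_vec_neg [simp]: "nonpos_vec (\<lambda>t. - v t) \<longleftrightarrow> nonneg_vec v"
  by (simp add: nonneg_vec_def nonpos_vec_def)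

lemma nonneg_simple_root [simp]: "nonneg_vec (simple_root s)"
  by (simp add: nonneg_vec_def)

lemma nonneg_vec_sum:
  "(\<And>i. i \<in> F \<Longrightarrow> 0 \<le> c i) \<Longrightarrow> (\<And>i. i \<in> F \<Longrightarrow> nonneg_vec (f i)) \<Longrightarrow>
    nonneg_vec (\<lambda>t. \<Sum>i\<in>F. c i * f i t)"
  by (auto simp: nonneg_vec_def intro!: sum_nonneg)

lemma nonpos_vec_sum:
  "(\<And>i. i \<in> F \<Longrightarrow> 0 \<le> c i) \<Longrightarrow> (\<And>i. i \<in> F \<Longrightarrow> nonpos_vec (f i)) \<Longrightarrow>
    nonpos_vec (\<lambda>t. \<Sum>i\<in>F. c i * f i t)"
  by (auto simp: nonpos_vec_def intro!: sum_nonpos mult_nonneg_nonpos)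

text \<open>The alternating word of length \<open>k\<close> in \<open>s\<close> and \<open>t\<close> which ends with \<open>t\<close>.\<close>

primrec dihedral_word :: "'a \<Rightarrow> 'a \<Rightarrow> nat \<Rightarrow> 'a list" where
  "dihedral_word s t 0 = []"
| "dihedral_word s t (Suc k) = (if even k then t else s) # dihedral_word s t k"

lemma length_dihedral_word [simp]: "length (dihedral_word s t k) = k"
  by (induction k) auto

lemma set_dihedral_word: "set (dihedral_word s t k) \<subseteq> {s, t}"
  by (induction k) auto

lemma dihedral_word_suffix:
  assumes "m \<le> k"
  obtains p where "dihedral_word s t k = p @ dihedral_word s t m" "length p = k - m" "set p \<subseteq> {s, t}"
proof -
  have "\<exists>p. dihedral_word s t k = p @ dihedral_word s t m \<and> length p = k - m \<and> set p \<subseteq> {s, t}"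
    using assms
  proof (induction k rule: dec_induct)
    case base
    show ?case by simp
  next
    case (step n)
    then obtain p where "dihedral_word s t n = p @ dihedral_word s t m" "length p = n - m"
      "set p \<subseteq> {s, t}" by blast
    then show ?case
      using step by (intro exI[of _ "(if even n then t else s) # p"]) (auto simp: Suc_diff_le)
  qed
  then show ?thesis using that by blast
qed

section \<open>Rank two: alternating words and the sign of the image of a simple root\<close>

context coxeter
begin

lemma set_dihedral_word_S [simp]: "s \<in> S \<Longrightarrow> t \<in> S \<Longrightarrow> set (dihedral_word s t k) \<subseteq> S"
  using set_dihedral_word[of s t k] by blast

lemma gen_mult_pow:
  assumes "s \<in> S" "t \<in> S"
  shows "t \<otimes> (s \<otimes> t) [^] (k::nat) = (t \<otimes> s) [^] k \<otimes> t"
proof (induction k)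
  case (Suc k)
  have "t \<otimes> (s \<otimes> t) [^] Suc k = (t \<otimes> (s \<otimes> t) [^] k) \<otimes> (s \<otimes> t)"
    using assms by (simp add: m_assoc)
  also have "\<dots> = (t \<otimes> s) [^] Suc k \<otimes> t"
    using assms by (simp add: Suc m_assoc)
  finally show ?case .
qed (use assms in simp)

text \<open>For \<open>k = cox_order G s t\<close> the power is trivial, which leaves the braid
  relation of \<open>dihedral_word_braid\<close>.\<close>

lemma dihedral_word_swap:
  assumes "s \<in> S" "t \<in> S"
  shows "word_prod G (dihedral_word s t k) =
    (if even k then (s \<otimes> t) [^] k else (t \<otimes> s) [^] k) \<otimes> word_prod G (dihedral_word t s k)"
proof (induction k)
  case (Suc k)
  let ?D = "word_prod G (dihedral_word t s k)"
  have D: "?D \<in> carrier G" using assms by (intro word_prod_closed_S) auto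
  have aux: "y \<otimes> ((x \<otimes> y) [^] k \<otimes> ?D) = (y \<otimes> x) [^] Suc k \<otimes> (x \<otimes> ?D)"
    if "x \<in> S" "y \<in> S" for x y
  proof -
    have "y \<otimes> ((x \<otimes> y) [^] k \<otimes> ?D) = (y \<otimes> (x \<otimes> y) [^] k) \<otimes> ?D"
      using that D by (simp add: m_assoc)
    also have "\<dots> = (y \<otimes> x) [^] k \<otimes> (y \<otimes> x \<otimes> (x \<otimes> ?D))"
      using that D by (simp add: gen_mult_pow m_assoc)
    also have "\<dots> = (y \<otimes> x) [^] Suc k \<otimes> (x \<otimes> ?D)"
      using that D by (simp add: m_assoc)
    finally show ?thesis .
  qed
  show ?case
    using Suc aux[of s t] aux[of t s] assms by (cases "even k") auto
qed (use assms in simp)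

lemma dihedral_word_braid:
  assumes "s \<in> S" "t \<in> S"
  shows "word_prod G (dihedral_word s t (cox_order G s t)) =
    word_prod G (dihedral_word t s (cox_order G s t))"
  using dihedral_word_swap[OF assms, of "cox_order G s t"] cox_pow[OF assms] cox_pow[OF assms(2,1)]
    cox_order_commute[OF assms] assms by auto

lemma reflection_plane:
  assumes "s \<in> S" "t \<in> S"
  shows "simple_reflection G t (\<lambda>x. p * simple_root s x + q * simple_root t x) =
    (\<lambda>x. p * simple_root s x + (- 2 * cox_matrix_entry G s t * p - q) * simple_root t x)"
proof -
  have "simple_reflection G t (simple_root s) =
      (\<lambda>x. simple_root s x - 2 * cox_matrix_entry G s t * simple_root t x)"
    using assms by (simp add: simple_reflection_def entry_commute)
  then show ?thesis
    using assms by (simp add: reflection_lin reflection_simple algebra_simps)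
qed

text \<open>\<open>U\<close> solves a Chebyshev recurrence; each further reflection replaces the
  older of two consecutive coefficients by the next one.\<close>

lemma refl_dihedral_word:
  assumes "s \<in> S" "t \<in> S" "U 0 = 0" "U 1 = 1"
    and U: "\<And>k. U (Suc (Suc k)) = - 2 * cox_matrix_entry G s t * U (Suc k) - U k"
  shows "refl_word G (dihedral_word s t k) (simple_root s) =
    (\<lambda>x. (if even k then U (Suc k) else U k) * simple_root s x
       + (if even k then U k else U (Suc k)) * simple_root t x)"
proof (induction k)
  case 0
  show ?case using assms by simp
next
  case (Suc k)
  show ?case
  proof (cases "even k")
    case True
    then show ?thesis
      using Suc reflection_plane[OF assms(1,2), of "U (Suc k)" "U k"] by (simp only: U) simp
  next
    case False
    have "simple_reflection G s (\<lambda>x. U (Suc k) * simple_root t x + U k * simple_root s x) =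
        (\<lambda>x. U (Suc k) * simple_root t x + U (Suc (Suc k)) * simple_root s x)"
      unfolding U[of k] entry_commute[OF assms(1,2)] by (rule reflection_plane[OF assms(2,1)])
    then show ?thesis using Suc False by (simp add: add.commute)
  qed
qed

text \<open>For finite order m the solution is sin(k\<theta>) / sin \<theta> with \<theta> =
  \<pi>/m, nonnegative while k\<theta> is at most \<pi>; for infinite order it is k itself, as the
  recurrence then has the double root 1.\<close>

lemma dihedral_coefficients:
  assumes "s \<in> S" "t \<in> S" "s \<noteq> t"
  obtains U where "U 0 = 0" "U 1 = 1"
    "\<And>k. U (Suc (Suc k)) = - 2 * cox_matrix_entry G s t * U (Suc k) - U k"
    "\<And>k. cox_order G s t = 0 \<or> k \<le> cox_order G s t \<Longrightarrow> 0 \<le> U k"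
proof (cases "cox_order G s t = 0")
  case True
  then show ?thesis
    by (intro that[of real]) (auto simp: cox_matrix_entry_def)
next
  case False
  define m where "m = cox_order G s t"
  define \<theta> where "\<theta> = pi / real m"
  have m2: "m \<ge> 2"
    using False cox_order_eq_1_iff[OF assms(1,2)] assms(3) unfolding m_def by linarith
  then have "0 < \<theta>" "\<theta> < pi"
    by (auto simp: \<theta>_def field_simps)
  then have sin: "sin \<theta> > 0" using sin_gt_zero by blast
  show ?thesis
  proof (rule that[of "\<lambda>k. sin (real k * \<theta>) / sin \<theta>"])
    fix k
    have "sin (real (Suc (Suc k)) * \<theta>) + sin (real k * \<theta>) = 2 * cos \<theta> * sin (real (Suc k) * \<theta>)"
      using sin_add[of "real (Suc k) * \<theta>" \<theta>] sin_diff[of "real (Suc k) * \<theta>" \<theta>]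
      by (simp add: algebra_simps)
    then show "sin (real (Suc (Suc k)) * \<theta>) / sin \<theta> =
        - 2 * cox_matrix_entry G s t * (sin (real (Suc k) * \<theta>) / sin \<theta>) - sin (real k * \<theta>) / sin \<theta>"
      using False by (simp add: cox_matrix_entry_def \<theta>_def m_def diff_divide_distrib[symmetric])
  next
    fix k assume "cox_order G s t = 0 \<or> k \<le> cox_order G s t"
    then have "k \<le> m" using False by (simp add: m_def)
    then have "real k * \<theta> \<le> pi" using m2 by (simp add: \<theta>_def field_simps)
    then have "0 \<le> sin (real k * \<theta>)" using \<open>0 < \<theta>\<close> by (intro sin_ge_zero) auto
    then show "0 \<le> sin (real k * \<theta>) / sin \<theta>" using sin by simp
  qed (use sin in auto)
qed

text \<open>Split off from the right of \<open>w\<close> a longest alternating word in \<open>s\<close> and a descent \<open>t\<close>: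
  the remaining factor makes both \<open>\<alpha>\<^sub>s\<close> and \<open>\<alpha>\<^sub>t\<close> positive by induction.\<close>

theorem act_simple_nonneg:
  assumes "w \<in> carrier G" "s \<in> S" "len w < len (w \<otimes> s)"
  shows "nonneg_vec (w \<bullet> simple_root s)"
  using assms
proof (induction "len w" arbitrary: w s rule: less_induct)
  case less
  show ?case
  proof (cases "w = \<one>")
    case True
    then show ?thesis by simp
  next
    case False
    then obtain v\<^sub>0 t where v0: "v\<^sub>0 \<in> carrier G" "t \<in> S" "w = v\<^sub>0 \<otimes> t" "len w = Suc (len v\<^sub>0)"
      using descent_exists less.prems by blast
    have st: "s \<noteq> t"
      using v0 less.prems by auto
    let ?D = "\<lambda>k. word_prod G (dihedral_word s t k)"
    let ?m = "cox_order G s t"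
    \<comment> \<open>Lengths are required to add, which bounds \<open>K\<close> by
      \<open>len w\<close>, so that a longest alternating factor exists.\<close>
    define K where "K = {k. \<exists>v\<in>carrier G. w = v \<otimes> ?D k \<and> len w = len v + k}"
    have Dc: "?D k \<in> carrier G" "set (dihedral_word s t k) \<subseteq> S" for k
      using v0 less.prems by auto
    have K1: "1 \<in> K" unfolding K_def using v0 by (auto intro!: bexI[of _ v\<^sub>0])
    have Kb: "k \<le> len w" if "k \<in> K" for k using that unfolding K_def by auto
    then have Kfin: "finite K" using finite_nat_set_iff_bounded_le by blast
    define k where "k = Max K"
    have k1: "k \<ge> 1" unfolding k_def using K1 Kfin by simp
    have "k \<in> K" unfolding k_def using K1 Kfin Max_in by blast
    then obtain v where v: "v \<in> carrier G" "w = v \<otimes> ?D k" "len w = len v + k"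
      unfolding K_def by blast
    have Dlen: "len (?D j) \<le> j" for j
      using len_le[OF Dc(2), of j] by simp
    \<comment> \<open>\<open>x\<close> would prolong the alternating word to the left,
      \<open>y\<close> is its first letter. Neither is a descent of \<open>v\<close>: for
      \<open>x\<close> by maximality of \<open>k\<close>, for \<open>y\<close> because the lengths
      add.\<close>
    define x where "x = (if even k then t else s)"
    define y where "y = (if even k then s else t)"
    have xy: "x \<in> S" "y \<in> S" using v0 less.prems by (auto simp: x_def y_def)
    have "len v < len (v \<otimes> x)"
    proof (rule ccontr)
      assume "\<not> ?thesis"
      then have "len (v \<otimes> x) < len v" using len_mult_gen_ne[of v x] v xy by simp
      moreover have "w = v \<otimes> x \<otimes> ?D (Suc k)"
        using v xy Dc(1)[of k] by (simp add: x_def m_assoc)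
      moreover have "len w \<le> len (v \<otimes> x) + len (?D (Suc k))"
        using calculation(2) len_mult_le[of "v \<otimes> x" "?D (Suc k)"] v xy Dc(1)[of "Suc k"]
        by (metis gen_closed m_closed)
      ultimately have "Suc k \<in> K"
        unfolding K_def using v xy Dlen[of "Suc k"] by (auto intro!: bexI[of _ "v \<otimes> x"])
      then show False using Kfin k_def Max_ge[of K "Suc k"] by (metis not_less_eq_eq order_refl)
    qed
    moreover have "len v < len (v \<otimes> y)"
    proof -
      obtain j where j: "k = Suc j" using k1 by (cases k) auto
      have "w = v \<otimes> y \<otimes> ?D j"
        using v xy j Dc(1)[of j] by (auto simp: y_def m_assoc)
      then have "len w \<le> len (v \<otimes> y) + j"
        using len_mult_le[of "v \<otimes> y" "?D j"] v xy Dc(1)[of j] Dlen[of j]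
        by (metis add_left_mono gen_closed le_trans m_closed)
      then show ?thesis
        using v j by simp
    qed
    ultimately have lens: "len v < len (v \<otimes> s)" "len v < len (v \<otimes> t)"
      by (auto simp: x_def y_def split: if_splits)
    have "len v < len w" using v k1 by simp
    then have nn: "nonneg_vec (v \<bullet> simple_root s)" "nonneg_vec (v \<bullet> simple_root t)"
      using less.hyps lens v(1) v0(2) less.prems(2) by blast+
    \<comment> \<open>Otherwise the braid relation rewrites the alternating word so that it ends
      with \<open>s\<close>, and \<open>w \<otimes> s\<close> would be shorter than
      \<open>w\<close>.\<close>
    have km: "?m = 0 \<or> k < ?m"
    proof (rule ccontr)
      assume "\<not> ?thesis"
      then have m: "?m \<noteq> 0" "?m \<le> k" by auto
      then obtain p where p: "dihedral_word s t k = p @ dihedral_word s t ?m" "length p = k - ?m"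
        "set p \<subseteq> {s, t}" using dihedral_word_suffix by metis
      obtain j where j: "?m = Suc j" using m by (cases ?m) auto
      obtain q where q: "dihedral_word t s ?m = q @ dihedral_word t s 1" "length q = ?m - 1"
        "set q \<subseteq> {t, s}"
        by (rule dihedral_word_suffix[of 1 ?m t s]) (use j in auto)
      have pq: "set p \<subseteq> S" "set q \<subseteq> S" using p q v0 less.prems by auto
      have "?D k = word_prod G p \<otimes> ?D ?m"
        using p pq Dc by simp
      also have "\<dots> = word_prod G p \<otimes> (word_prod G q \<otimes> s)"
        using dihedral_word_braid[of s t] q pq v0 less.prems by simp
      finally have "w \<otimes> s = v \<otimes> (word_prod G p \<otimes> word_prod G q)"
        using v pq less.prems by (simp add: m_assoc)
      then have "w \<otimes> s = v \<otimes> word_prod G (p @ q)" using pq by simp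
      moreover have "len (word_prod G (p @ q)) \<le> length (p @ q)" using pq by (intro len_le) auto
      moreover have "length (p @ q) < k" using p q j m by simp
      ultimately have "len (w \<otimes> s) < len w"
        using len_mult_le[of v "word_prod G (p @ q)"] v pq by simp
      then show False using less.prems by simp
    qed
    obtain U where U: "U 0 = 0" "U 1 = 1"
      "\<And>k. U (Suc (Suc k)) = - 2 * cox_matrix_entry G s t * U (Suc k) - U k"
      "\<And>k. ?m = 0 \<or> k \<le> ?m \<Longrightarrow> 0 \<le> U k"
      using dihedral_coefficients[OF less.prems(2) v0(2) st] by metis
    have Upos: "0 \<le> U k" "0 \<le> U (Suc k)" using km by (auto intro!: U(4))
    have "?D k \<bullet> simple_root s = (\<lambda>x. (if even k then U (Suc k) else U k) * simple_root s x
       + (if even k then U k else U (Suc k)) * simple_root t x)"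
      using refl_dihedral_word[of s t U k] U act_word_prod[OF Dc(2), of "simple_root s" k] v0 less.prems
      by simp
    then have "w \<bullet> simple_root s = (\<lambda>x. (if even k then U (Suc k) else U k) * (v \<bullet> simple_root s) x
       + (if even k then U k else U (Suc k)) * (v \<bullet> simple_root t) x)"
      using v Dc by (simp add: act_mult act_lin)
    then show ?thesis
      using nn Upos by (auto simp: nonneg_vec_def intro!: add_nonneg_nonneg mult_nonneg_nonneg)
  qed
qed

lemma act_simple_nonpos:
  assumes "w \<in> carrier G" "s \<in> S" "len (w \<otimes> s) < len w"
  shows "nonpos_vec (w \<bullet> simple_root s)"
proof -
  have "nonneg_vec ((w \<otimes> s) \<bullet> simple_root s)"
    using assms by (intro act_simple_nonneg) (auto simp: m_assoc)
  then show ?thesis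
    using assms by (simp add: act_mult act_gen reflection_simple act_neg)
qed

lemma act_simple_sign:
  "w \<in> carrier G \<Longrightarrow> s \<in> S \<Longrightarrow> nonneg_vec (w \<bullet> simple_root s) \<or> nonpos_vec (w \<bullet> simple_root s)"
  by (metis act_simple_nonneg act_simple_nonpos len_mult_gen_ne linorder_neqE_nat)

section \<open>Roots and their signs\<close>

abbreviation \<Phi> :: "('a \<Rightarrow> real) set" where "\<Phi> \<equiv> roots G S"
abbreviation \<Phi>pos :: "('a \<Rightarrow> real) set" where "\<Phi>pos \<equiv> pos_roots G S"

lemma rootE:
  assumes "\<gamma> \<in> \<Phi>"
  obtains w s where "w \<in> carrier G" "s \<in> S" "\<gamma> = w \<bullet> simple_root s"
  using assms unfolding roots_def by blast

lemma rootI: "w \<in> carrier G \<Longrightarrow> s \<in> S \<Longrightarrow> w \<bullet> simple_root s \<in> \<Phi>"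
  unfolding roots_def by blast

lemma simple_root_in_roots [simp]: "s \<in> S \<Longrightarrow> simple_root s \<in> \<Phi>"
  using rootI[of \<one> s] by simp

lemma root_fin_supp [simp]: "\<gamma> \<in> \<Phi> \<Longrightarrow> fin_supp \<gamma>"
  by (auto elim: rootE)

lemma root_supp_in_S [simp]: "\<gamma> \<in> \<Phi> \<Longrightarrow> supp_in S \<gamma>"
  by (auto elim!: rootE intro: supp_in_act_S)

lemma root_form [simp]: "\<gamma> \<in> \<Phi> \<Longrightarrow> form G \<gamma> \<gamma> = 1"
  by (auto elim!: rootE simp: form_act)

lemma root_act [simp]: "w \<in> carrier G \<Longrightarrow> \<gamma> \<in> \<Phi> \<Longrightarrow> w \<bullet> \<gamma> \<in> \<Phi>"
  by (auto elim!: rootE simp: act_mult[symmetric] intro!: rootI)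

lemma root_sign: "\<gamma> \<in> \<Phi> \<Longrightarrow> nonneg_vec \<gamma> \<or> nonpos_vec \<gamma>"
  by (metis rootE act_simple_sign)

lemma root_not_both: "\<gamma> \<in> \<Phi> \<Longrightarrow> nonneg_vec \<gamma> \<Longrightarrow> nonpos_vec \<gamma> \<Longrightarrow> False"
proof -
  assume "\<gamma> \<in> \<Phi>" "nonneg_vec \<gamma>" "nonpos_vec \<gamma>"
  then have "\<gamma> = (\<lambda>t. 0)" by (auto simp: nonneg_vec_def nonpos_vec_def fun_eq_iff intro: antisym)
  then have "form G \<gamma> \<gamma> = 0" by (simp add: form_def)
  then show False using root_form[OF \<open>\<gamma> \<in> \<Phi>\<close>] by simp
qed

lemma root_neg [simp]: "\<gamma> \<in> \<Phi> \<Longrightarrow> (\<lambda>t. - \<gamma> t) \<in> \<Phi>"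
proof -
  assume "\<gamma> \<in> \<Phi>"
  then obtain w s where w: "w \<in> carrier G" "s \<in> S" "\<gamma> = w \<bullet> simple_root s" by (elim rootE)
  then have "(w \<otimes> s) \<bullet> simple_root s = (\<lambda>t. - \<gamma> t)"
    by (simp add: act_mult act_gen reflection_simple act_neg)
  then show ?thesis using w rootI[of "w \<otimes> s" s] by simp
qed

lemma pos_roots_iff: "\<gamma> \<in> \<Phi>pos \<longleftrightarrow> \<gamma> \<in> \<Phi> \<and> nonneg_vec \<gamma>"
  by (simp add: pos_roots_def nonneg_vec_def)

lemma pos_root_act_iff: "w \<in> carrier G \<Longrightarrow> \<gamma> \<in> \<Phi> \<Longrightarrow> w \<bullet> \<gamma> \<in> \<Phi>pos \<longleftrightarrow> \<not> nonpos_vec (w \<bullet> \<gamma>)"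
  using root_act[of w \<gamma>] root_sign[of "w \<bullet> \<gamma>"] root_not_both[of "w \<bullet> \<gamma>"] by (auto simp: pos_roots_iff)

text \<open>A nontrivial element makes the simple root of the last letter of a reduced word
  negative.\<close>

lemma act_eq_one:
  assumes "w \<in> carrier G" "\<And>s. s \<in> S \<Longrightarrow> nonneg_vec (w \<bullet> simple_root s)"
  shows "w = \<one>"
proof (rule ccontr)
  assume "w \<noteq> \<one>"
  then obtain v t where v: "v \<in> carrier G" "t \<in> S" "w = v \<otimes> t" "len w = Suc (len v)"
    using descent_exists assms(1) by blast
  then have "nonpos_vec (w \<bullet> simple_root t)"
    using assms by (intro act_simple_nonpos) auto
  then show False using assms v root_not_both[of "w \<bullet> simple_root t"] by simp
qed

lemma act_faithful:
  assumes "u \<in> carrier G" "w \<in> carrier G" "\<And>s. s \<in> S \<Longrightarrow> u \<bullet> simple_root s = w \<bullet> simple_root s"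
  shows "u = w"
proof -
  have "inv u \<otimes> w = \<one>"
    by (rule act_eq_one) (use assms in \<open>auto simp: act_mult assms(3)[symmetric]\<close>)
  then have "u \<otimes> (inv u \<otimes> w) = u" using assms by simp
  then show ?thesis using assms by (simp add: m_assoc[symmetric])
qed

lemma nonpos_simple_iff_len:
  "w \<in> carrier G \<Longrightarrow> s \<in> S \<Longrightarrow> nonpos_vec (w \<bullet> simple_root s) \<longleftrightarrow> len (w \<otimes> s) < len w"
  using act_simple_nonneg[of w s] act_simple_nonpos[of w s] len_mult_gen_ne[of w s]
    root_not_both[of "w \<bullet> simple_root s"] by fastforce

text \<open>Roots have norm 1, which leaves only the coefficient 1 for a nonnegative multiple of a
  simple root.\<close>

lemma pos_root_eq_simple:
  assumes "\<gamma> \<in> \<Phi>pos" "s \<in> S" "supp_in {s} \<gamma>"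
  shows "\<gamma> = simple_root s"
proof -
  have \<gamma>: "\<gamma> = (\<lambda>t. \<gamma> s * simple_root s t)"
    using assms(3) by (auto simp: supp_in_def simple_root_def fun_eq_iff)
  have "form G \<gamma> \<gamma> = (\<Sum>s\<in>{s}. \<Sum>t\<in>{s}. \<gamma> s * \<gamma> t * cox_matrix_entry G s t)"
    by (subst form_eq_sum[where F = "{s}" and F' = "{s}"]) (use assms in \<open>auto simp: supp_in_def\<close>)
  then have "\<gamma> s * \<gamma> s = 1" using assms by (simp add: pos_roots_iff)
  moreover have "0 \<le> \<gamma> s" using assms by (simp add: pos_roots_iff nonneg_vec_def)
  ultimately have "\<gamma> s = 1" by (simp add: square_eq_1_iff)
  then show ?thesis using \<gamma> by simp
qed

text \<open>The reflection changes only the coordinate at \<open>s\<close>. Some other coordinate is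
  positive and survives, and the coordinates of a root do not have mixed signs.\<close>

lemma act_gen_pos:
  assumes "s \<in> S" "\<gamma> \<in> \<Phi>pos" "\<gamma> \<noteq> simple_root s"
  shows "s \<bullet> \<gamma> \<in> \<Phi>pos"
proof -
  obtain t where t: "t \<noteq> s" "\<gamma> t \<noteq> 0"
    using pos_root_eq_simple[OF assms(2,1)] assms(3) by (auto simp: supp_in_def)
  then have "\<gamma> t > 0" using assms by (simp add: pos_roots_def order_less_le)
  moreover have "(s \<bullet> \<gamma>) t = \<gamma> t"
    using assms t by (simp add: act_gen pos_roots_iff simple_reflection_def simple_root_def)
  ultimately have "\<not> nonpos_vec (s \<bullet> \<gamma>)" unfolding nonpos_vec_def by (metis not_le)
  then show ?thesis using assms pos_root_act_iff by (simp add: pos_roots_iff)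
qed

section \<open>Reflections and reflection subgroups\<close>

abbreviation refl :: "('a \<Rightarrow> real) \<Rightarrow> 'a" where "refl \<equiv> root_reflection G S"

text \<open>The right-hand side involves \<open>w\<close> and \<open>s\<close> only through the root
  \<open>w \<bullet> simple_root s\<close>; with faithfulness this makes
  \<open>root_reflection\<close> well defined in \<open>refl_eq\<close>.\<close>

lemma conj_gen_act:
  assumes "w \<in> carrier G" "s \<in> S" "fin_supp v" "supp_in S v"
  shows "(w \<otimes> s \<otimes> inv w) \<bullet> v = (\<lambda>t. v t - 2 * form G (w \<bullet> simple_root s) v * (w \<bullet> simple_root s) t)"
proof -
  let ?u = "inv w \<bullet> v"
  have "(w \<otimes> s \<otimes> inv w) \<bullet> v = w \<bullet> simple_reflection G s ?u"
    using assms by (simp add: act_mult act_gen)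
  also have "simple_reflection G s ?u = (\<lambda>t. 1 * ?u t + (- 2 * B s ?u) * simple_root s t)"
    by (simp add: simple_reflection_def)
  also have "w \<bullet> \<dots> = (\<lambda>t. v t - 2 * B s ?u * (w \<bullet> simple_root s) t)"
    using assms by (subst act_lin) auto
  also have "B s ?u = form G (w \<bullet> simple_root s) (w \<bullet> ?u)"
    using assms by (intro form_act[symmetric]) (auto intro: supp_in_act_S)
  finally show ?thesis using assms by simp
qed

lemma refl_eq:
  assumes "w \<in> carrier G" "s \<in> S"
  shows "refl (w \<bullet> simple_root s) = w \<otimes> s \<otimes> inv w"
  unfolding root_reflection_def
proof (rule the_equality)
  fix r assume "\<exists>v\<in>carrier G. \<exists>t\<in>S. w \<bullet> simple_root s = v \<bullet> simple_root t \<and> r = v \<otimes> t \<otimes> inv v"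
  then obtain v t where v: "v \<in> carrier G" "t \<in> S" "w \<bullet> simple_root s = v \<bullet> simple_root t"
    "r = v \<otimes> t \<otimes> inv v" by blast
  show "r = w \<otimes> s \<otimes> inv w"
    by (rule act_faithful) (use v assms in \<open>auto simp: conj_gen_act\<close>)
qed (use assms in blast)

lemma refl_closed [simp]: "\<gamma> \<in> \<Phi> \<Longrightarrow> refl \<gamma> \<in> carrier G"
  by (auto elim!: rootE simp: refl_eq)

lemma refl_act:
  "\<gamma> \<in> \<Phi> \<Longrightarrow> fin_supp v \<Longrightarrow> supp_in S v \<Longrightarrow> refl \<gamma> \<bullet> v = (\<lambda>t. v t - 2 * form G \<gamma> v * \<gamma> t)"
  by (auto elim!: rootE simp: refl_eq conj_gen_act)

lemma refl_simple [simp]: "s \<in> S \<Longrightarrow> refl (simple_root s) = s"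
  using refl_eq[of \<one> s] by simp

lemma refl_conj: "w \<in> carrier G \<Longrightarrow> \<gamma> \<in> \<Phi> \<Longrightarrow> refl (w \<bullet> \<gamma>) = w \<otimes> refl \<gamma> \<otimes> inv w"
  by (auto elim!: rootE simp: refl_eq act_mult[symmetric] m_assoc inv_mult_group)

lemma refl_square [simp]: "\<gamma> \<in> \<Phi> \<Longrightarrow> refl \<gamma> \<otimes> refl \<gamma> = \<one>"
proof -
  assume "\<gamma> \<in> \<Phi>"
  then obtain w s where w: "w \<in> carrier G" "s \<in> S" "\<gamma> = w \<bullet> simple_root s" by (elim rootE)
  then show ?thesis by (simp add: refl_eq m_assoc)
qed

lemma refl_self: "\<gamma> \<in> \<Phi> \<Longrightarrow> refl \<gamma> \<bullet> \<gamma> = (\<lambda>t. - \<gamma> t)"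
  by (simp add: refl_act)

lemma refl_neg: 
  assumes "\<gamma> \<in> \<Phi>"
  shows "refl (\<lambda>t. - \<gamma> t) = refl \<gamma>"
proof (rule act_faithful)
  fix s assume "s \<in> S"
  then show "refl (\<lambda>t. - \<gamma> t) \<bullet> simple_root s = refl \<gamma> \<bullet> simple_root s"
    using assms by (simp add: refl_act form_neg_left)
qed (use assms in auto)

lemma refl_orthogonal:
  "\<gamma> \<in> \<Phi> \<Longrightarrow> fin_supp v \<Longrightarrow> supp_in S v \<Longrightarrow> form G \<gamma> v = 0 \<Longrightarrow> refl \<gamma> \<bullet> v = v"
  by (simp add: refl_act)

abbreviation refl_prod :: "('a \<Rightarrow> real) list \<Rightarrow> 'a" where
  "refl_prod ds \<equiv> word_prod G (map refl ds)"

lemma refl_prod_closed [simp]: "set ds \<subseteq> \<Phi> \<Longrightarrow> refl_prod ds \<in> carrier G"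
  by (intro word_prod_closed) auto

lemma refl_prod_append: 
  "set as \<subseteq> \<Phi> \<Longrightarrow> set bs \<subseteq> \<Phi> \<Longrightarrow> refl_prod (as @ bs) = refl_prod as \<otimes> refl_prod bs"
  by (subst map_append, subst word_prod_append) auto

lemma generate_refl:
  assumes "D \<subseteq> \<Phi>"
  shows "generate G (refl ` D) = refl_prod ` {ds. set ds \<subseteq> D}"
proof -
  have "generate G (refl ` D) = word_prod G ` {ss. set ss \<subseteq> refl ` D}"
    using assms by (intro generate_involution_words) auto
  also have "{ss. set ss \<subseteq> refl ` D} = map refl ` {ds. set ds \<subseteq> D}"
    using lists_image[of refl D] by (simp add: lists_eq_set)
  finally show ?thesis by (simp add: image_image)
qed

text \<open>Apply the letters from the right. The moving root starts in \<open>\<Psi>\<close> and a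
  letter \<delta> can move it out of \<open>\<Psi>\<close> only when the root equals \<delta>; being
  negative in the end, it has to meet such a letter. Stated abstractly to cover both simple
  reflections and canonical generators of reflection subgroups.\<close>

lemma refl_exchange:
  assumes \<Psi>: "\<Psi> \<subseteq> \<Phi>pos" and D: "D \<subseteq> \<Psi>"
    and perm: "\<And>\<delta> \<beta>. \<delta> \<in> D \<Longrightarrow> \<beta> \<in> \<Psi> \<Longrightarrow> \<beta> \<noteq> \<delta> \<Longrightarrow> refl \<delta> \<bullet> \<beta> \<in> \<Psi>"
    and "set ds \<subseteq> D" "\<gamma> \<in> \<Psi>" "nonpos_vec (refl_prod ds \<bullet> \<gamma>)"
  obtains a \<delta> b where "ds = a @ \<delta> # b" "refl_prod b \<bullet> \<gamma> = \<delta>"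
proof -
  have "refl_prod ds \<bullet> \<gamma> \<in> \<Psi> \<or> (\<exists>a \<delta> b. ds = a @ \<delta> # b \<and> refl_prod b \<bullet> \<gamma> = \<delta>)"
    using assms(4)
  proof (induction ds)
    case Nil
    then show ?case using assms(5) \<Psi> by (auto simp: pos_roots_iff)
  next
    case (Cons \<delta> ds)
    have "\<Psi> \<subseteq> \<Phi>" using \<Psi> by (auto simp: pos_roots_iff)
    then have \<delta>: "\<delta> \<in> D" "\<delta> \<in> \<Phi>" "set ds \<subseteq> \<Phi>" "fin_supp \<gamma>"
      using Cons.prems D assms(5) by (auto simp: subset_iff)
    have eq: "refl_prod (\<delta> # ds) \<bullet> \<gamma> = refl \<delta> \<bullet> refl_prod ds \<bullet> \<gamma>"
      using \<delta> by (simp add: act_mult)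
    have "refl_prod ds \<bullet> \<gamma> \<in> \<Psi> \<or> (\<exists>a \<delta>' b. ds = a @ \<delta>' # b \<and> refl_prod b \<bullet> \<gamma> = \<delta>')"
      using Cons by auto
    then show ?case
    proof
      assume *: "refl_prod ds \<bullet> \<gamma> \<in> \<Psi>"
      show ?case
      proof (cases "refl_prod ds \<bullet> \<gamma> = \<delta>")
        case True
        then show ?thesis by (metis append_Nil)
      next
        case False
        then show ?thesis using perm[OF \<delta>(1) *] eq by simp
      qed
    qed (metis append_Cons)
  qed
  moreover have "refl_prod ds \<bullet> \<gamma> \<notin> \<Psi>"
    using \<Psi> assms(6) root_not_both[of "refl_prod ds \<bullet> \<gamma>"] by (auto simp: pos_roots_iff)
  ultimately show ?thesis using that by blast
qed

text \<open>\<open>refl \<delta>\<close> is the conjugate of \<open>refl \<gamma>\<close> by the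
  product over \<open>bs\<close>, so the two cancel once moved together.\<close>

lemma refl_prod_delete:
  assumes "set as \<subseteq> \<Phi>" "set bs \<subseteq> \<Phi>" "\<delta> \<in> \<Phi>" "\<gamma> \<in> \<Phi>" "refl_prod bs \<bullet> \<gamma> = \<delta>"
  shows "refl_prod (as @ \<delta> # bs) \<otimes> refl \<gamma> = refl_prod (as @ bs)"
proof -
  have "refl \<delta> = refl_prod bs \<otimes> refl \<gamma> \<otimes> inv (refl_prod bs)"
    using assms refl_conj[of "refl_prod bs" \<gamma>] by simp
  then have "refl \<delta> \<otimes> refl_prod bs = refl_prod bs \<otimes> refl \<gamma>"
    using assms by (simp add: m_assoc)
  then have "refl \<delta> \<otimes> refl_prod bs \<otimes> refl \<gamma> = refl_prod bs"
    using assms by (simp add: m_assoc)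
  then show ?thesis
    using assms refl_prod_append[of as "\<delta> # bs"] refl_prod_append[of as bs] by (simp add: m_assoc)
qed

text \<open>In a shortest expression with last letter \<delta>, the factor before it makes \<delta>
  negative, as the whole product does not. Exchange then deletes two letters, unless the expression
  is empty.\<close>

lemma refl_group_no_inversion:
  assumes \<Psi>: "\<Psi> \<subseteq> \<Phi>pos" and D: "D \<subseteq> \<Psi>"
    and perm: "\<And>\<delta> \<beta>. \<delta> \<in> D \<Longrightarrow> \<beta> \<in> \<Psi> \<Longrightarrow> \<beta> \<noteq> \<delta> \<Longrightarrow> refl \<delta> \<bullet> \<beta> \<in> \<Psi>"
    and w: "w \<in> generate G (refl ` D)" and nonneg: "\<And>\<delta>. \<delta> \<in> D \<Longrightarrow> nonneg_vec (w \<bullet> \<delta>)"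
  shows "w = \<one>"
proof -
  have D\<Phi>: "D \<subseteq> \<Phi>" using D \<Psi> by (auto simp: pos_roots_iff)
  define P where "P n \<longleftrightarrow> (\<exists>ds. set ds \<subseteq> D \<and> refl_prod ds = w \<and> length ds = n)" for n
  have "\<exists>n. P n" using w generate_refl[OF D\<Phi>] unfolding P_def by auto
  then have "P (LEAST n. P n)" by (rule LeastI_ex)
  then obtain ds where ds: "set ds \<subseteq> D" "refl_prod ds = w" "length ds = (LEAST n. P n)"
    unfolding P_def by blast
  have least: "length ds \<le> length es" if "set es \<subseteq> D" "refl_prod es = w" for es
    unfolding ds(3) by (rule Least_le) (use that in \<open>auto simp: P_def\<close>)
  show ?thesis
  proof (cases ds rule: rev_exhaust)
    case Nil
    then show ?thesis using ds by simp
  next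
    case (snoc c \<delta>)
    have \<delta>: "\<delta> \<in> D" "\<delta> \<in> \<Phi>" "set c \<subseteq> D" "set c \<subseteq> \<Phi>" using snoc ds D\<Phi> by auto
    have weq: "w = refl_prod c \<otimes> refl \<delta>"
      using ds snoc \<delta> refl_prod_append[of c "[\<delta>]"] by simp
    then have "w \<bullet> \<delta> = (\<lambda>t. - (refl_prod c \<bullet> \<delta>) t)"
      using \<delta> by (simp add: act_mult refl_self act_neg)
    then have "nonpos_vec (refl_prod c \<bullet> \<delta>)" using nonneg[OF \<delta>(1)] by simp
    then obtain a \<delta>' b where ab: "c = a @ \<delta>' # b" "refl_prod b \<bullet> \<delta> = \<delta>'"
      using refl_exchange[OF \<Psi> D perm \<delta>(3), of \<delta>] \<delta> D by blast
    then have "refl_prod (a @ b) = w"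
      using refl_prod_delete[of a b \<delta>' \<delta>] \<delta> weq by simp
    then have "length ds \<le> length (a @ b)" using ab \<delta> by (intro least) auto
    then show ?thesis using snoc ab by simp
  qed
qed

lemma simple_root_image_pos: "simple_root ` S \<subseteq> \<Phi>pos"
  by (auto simp: pos_roots_iff)

lemma refl_simple_perm:
  "\<delta> \<in> simple_root ` S \<Longrightarrow> \<beta> \<in> \<Phi>pos \<Longrightarrow> \<beta> \<noteq> \<delta> \<Longrightarrow> refl \<delta> \<bullet> \<beta> \<in> \<Phi>pos"
  by (auto simp: act_gen_pos)

lemma refl_prod_simple: "set ss \<subseteq> S \<Longrightarrow> refl_prod (map simple_root ss) = word_prod G ss"
  by (induction ss) auto

lemma exchange:
  assumes "set ss \<subseteq> S" "\<gamma> \<in> \<Phi>pos" "nonpos_vec (word_prod G ss \<bullet> \<gamma>)"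
  obtains a s b where "ss = a @ s # b" "word_prod G b \<bullet> \<gamma> = simple_root s"
    "word_prod G ss \<otimes> refl \<gamma> = word_prod G (a @ b)"
proof -
  obtain a' \<delta> b' where *: "map simple_root ss = a' @ \<delta> # b'" "refl_prod b' \<bullet> \<gamma> = \<delta>"
    using refl_exchange[OF subset_refl simple_root_image_pos refl_simple_perm, of "map simple_root ss" \<gamma>]
      assms by (metis image_mono refl_prod_simple set_map)
  then obtain a s b where ab: "ss = a @ s # b" "a' = map simple_root a" "\<delta> = simple_root s"
    "b' = map simple_root b"
    by (auto simp: map_eq_append_conv map_eq_Cons_conv)
  have S: "set a \<subseteq> S" "s \<in> S" "set b \<subseteq> S" using assms ab by auto
  have "refl_prod (map simple_root a @ \<delta> # map simple_root b) \<otimes> refl \<gamma> =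
      refl_prod (map simple_root a @ map simple_root b)"
    by (rule refl_prod_delete) (use S assms ab * in \<open>auto simp: pos_roots_iff\<close>)
  moreover have "refl_prod (map simple_root a @ \<delta> # map simple_root b) = word_prod G ss"
    using refl_prod_simple[OF assms(1)] ab by simp
  moreover have "refl_prod (map simple_root a @ map simple_root b) = word_prod G (a @ b)"
    using refl_prod_simple[of "a @ b"] S by simp
  ultimately show ?thesis
    using that[of a s b] ab * S by (metis refl_prod_simple)
qed

text \<open>The generators are the simple roots of \<open>J\<close>, while \<open>\<Psi>\<close> can
  be the set of all positive roots: a simple reflection permutes those other than its own.\<close>

lemma parabolic_no_inversion:
  assumes "J \<subseteq> S" "w \<in> generate G J" "\<And>j. j \<in> J \<Longrightarrow> nonneg_vec (w \<bullet> simple_root j)"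
  shows "w = \<one>"
proof (rule refl_group_no_inversion[of \<Phi>pos "simple_root ` J"])
  have "refl ` simple_root ` J = J" using assms(1) by force
  then show "w \<in> generate G (refl ` simple_root ` J)" using assms by simp
  show "refl \<delta> \<bullet> \<beta> \<in> \<Phi>pos" if "\<delta> \<in> simple_root ` J" "\<beta> \<in> \<Phi>pos" "\<beta> \<noteq> \<delta>" for \<delta> \<beta>
    using refl_simple_perm[of \<delta> \<beta>] that assms(1) by blast
qed (use assms in \<open>auto simp: pos_roots_iff\<close>)

lemma len_refl:
  assumes "w \<in> carrier G" "\<gamma> \<in> \<Phi>pos" "nonpos_vec (w \<bullet> \<gamma>)"
  shows "len (w \<otimes> refl \<gamma>) < len w"
proof -
  obtain ss where ss: "set ss \<subseteq> S" "word_prod G ss = w" "length ss = len w"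
    using assms reduced_word by blast
  obtain a s b where ab: "ss = a @ s # b" "word_prod G ss \<otimes> refl \<gamma> = word_prod G (a @ b)"
    using exchange[of ss \<gamma>] assms ss by metis
  have "len (word_prod G (a @ b)) \<le> length (a @ b)" using ab ss by (intro len_le) auto
  then show ?thesis using ab ss by simp
qed

text \<open>Each further letter adds at most one inverted root, the preimage of its simple
  root.\<close>

lemma finite_inversions:
  assumes "w \<in> carrier G"
  shows "finite {\<gamma> \<in> \<Phi>pos. nonpos_vec (w \<bullet> \<gamma>)}"
  using assms
proof (induction rule: word_induct)
  case one
  have empty: "{\<gamma> \<in> \<Phi>pos. nonpos_vec (\<one> \<bullet> \<gamma>)} = {}"
    using root_not_both by (auto simp: pos_roots_iff)
  show ?case unfolding empty by simp
next
  case (mult s w)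
  have "{\<gamma> \<in> \<Phi>pos. nonpos_vec ((s \<otimes> w) \<bullet> \<gamma>)} \<subseteq>
      {\<gamma> \<in> \<Phi>pos. nonpos_vec (w \<bullet> \<gamma>)} \<union> {inv w \<bullet> simple_root s}"
  proof
    fix \<gamma> assume "\<gamma> \<in> {\<gamma> \<in> \<Phi>pos. nonpos_vec ((s \<otimes> w) \<bullet> \<gamma>)}"
    then have \<gamma>: "\<gamma> \<in> \<Phi>pos" "\<gamma> \<in> \<Phi>" "nonpos_vec (s \<bullet> w \<bullet> \<gamma>)"
      using mult by (auto simp: pos_roots_iff act_mult)
    show "\<gamma> \<in> {\<gamma> \<in> \<Phi>pos. nonpos_vec (w \<bullet> \<gamma>)} \<union> {inv w \<bullet> simple_root s}"
    proof (cases "nonpos_vec (w \<bullet> \<gamma>)")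
      case False
      then have "w \<bullet> \<gamma> \<in> \<Phi>pos" using \<gamma> mult by (simp add: pos_root_act_iff)
      then have "w \<bullet> \<gamma> = simple_root s"
        using act_gen_pos[of s "w \<bullet> \<gamma>"] \<gamma> mult root_not_both[of "s \<bullet> w \<bullet> \<gamma>"]
        by (auto simp: pos_roots_iff)
      then show ?thesis using \<gamma> mult act_inv(1)[of w \<gamma>] by simp
    qed (use \<gamma> in simp)
  qed
  then show ?case using mult finite_subset by blast
qed

section \<open>Root subsystems and their canonical generators\<close>

definition refl_stable :: "('a \<Rightarrow> real) set \<Rightarrow> bool" where
  "refl_stable \<Psi> \<longleftrightarrow> \<Psi> \<subseteq> \<Phi> \<and> (\<forall>\<gamma>\<in>\<Psi>. \<forall>\<beta>\<in>\<Psi>. refl \<gamma> \<bullet> \<beta> \<in> \<Psi>)"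

text \<open>Dyer's canonical generators of a reflection subgroup.\<close>

definition canonical :: "('a \<Rightarrow> real) set \<Rightarrow> ('a \<Rightarrow> real) set" where
  "canonical \<Psi> = {\<delta> \<in> \<Psi> \<inter> \<Phi>pos. \<forall>\<beta>\<in>\<Psi> \<inter> \<Phi>pos. nonpos_vec (refl \<delta> \<bullet> \<beta>) \<longrightarrow> \<beta> = \<delta>}"

lemma refl_stable_neg: "refl_stable \<Psi> \<Longrightarrow> \<gamma> \<in> \<Psi> \<Longrightarrow> (\<lambda>t. - \<gamma> t) \<in> \<Psi>"
  unfolding refl_stable_def using refl_self by (metis subsetD)

lemma refl_stable_act:
  assumes "refl_stable \<Psi>" "w \<in> carrier G"
  shows "refl_stable ((\<bullet>) w ` \<Psi>)"
proof -
  have "refl (w \<bullet> \<gamma>) \<bullet> w \<bullet> \<beta> = w \<bullet> refl \<gamma> \<bullet> \<beta>" if "\<gamma> \<in> \<Phi>" "\<beta> \<in> \<Phi>" for \<gamma> \<beta>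
    using that assms(2) by (simp add: refl_conj act_mult[symmetric] m_assoc)
  then show ?thesis
    using assms unfolding refl_stable_def by (auto simp: subset_iff image_iff)
qed

text \<open>When \<alpha>_t is not in \<Psi>, the reflection \<open>t\<close> keeps the sign of
  every root of \<Psi>, so it matches canonical roots of \<Psi> with those of the image.\<close>

lemma canonical_image:
  assumes \<Psi>: "refl_stable \<Psi>" and t: "t \<in> S" "simple_root t \<notin> \<Psi>"
    and \<delta>: "\<delta> \<in> \<Psi>" "\<delta> \<in> \<Phi>pos" "t \<bullet> \<delta> \<in> canonical ((\<bullet>) t ` \<Psi>)"
  shows "\<delta> \<in> canonical \<Psi>"
  unfolding canonical_def
proof (intro CollectI conjI ballI impI)
  fix \<beta> assume \<beta>: "\<beta> \<in> \<Psi> \<inter> \<Phi>pos" "nonpos_vec (refl \<delta> \<bullet> \<beta>)"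
  have r: "\<beta> \<in> \<Phi>" "\<delta> \<in> \<Phi>" using \<beta> \<delta> by (auto simp: pos_roots_iff)
  have tb: "t \<bullet> \<beta> \<in> (\<bullet>) t ` \<Psi> \<inter> \<Phi>pos"
    using \<beta> t act_gen_pos[of t \<beta>] by auto
  have eq: "refl (t \<bullet> \<delta>) \<bullet> t \<bullet> \<beta> = t \<bullet> refl \<delta> \<bullet> \<beta>"
  proof -
    have "refl (t \<bullet> \<delta>) \<otimes> t = t \<otimes> refl \<delta>"
      using t r by (simp add: refl_conj m_assoc)
    then show ?thesis using t r by (simp add: act_mult[symmetric])
  qed
  \<comment> \<open>The negative of a negative root is a positive root of \<Psi> other than
    \<alpha>_t, so \<open>t\<close> keeps it positive.\<close>
  define \<rho> where "\<rho> = (\<lambda>x. - (refl \<delta> \<bullet> \<beta>) x)"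
  have "\<rho> \<in> \<Psi>"
    unfolding \<rho>_def using \<Psi> \<beta> \<delta> by (intro refl_stable_neg) (auto simp: refl_stable_def)
  moreover have "\<rho> \<in> \<Phi>pos" using r \<beta> by (simp add: \<rho>_def pos_roots_iff)
  ultimately have "t \<bullet> \<rho> \<in> \<Phi>pos" using t by (metis act_gen_pos)
  moreover have "t \<bullet> \<rho> = (\<lambda>x. - (t \<bullet> refl \<delta> \<bullet> \<beta>) x)"
    unfolding \<rho>_def using t r by (simp add: act_neg)
  ultimately have "nonpos_vec (refl (t \<bullet> \<delta>) \<bullet> t \<bullet> \<beta>)"
    by (simp add: eq pos_roots_iff)
  then have "t \<bullet> \<beta> = t \<bullet> \<delta>" using \<delta>(3) tb by (auto simp: canonical_def)
  then show "\<beta> = \<delta>" using act_inject[of t \<beta> \<delta>] r t by simp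
qed (use \<delta> in auto)

text \<open>Remove the last letter t of \<open>w\<close>. If \<alpha>_t is in \<Psi>, it is itself
  canonical and inverted; otherwise \<Psi> is replaced by its image under t, whose canonical roots
  come back by \<open>canonical_image\<close>.\<close>

lemma canonical_inversion:
  assumes "w \<in> carrier G" "refl_stable \<Psi>" "\<gamma> \<in> \<Psi>" "\<gamma> \<in> \<Phi>pos" "nonpos_vec (w \<bullet> \<gamma>)"
  obtains \<delta> where "\<delta> \<in> canonical \<Psi>" "nonpos_vec (w \<bullet> \<delta>)"
proof -
  have "\<exists>\<delta>\<in>canonical \<Psi>. nonpos_vec (w \<bullet> \<delta>)"
    using assms
  proof (induction "len w" arbitrary: w \<Psi> \<gamma> rule: less_induct)
    case less
    have \<gamma>: "\<gamma> \<in> \<Phi>" using less.prems by (simp add: pos_roots_iff)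
    then have "w \<noteq> \<one>" using less.prems root_not_both by (auto simp: pos_roots_iff)
    then obtain v t where v: "v \<in> carrier G" "t \<in> S" "w = v \<otimes> t" "len w = Suc (len v)"
      using descent_exists less.prems by blast
    have neg: "nonpos_vec (w \<bullet> simple_root t)"
      using v by (intro act_simple_nonpos) auto
    show ?case
    proof (cases "simple_root t \<in> \<Psi>")
      case True
      have "simple_root t \<in> canonical \<Psi>"
        unfolding canonical_def using True v
        by (auto simp: pos_roots_iff) (metis act_gen_pos pos_roots_iff root_not_both)
      then show ?thesis using neg by blast
    next
      case False
      have \<gamma>t: "t \<bullet> \<gamma> \<in> \<Phi>pos" using False less.prems v by (metis act_gen_pos)
      have tt: "v \<bullet> x = w \<bullet> t \<bullet> x" if "fin_supp x" for x
        using v that by (simp add: act_mult[symmetric])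
      have vt: "v \<bullet> t \<bullet> x = w \<bullet> x" if "fin_supp x" for x
        using v that by (simp add: act_mult)
      have "\<exists>\<delta>\<in>canonical ((\<bullet>) t ` \<Psi>). nonpos_vec (v \<bullet> \<delta>)"
        by (rule less.hyps[of v _ "t \<bullet> \<gamma>"])
          (use v less.prems \<gamma>t \<gamma> vt in \<open>auto intro: refl_stable_act\<close>)
      then obtain \<delta>' where \<delta>': "\<delta>' \<in> canonical ((\<bullet>) t ` \<Psi>)" "nonpos_vec (v \<bullet> \<delta>')" by blast
      then obtain \<delta> where \<delta>: "\<delta> \<in> \<Psi>" "\<delta>' = t \<bullet> \<delta>" by (auto simp: canonical_def)
      have \<delta>r: "\<delta> \<in> \<Phi>" using \<delta> less.prems by (auto simp: refl_stable_def)
      have "\<delta> = t \<bullet> \<delta>'" using \<delta> \<delta>r v by (simp add: act_mult[symmetric])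
      \<comment> \<open>Otherwise -\<alpha>_t, and hence \<alpha>_t, would belong to \<Psi>.\<close>
      moreover have "\<delta>' \<noteq> simple_root t"
      proof
        assume "\<delta>' = simple_root t"
        then have "\<delta> = (\<lambda>x. - simple_root t x)"
          using calculation v by (simp add: act_gen reflection_simple)
        then show False using False \<delta> refl_stable_neg[OF less.prems(2) \<delta>(1)] by simp
      qed
      ultimately have "\<delta> \<in> \<Phi>pos"
        using act_gen_pos[of t \<delta>'] \<delta>' v by (auto simp: canonical_def)
      then have "\<delta> \<in> canonical \<Psi>"
        using canonical_image less.prems(2) v(2) False \<delta> \<delta>'(1) by blast
      then show ?thesis using \<delta>' \<delta> \<delta>r vt by auto
    qed
  qed
  then show ?thesis using that by blast
qed

lemma canonical_perm:
  assumes "refl_stable \<Psi>" "\<delta> \<in> canonical \<Psi>" "\<beta> \<in> \<Psi> \<inter> \<Phi>pos" "\<beta> \<noteq> \<delta>"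
  shows "refl \<delta> \<bullet> \<beta> \<in> \<Psi> \<inter> \<Phi>pos"
proof -
  have "refl \<delta> \<bullet> \<beta> \<in> \<Psi>" "\<not> nonpos_vec (refl \<delta> \<bullet> \<beta>)" "\<beta> \<in> \<Phi>" "\<delta> \<in> \<Phi>"
    using assms by (auto simp: canonical_def refl_stable_def)
  then show ?thesis by (simp add: pos_root_act_iff)
qed

lemma refl_stable_group:
  assumes "refl_stable \<Psi>" "u \<in> generate G (refl ` \<Psi>)" "\<gamma> \<in> \<Psi>"
  shows "u \<bullet> \<gamma> \<in> \<Psi>"
proof -
  have \<Psi>: "\<Psi> \<subseteq> \<Phi>" using assms by (simp add: refl_stable_def)
  obtain ds where "set ds \<subseteq> \<Psi>" "u = refl_prod ds"
    using assms(2) generate_refl[OF \<Psi>] by blast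
  then show ?thesis
  proof (induction ds arbitrary: u)
    case Nil
    then show ?case using assms \<Psi> by auto
  next
    case (Cons \<delta> ds)
    then have "u \<bullet> \<gamma> = refl \<delta> \<bullet> refl_prod ds \<bullet> \<gamma>"
      using \<Psi> assms by (auto simp: subset_iff intro!: act_mult)
    then show ?case using Cons assms(1) by (auto simp: refl_stable_def)
  qed
qed

text \<open>As long as some positive root of \<Psi> is inverted, a canonical one is, and multiplying
  by its reflection shortens \<open>w\<close>.\<close>

lemma refl_reduce:
  assumes "w \<in> carrier G" "refl_stable \<Psi>"
  obtains u where "u \<in> generate G (refl ` canonical \<Psi>)" "u \<in> carrier G"
    "\<And>\<beta>. \<beta> \<in> \<Psi> \<Longrightarrow> \<beta> \<in> \<Phi>pos \<Longrightarrow> nonneg_vec ((w \<otimes> u) \<bullet> \<beta>)"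
proof -
  have "\<exists>u\<in>generate G (refl ` canonical \<Psi>) \<inter> carrier G.
      \<forall>\<beta>\<in>\<Psi> \<inter> \<Phi>pos. nonneg_vec ((w \<otimes> u) \<bullet> \<beta>)"
    using assms(1)
  proof (induction "len w" arbitrary: w rule: less_induct)
    case less
    show ?case
    proof (cases "\<forall>\<beta>\<in>\<Psi> \<inter> \<Phi>pos. nonneg_vec (w \<bullet> \<beta>)")
      case True
      then show ?thesis
        using less.prems by (intro bexI[of _ \<one>]) (auto intro: generate.one)
    next
      case False
      then obtain \<beta> where \<beta>0: "\<beta> \<in> \<Psi>" "\<beta> \<in> \<Phi>pos" "\<not> nonneg_vec (w \<bullet> \<beta>)" by blast
      then have "w \<bullet> \<beta> \<in> \<Phi>" using less.prems by (intro root_act) (auto simp: pos_roots_iff)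
      then have \<beta>: "\<beta> \<in> \<Psi>" "\<beta> \<in> \<Phi>pos" "nonpos_vec (w \<bullet> \<beta>)"
        using \<beta>0 root_sign by auto
      then obtain \<delta> where \<delta>: "\<delta> \<in> canonical \<Psi>" "nonpos_vec (w \<bullet> \<delta>)"
        using canonical_inversion less.prems assms(2) by blast
      then have \<delta>p: "\<delta> \<in> \<Phi>pos" "\<delta> \<in> \<Phi>" by (auto simp: canonical_def pos_roots_iff)
      then have "len (w \<otimes> refl \<delta>) < len w" using len_refl less.prems \<delta> by blast
      then obtain u where u: "u \<in> generate G (refl ` canonical \<Psi>)" "u \<in> carrier G"
        "\<forall>\<beta>\<in>\<Psi> \<inter> \<Phi>pos. nonneg_vec ((w \<otimes> refl \<delta> \<otimes> u) \<bullet> \<beta>)"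
        using less.hyps[of "w \<otimes> refl \<delta>"] less.prems \<delta>p by auto
      moreover have "refl \<delta> \<otimes> u \<in> generate G (refl ` canonical \<Psi>)"
        using u \<delta> by (auto intro: generate.eng generate.incl)
      ultimately show ?thesis
        using less.prems \<delta>p by (intro bexI[of _ "refl \<delta> \<otimes> u"]) (auto simp: m_assoc)
    qed
  qed
  then show ?thesis using that by blast
qed

lemma canonical_subset: "canonical \<Psi> \<subseteq> \<Psi> \<inter> \<Phi>pos"
  by (auto simp: canonical_def)

text \<open>For positive \<gamma> in \<Psi>, choose a product \<open>u\<close> of canonical
  reflections such that \<open>refl \<gamma> \<otimes> u\<close> has no inversions in \<Psi>. This
  element sends \<open>inv u \<bullet> \<gamma>\<close> to -\<gamma>, so
  \<open>inv u \<bullet> \<gamma>\<close> is negative, and exchange finds a canonical root in the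
  orbit of \<gamma>.\<close>

lemma canonical_generates:
  assumes \<Psi>: "refl_stable \<Psi>"
  shows "generate G (refl ` canonical \<Psi>) = generate G (refl ` \<Psi>)"
proof
  have \<Psi>r: "\<Psi> \<subseteq> \<Phi>" using \<Psi> by (simp add: refl_stable_def)
  have car: "refl ` \<Psi> \<subseteq> carrier G" "refl ` canonical \<Psi> \<subseteq> carrier G"
    using \<Psi>r canonical_subset[of \<Psi>] by (auto simp: subset_iff)
  show "generate G (refl ` canonical \<Psi>) \<subseteq> generate G (refl ` \<Psi>)"
    using canonical_subset[of \<Psi>] by (intro mono_generate) blast
  have sub: "subgroup (generate G (refl ` canonical \<Psi>)) G"
    using car by (intro generate_is_subgroup)
  have pos: "refl \<gamma> \<in> generate G (refl ` canonical \<Psi>)" if \<gamma>: "\<gamma> \<in> \<Psi>" "\<gamma> \<in> \<Phi>pos" for \<gamma>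
  proof -
    have \<gamma>r: "\<gamma> \<in> \<Phi>" using \<gamma> \<Psi>r by blast
    obtain u where u: "u \<in> generate G (refl ` canonical \<Psi>)" "u \<in> carrier G"
      and b: "\<And>\<beta>. \<beta> \<in> \<Psi> \<Longrightarrow> \<beta> \<in> \<Phi>pos \<Longrightarrow> nonneg_vec ((refl \<gamma> \<otimes> u) \<bullet> \<beta>)"
      using refl_reduce[of "refl \<gamma>" \<Psi>] \<gamma>r \<Psi> by (metis refl_closed)
    have iu: "inv u \<in> generate G (refl ` canonical \<Psi>)"
      using u sub by (simp add: subgroup.m_inv_closed)
    then obtain ds where ds: "set ds \<subseteq> canonical \<Psi>" "inv u = refl_prod ds"
      using generate_refl[of "canonical \<Psi>"] canonical_subset[of \<Psi>] \<Psi>r by blast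
    have "inv u \<bullet> \<gamma> \<in> \<Psi>"
      using iu mono_generate[of "refl ` canonical \<Psi>" "refl ` \<Psi>"] canonical_subset[of \<Psi>] \<gamma> \<Psi>
      by (intro refl_stable_group) auto
    moreover have "(refl \<gamma> \<otimes> u) \<bullet> inv u \<bullet> \<gamma> = (\<lambda>t. - \<gamma> t)"
      using u \<gamma>r by (simp add: act_mult refl_self)
    ultimately have "inv u \<bullet> \<gamma> \<notin> \<Phi>pos"
      using b[of "inv u \<bullet> \<gamma>"] \<gamma> root_not_both by (auto simp: pos_roots_iff)
    then have "nonpos_vec (refl_prod ds \<bullet> \<gamma>)"
      using u \<gamma>r pos_root_act_iff[of "inv u" \<gamma>] ds(2) by (metis inv_closed)
    then obtain a \<delta> c where ac: "ds = a @ \<delta> # c" "refl_prod c \<bullet> \<gamma> = \<delta>"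
      using refl_exchange[of "\<Psi> \<inter> \<Phi>pos" "canonical \<Psi>" ds \<gamma>] canonical_subset[of \<Psi>]
        canonical_perm[OF \<Psi>] ds \<gamma> by auto
    have c: "set c \<subseteq> canonical \<Psi>" "\<delta> \<in> canonical \<Psi>" "set c \<subseteq> \<Phi>" "\<delta> \<in> \<Phi>"
      using ac ds canonical_subset[of \<Psi>] \<Psi>r by auto
    then have cg: "refl_prod c \<in> generate G (refl ` canonical \<Psi>)"
      using generate_refl[of "canonical \<Psi>"] canonical_subset[of \<Psi>] \<Psi>r by blast
    have "\<gamma> = inv (refl_prod c) \<bullet> \<delta>"
      using ac c \<gamma>r by auto
    then have "refl \<gamma> = inv (refl_prod c) \<otimes> refl \<delta> \<otimes> inv (inv (refl_prod c))"
      using refl_conj[of "inv (refl_prod c)" \<delta>] c by simp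
    then show ?thesis
      using cg c sub by (simp add: subgroup.m_inv_closed generate.eng generate.incl)
  qed
  have "refl ` \<Psi> \<subseteq> generate G (refl ` canonical \<Psi>)"
  proof (rule image_subsetI)
    fix \<gamma> assume \<gamma>: "\<gamma> \<in> \<Psi>"
    then have "\<gamma> \<in> \<Phi>" using \<Psi>r by blast
    then have "nonneg_vec \<gamma> \<or> nonpos_vec \<gamma>" by (rule root_sign)
    then show "refl \<gamma> \<in> generate G (refl ` canonical \<Psi>)"
    proof
      assume "nonneg_vec \<gamma>"
      then show ?thesis using pos \<gamma> \<open>\<gamma> \<in> \<Phi>\<close> by (simp add: pos_roots_iff)
    next
      assume "nonpos_vec \<gamma>"
      then have "refl (\<lambda>t. - \<gamma> t) \<in> generate G (refl ` canonical \<Psi>)"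
        using refl_stable_neg[OF \<Psi> \<gamma>] \<open>\<gamma> \<in> \<Phi>\<close> by (intro pos) (simp_all add: pos_roots_iff)
      then show ?thesis using refl_neg[OF \<open>\<gamma> \<in> \<Phi>\<close>] by simp
    qed
  qed
  then show "generate G (refl ` \<Psi>) \<subseteq> generate G (refl ` canonical \<Psi>)"
    using sub by (rule generate_subgroup_incl)
qed

text \<open>Passing to the canonical roots provides the permutation property that
  \<open>refl_group_no_inversion\<close> asks of its generators.\<close>

theorem refl_stable_no_inversion:
  assumes "refl_stable \<Psi>" "w \<in> generate G (refl ` \<Psi>)"
    "\<And>\<gamma>. \<gamma> \<in> \<Psi> \<Longrightarrow> \<gamma> \<in> \<Phi>pos \<Longrightarrow> nonneg_vec (w \<bullet> \<gamma>)"
  shows "w = \<one>"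
proof (rule refl_group_no_inversion[of "\<Psi> \<inter> \<Phi>pos" "canonical \<Psi>"])
  show "w \<in> generate G (refl ` canonical \<Psi>)"
    using assms canonical_generates by simp
  show "nonneg_vec (w \<bullet> \<delta>)" if "\<delta> \<in> canonical \<Psi>" for \<delta>
    using that assms(3) canonical_subset[of \<Psi>] by blast
  show "canonical \<Psi> \<subseteq> \<Psi> \<inter> \<Phi>pos" by (rule canonical_subset)
  show "refl \<delta> \<bullet> \<beta> \<in> \<Psi> \<inter> \<Phi>pos" if "\<delta> \<in> canonical \<Psi>" "\<beta> \<in> \<Psi> \<inter> \<Phi>pos" "\<beta> \<noteq> \<delta>" for \<delta> \<beta>
    using canonical_perm[OF assms(1)] that .
qed simp

end

section \<open>Standard parabolic subgroups and longest elements\<close>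

context coxeter
begin

lemma generate_closed: "J \<subseteq> S \<Longrightarrow> w \<in> generate G J \<Longrightarrow> w \<in> carrier G"
  using S_subset_carrier generate_in_carrier[of J w] by blast

lemma generate_subgroup: "J \<subseteq> S \<Longrightarrow> subgroup (generate G J) G"
  using S_subset_carrier by (intro generate_is_subgroup) blast

lemma root_nonzero:
  assumes "\<gamma> \<in> \<Phi>"
  obtains k where "\<gamma> k \<noteq> 0"
proof -
  have "\<not> (\<forall>k. \<gamma> k = 0)"
  proof
    assume "\<forall>k. \<gamma> k = 0"
    then have "nonneg_vec \<gamma>" "nonpos_vec \<gamma>" by (simp_all add: nonneg_vec_def nonpos_vec_def)
    then show False using root_not_both[OF assms] by blast
  qed
  then show ?thesis using that by blast
qed

lemma act_supp:
  assumes "u \<in> carrier G" "fin_supp v"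
  shows "u \<bullet> v = (\<lambda>x. \<Sum>t | v t \<noteq> 0. v t * (u \<bullet> simple_root t) x)"
  by (rule act_expand) (use assms in \<open>auto simp: fin_supp_def\<close>)

lemma nonpos_act:
  assumes "u \<in> carrier G" "fin_supp v" "supp_in L v" "nonneg_vec v"
    "\<And>l. l \<in> L \<Longrightarrow> nonpos_vec (u \<bullet> simple_root l)"
  shows "nonpos_vec (u \<bullet> v)"
  unfolding act_supp[OF assms(1,2)]
proof (rule nonpos_vec_sum[where c = v and f = "\<lambda>t. u \<bullet> simple_root t"])
  fix t assume "t \<in> {t. v t \<noteq> 0}"
  then show "0 \<le> v t" "nonpos_vec (u \<bullet> simple_root t)"
    using assms(3-5) by (simp_all add: nonneg_vec_def supp_in_def)
qed

lemma nonneg_act: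
  assumes "u \<in> carrier G" "fin_supp v" "supp_in L v" "nonneg_vec v"
    "\<And>l. l \<in> L \<Longrightarrow> nonneg_vec (u \<bullet> simple_root l)"
  shows "nonneg_vec (u \<bullet> v)"
  unfolding act_supp[OF assms(1,2)]
proof (rule nonneg_vec_sum[where c = v and f = "\<lambda>t. u \<bullet> simple_root t"])
  fix t assume "t \<in> {t. v t \<noteq> 0}"
  then show "0 \<le> v t" "nonneg_vec (u \<bullet> simple_root t)"
    using assms(3-5) by (simp_all add: nonneg_vec_def supp_in_def)
qed

lemma form_supp:
  assumes "fin_supp u" "fin_supp v"
  shows "form G u v = (\<Sum>t | v t \<noteq> 0. v t * form G u (simple_root t))"
proof -
  have "form G u (simple_root t) = (\<Sum>s | u s \<noteq> 0. u s * cox_matrix_entry G s t)" for t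
  proof -
    have "r = t" if "simple_root t r \<noteq> 0" for r
      using that by (simp add: simple_root_def split: if_splits)
    then have "form G u (simple_root t) =
        (\<Sum>s | u s \<noteq> 0. \<Sum>r\<in>{t}. u s * simple_root t r * cox_matrix_entry G s r)"
      using assms(1) by (intro form_eq_sum) (auto simp: fin_supp_def)
    then show ?thesis by simp
  qed
  then have "(\<Sum>t | v t \<noteq> 0. v t * form G u (simple_root t)) =
      (\<Sum>t | v t \<noteq> 0. \<Sum>s | u s \<noteq> 0. u s * v t * cox_matrix_entry G s t)"
    by (simp add: sum_distrib_left mult.assoc mult.left_commute)
  also have "\<dots> = form G u v" unfolding form_def by (rule sum.swap)
  finally show ?thesis ..
qed

lemma act_coord:
  assumes "J \<subseteq> S" "w \<in> generate G J" "s \<notin> J" "fin_supp v"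
  shows "(w \<bullet> v) s = v s"
proof -
  obtain ss where ss: "set ss \<subseteq> J" "w = word_prod G ss"
    using assms generate_words by blast
  have "refl_word G ss v s = v s"
    using ss(1) assms(3) by (induction ss) (auto simp: simple_reflection_def simple_root_def)
  then show ?thesis using act_word_prod[of ss v] ss assms by auto
qed

lemma act_orthogonal:
  assumes "J \<subseteq> S" "w \<in> generate G J" "fin_supp v" "\<And>j. j \<in> J \<Longrightarrow> B j v = 0"
  shows "w \<bullet> v = v"
proof -
  obtain ss where ss: "set ss \<subseteq> J" "w = word_prod G ss"
    using assms generate_words by blast
  have "refl_word G ss v = v"
    using ss(1) assms(4) by (induction ss) (auto simp: simple_reflection_def)
  then show ?thesis using act_word_prod[of ss v] ss assms by auto
qed

text \<open>Simple roots span extreme rays of the cone of positive roots: nonnegative terms cannot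
  cancel away from \<open>x\<close>, so every summand is supported on \<open>x\<close>.\<close>

lemma simple_root_decomposition:
  assumes "finite F" "x \<in> S" "\<And>i. i \<in> F \<Longrightarrow> 0 \<le> c i" "\<And>i. i \<in> F \<Longrightarrow> f i \<in> \<Phi>pos"
    "simple_root x = (\<lambda>t. \<Sum>i\<in>F. c i * f i t)" "i \<in> F" "c i \<noteq> 0"
  shows "f i = simple_root x"
proof (rule pos_root_eq_simple)
  have "f i t = 0" if "t \<noteq> x" for t
  proof -
    have "(\<Sum>i\<in>F. c i * f i t) = simple_root x t" using assms(5) by metis
    then have "(\<Sum>i\<in>F. c i * f i t) = 0" using that by (simp add: simple_root_def)
    then have "c i * f i t = 0"
      using assms(1,3,4,6) by (subst (asm) sum_nonneg_eq_0_iff) (auto simp: pos_roots_def)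
    then show ?thesis using assms(7) by simp
  qed
  then show "supp_in {x} (f i)" by (auto simp: supp_in_def)
qed (use assms in auto)

text \<open>Expanding \<beta> writes the simple root as a nonnegative combination of positive roots;
  by extremality every simple constituent of \<beta> is already mapped to it.\<close>

lemma simple_preimage:
  assumes "u \<in> carrier G" "K \<subseteq> S" "\<And>k. k \<in> K \<Longrightarrow> nonneg_vec (u \<bullet> simple_root k)"
    "\<beta> \<in> \<Phi>pos" "supp_in K \<beta>" "x \<in> S" "u \<bullet> \<beta> = simple_root x"
  obtains k where "k \<in> K" "\<beta> = simple_root k"
proof -
  have \<beta>: "\<beta> \<in> \<Phi>" "fin_supp \<beta>" using assms by (auto simp: pos_roots_iff)
  then obtain k where k: "\<beta> k \<noteq> 0"
    using root_nonzero by blast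
  then have kK: "k \<in> K" "k \<in> S" using assms by (auto simp: supp_in_def)
  have "u \<bullet> simple_root k = simple_root x"
  proof (rule simple_root_decomposition[where F = "{t. \<beta> t \<noteq> 0}" and c = \<beta>])
    show "simple_root x = (\<lambda>t. \<Sum>i | \<beta> i \<noteq> 0. \<beta> i * (u \<bullet> simple_root i) t)"
      using assms(7) act_supp[of u \<beta>] \<beta> assms(1) by simp
    show "u \<bullet> simple_root i \<in> \<Phi>pos" if "i \<in> {t. \<beta> t \<noteq> 0}" for i
      using that assms by (auto simp: pos_roots_iff supp_in_def)
  qed (use assms k \<beta> in \<open>auto simp: fin_supp_def pos_roots_iff nonneg_vec_def\<close>)
  then have "\<beta> = simple_root k" using assms \<beta> by (metis act_inject fin_supp_simple_root)
  then show ?thesis using that kK by blast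
qed

text \<open>Descents in \<open>J\<close> are removed from the right until none is left. The last
  conclusion serves inductions on the length: \<open>u\<close> is shorter as soon as it differs from
  \<open>w\<close>.\<close>

lemma parabolic_decomposition:
  assumes "w \<in> carrier G" "J \<subseteq> S"
  obtains u v where "u \<in> carrier G" "v \<in> generate G J" "w = u \<otimes> v"
    "\<And>j. j \<in> J \<Longrightarrow> nonneg_vec (u \<bullet> simple_root j)" "u = w \<or> len u < len w"
proof -
  have "\<exists>u\<in>carrier G. \<exists>v\<in>generate G J. w = u \<otimes> v \<and>
      (\<forall>j\<in>J. nonneg_vec (u \<bullet> simple_root j)) \<and> (u = w \<or> len u < len w)"
    using assms(1)
  proof (induction "len w" arbitrary: w rule: less_induct)
    case less
    show ?case
    proof (cases "\<forall>j\<in>J. nonneg_vec (w \<bullet> simple_root j)")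
      case True
      then show ?thesis
        using less.prems by (intro bexI[of _ w] bexI[of _ \<one>]) (auto intro: generate.one)
    next
      case False
      then obtain j where j: "j \<in> J" "j \<in> S" "nonpos_vec (w \<bullet> simple_root j)"
        using act_simple_sign less.prems assms(2) by blast
      then have l: "len (w \<otimes> j) < len w" using less.prems nonpos_simple_iff_len by blast
      moreover have "w \<otimes> j \<in> carrier G" using less.prems j by simp
      ultimately obtain u v where u: "u \<in> carrier G" "v \<in> generate G J" "w \<otimes> j = u \<otimes> v"
        "\<forall>i\<in>J. nonneg_vec (u \<bullet> simple_root i)" "u = w \<otimes> j \<or> len u < len (w \<otimes> j)"
        using less.hyps by meson
      have "v \<in> carrier G" using u assms generate_closed by blast
      moreover have "w = (w \<otimes> j) \<otimes> j" using less.prems j by simp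
      ultimately have "w = u \<otimes> (v \<otimes> j)" using u j by (simp add: m_assoc)
      moreover have "v \<otimes> j \<in> generate G J" using u j by (auto intro: generate.intros)
      ultimately show ?thesis using u l by (intro bexI[of _ u] bexI[of _ "v \<otimes> j"]) auto
    qed
  qed
  then show ?thesis using that by blast
qed

text \<open>Used for the set of all roots supported in \<open>L\<close> and, in
  \<open>comp_of_finite_type\<close>, for the positive roots involving \<alpha>_s, where
  faithfulness is the difficult hypothesis.\<close>

lemma finite_group_of_action:
  assumes "J \<subseteq> S" "finite R" "\<And>\<gamma>. \<gamma> \<in> R \<Longrightarrow> fin_supp \<gamma>"
    "\<And>w \<gamma>. w \<in> generate G J \<Longrightarrow> \<gamma> \<in> R \<Longrightarrow> w \<bullet> \<gamma> \<in> R"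
    "\<And>w. w \<in> generate G J \<Longrightarrow> (\<And>\<gamma>. \<gamma> \<in> R \<Longrightarrow> w \<bullet> \<gamma> = \<gamma>) \<Longrightarrow> w = \<one>"
  shows "finite (generate G J)"
proof -
  have "inj_on (\<lambda>w. restrict ((\<bullet>) w) R) (generate G J)"
  proof (rule inj_onI)
    fix u w assume uw: "u \<in> generate G J" "w \<in> generate G J"
      "restrict ((\<bullet>) u) R = restrict ((\<bullet>) w) R"
    have c: "u \<in> carrier G" "w \<in> carrier G" using uw assms(1) generate_closed by blast+
    have eq: "u \<bullet> \<gamma> = w \<bullet> \<gamma>" if "\<gamma> \<in> R" for \<gamma>
      using fun_cong[OF uw(3), of \<gamma>] that by simp
    have "inv u \<otimes> w = \<one>"
    proof (rule assms(5))
      show "inv u \<otimes> w \<in> generate G J"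
        using uw generate_subgroup[OF assms(1)] by (simp add: subgroup.m_closed subgroup.m_inv_closed)
      show "(inv u \<otimes> w) \<bullet> \<gamma> = \<gamma>" if "\<gamma> \<in> R" for \<gamma>
        using that assms(3) c by (simp add: act_mult eq[symmetric])
    qed
    then have "u \<otimes> (inv u \<otimes> w) = u" using c by simp
    then show "u = w" using c by simp
  qed
  moreover have "(\<lambda>w. restrict ((\<bullet>) w) R) ` generate G J \<subseteq> R \<rightarrow>\<^sub>E R"
    using assms(4) by auto
  ultimately show ?thesis
    using assms(2) finite_PiE[of R "\<lambda>_. R"] by (meson finite_imageD finite_subset)
qed

text \<open>The element \<open>u\<close> may lie outside the subgroup. It inverts every positive
  root supported in \<open>L\<close>, so these roots are finite in number, and the subgroup acts
  faithfully on them and their negatives.\<close>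

lemma finite_type_if_negative:
  assumes "L \<subseteq> S" "u \<in> carrier G" "\<And>l. l \<in> L \<Longrightarrow> nonpos_vec (u \<bullet> simple_root l)"
  shows "finite_type G L"
proof -
  define P where "P = {\<gamma> \<in> \<Phi>pos. supp_in L \<gamma>}"
  define R where "R = {\<gamma> \<in> \<Phi>. supp_in L \<gamma>}"
  have "P \<subseteq> {\<gamma> \<in> \<Phi>pos. nonpos_vec (u \<bullet> \<gamma>)}"
    using assms nonpos_act[of u _ L] by (auto simp: P_def pos_roots_iff)
  then have "finite P" using finite_inversions assms(2) finite_subset by blast
  moreover have "R \<subseteq> P \<union> (\<lambda>\<gamma> t. - \<gamma> t) ` P"
  proof
    fix \<gamma> assume \<gamma>: "\<gamma> \<in> R"
    then have "nonneg_vec \<gamma> \<or> nonpos_vec \<gamma>" using root_sign by (auto simp: R_def)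
    then show "\<gamma> \<in> P \<union> (\<lambda>\<gamma> t. - \<gamma> t) ` P"
    proof
      assume "nonpos_vec \<gamma>"
      then have "(\<lambda>t. - \<gamma> t) \<in> P" using \<gamma> by (simp add: P_def R_def pos_roots_iff)
      then show ?thesis by (auto intro!: image_eqI[of _ _ "\<lambda>t. - \<gamma> t"])
    qed (use \<gamma> in \<open>simp add: P_def R_def pos_roots_iff\<close>)
  qed
  ultimately have "finite R" using finite_subset by blast
  then show ?thesis
    unfolding finite_type_def
  proof (rule finite_group_of_action[OF assms(1)])
    fix w \<gamma> assume "w \<in> generate G L" "\<gamma> \<in> R"
    then show "w \<bullet> \<gamma> \<in> R"
      using generate_closed[OF assms(1)] supp_in_act[OF _ assms(1)] by (auto simp: R_def)
  next
    fix w assume w: "w \<in> generate G L" "\<And>\<gamma>. \<gamma> \<in> R \<Longrightarrow> w \<bullet> \<gamma> = \<gamma>"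
    have "w \<bullet> simple_root l = simple_root l" if "l \<in> L" for l
      using that assms(1) by (intro w(2)) (auto simp: R_def)
    then show "w = \<one>" using assms(1) w by (intro parabolic_no_inversion[of L]) auto
  qed (auto simp: R_def)
qed

section \<open>Longest elements\<close>

abbreviation longest :: "'a set \<Rightarrow> 'a" where "longest \<equiv> w0 G S"

lemma
  assumes "J \<subseteq> S" "finite_type G J"
  shows longest_in: "longest J \<in> generate G J"
    and longest_max: "\<And>w. w \<in> generate G J \<Longrightarrow> len w \<le> len (longest J)"
proof -
  define b where "b = Suc (Max (len ` generate G J))"
  have "\<forall>w. w \<in> generate G J \<longrightarrow> len w < b"
    using assms(2) by (auto simp: b_def finite_type_def less_Suc_eq_le)
  from arg_max_nat_lemma[of "\<lambda>w. w \<in> generate G J", OF generate.one this]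
  show "longest J \<in> generate G J" "\<And>w. w \<in> generate G J \<Longrightarrow> len w \<le> len (longest J)"
    unfolding w0_def by blast+
qed

lemma longest_neg:
  assumes "J \<subseteq> S" "finite_type G J" "j \<in> J"
  shows "nonpos_vec (longest J \<bullet> simple_root j)"
proof (rule act_simple_nonpos)
  show c: "longest J \<in> carrier G" "j \<in> S"
    using assms longest_in generate_closed by blast+
  have "longest J \<otimes> j \<in> generate G J"
    using assms longest_in by (auto intro: generate.intros)
  then have "len (longest J \<otimes> j) \<le> len (longest J)" using assms longest_max by blast
  then show "len (longest J \<otimes> j) < len (longest J)"
    using len_mult_gen_ne[OF c] by simp
qed

text \<open>Two sign changes cancel, so the product has no inversions. Equal factors give that the
  longest element is an involution, different ones that it is unique.\<close>

lemma longest_pair: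
  assumes "J \<subseteq> S" "u \<in> generate G J" "w \<in> generate G J"
    "\<And>j. j \<in> J \<Longrightarrow> nonpos_vec (u \<bullet> simple_root j)"
    "\<And>j. j \<in> J \<Longrightarrow> nonpos_vec (w \<bullet> simple_root j)"
  shows "u \<otimes> w = \<one>"
proof (rule parabolic_no_inversion[OF assms(1)])
  show "u \<otimes> w \<in> generate G J" using assms by (auto intro: generate.eng)
  fix j assume j: "j \<in> J"
  have c: "u \<in> carrier G" "w \<in> carrier G" using assms generate_closed by blast+
  have "nonpos_vec (u \<bullet> (\<lambda>t. - (w \<bullet> simple_root j) t))"
    by (rule nonpos_act[where L = J])
      (use c assms j supp_in_act[of w J "simple_root j"] in auto)
  then show "nonneg_vec ((u \<otimes> w) \<bullet> simple_root j)"
    using c by (simp add: act_mult act_neg)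
qed

lemma longest_unique:
  assumes "J \<subseteq> S" "w \<in> generate G J" "\<And>j. j \<in> J \<Longrightarrow> nonpos_vec (w \<bullet> simple_root j)"
  shows "w = longest J" and "finite_type G J"
proof -
  have c: "w \<in> carrier G" using assms generate_closed by blast
  show f: "finite_type G J" using assms c finite_type_if_negative by blast
  have "w \<otimes> w = \<one>" "longest J \<otimes> w = \<one>"
    using assms longest_in[OF assms(1) f] longest_neg[OF assms(1) f]
    by (blast intro: longest_pair[OF assms(1)])+
  moreover have "longest J \<in> carrier G" using longest_in[OF assms(1) f] generate_closed assms by blast
  ultimately show "w = longest J" using c by (metis r_cancel)
qed

lemma longest_closed: "J \<subseteq> S \<Longrightarrow> finite_type G J \<Longrightarrow> longest J \<in> carrier G"
  using longest_in generate_closed by blast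

lemma longest_square: "J \<subseteq> S \<Longrightarrow> finite_type G J \<Longrightarrow> longest J \<otimes> longest J = \<one>"
  using longest_in longest_neg by (intro longest_pair[of J]) auto

lemma longest_inv: "J \<subseteq> S \<Longrightarrow> finite_type G J \<Longrightarrow> inv (longest J) = longest J"
  using longest_square longest_closed inv_equality by blast

lemma longest_longest_act:
  "J \<subseteq> S \<Longrightarrow> finite_type G J \<Longrightarrow> fin_supp v \<Longrightarrow> longest J \<bullet> longest J \<bullet> v = v"
  using longest_square longest_closed by (simp add: act_mult[symmetric])

text \<open>The opposition on \<open>J\<close>. Expanding the positive root -w_0\<alpha>_j exhibits
  \<alpha>_j as a nonnegative combination of positive roots -w_0\<alpha>_i, so by extremality one of
  these is \<alpha>_j itself.\<close>

lemma longest_perm: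
  assumes "J \<subseteq> S" "finite_type G J" "j \<in> J"
  obtains i where "i \<in> J" "longest J \<bullet> simple_root j = (\<lambda>t. - simple_root i t)"
    "longest J \<bullet> simple_root i = (\<lambda>t. - simple_root j t)"
proof -
  let ?w = "longest J"
  have c: "?w \<in> carrier G" "j \<in> S" using assms longest_closed by auto
  define \<gamma> where "\<gamma> = (\<lambda>t. - (?w \<bullet> simple_root j) t)"
  have \<gamma>: "\<gamma> \<in> \<Phi>pos" "\<gamma> \<in> \<Phi>" "supp_in J \<gamma>"
    using c assms longest_neg[OF assms] supp_in_act[OF longest_in[OF assms(1,2)] assms(1), of "simple_root j"]
    by (auto simp: \<gamma>_def pos_roots_iff)
  have w\<gamma>: "?w \<bullet> \<gamma> = (\<lambda>t. - simple_root j t)"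
    using c assms by (simp add: \<gamma>_def act_neg longest_longest_act)
  obtain i where i: "\<gamma> i \<noteq> 0"
    using root_nonzero \<gamma> by blast
  then have iJ: "i \<in> J" "i \<in> S" using \<gamma> assms by (auto simp: supp_in_def)
  have "(\<lambda>t. - (?w \<bullet> simple_root i) t) = simple_root j"
  proof (rule simple_root_decomposition[where F = "{t. \<gamma> t \<noteq> 0}" and c = \<gamma>
        and f = "\<lambda>i t. - (?w \<bullet> simple_root i) t"])
    have "simple_root j = (\<lambda>t. - (?w \<bullet> \<gamma>) t)" using w\<gamma> by simp
    also have "\<dots> = (\<lambda>t. \<Sum>i | \<gamma> i \<noteq> 0. \<gamma> i * - (?w \<bullet> simple_root i) t)"
      using act_supp[of ?w \<gamma>] c \<gamma> by (simp add: sum_negf)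
    finally show "simple_root j = (\<lambda>t. \<Sum>i | \<gamma> i \<noteq> 0. \<gamma> i * - (?w \<bullet> simple_root i) t)" .
    show "(\<lambda>t. - (?w \<bullet> simple_root i) t) \<in> \<Phi>pos" if "i \<in> {t. \<gamma> t \<noteq> 0}" for i
      using that c \<gamma> assms longest_neg[OF assms(1,2), of i] by (auto simp: pos_roots_iff supp_in_def)
  qed (use i \<gamma> c in \<open>auto simp: pos_roots_iff nonneg_vec_def fin_supp_def[symmetric]\<close>)
  then have *: "?w \<bullet> simple_root i = (\<lambda>t. - simple_root j t)" by (metis add.inverse_inverse)
  have "simple_root i = ?w \<bullet> ?w \<bullet> simple_root i"
    using assms by (simp add: longest_longest_act)
  also have "\<dots> = (\<lambda>t. - (?w \<bullet> simple_root j) t)"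
    unfolding * using c by (simp add: act_neg)
  finally have "?w \<bullet> simple_root j = (\<lambda>t. - simple_root i t)" by (metis add.inverse_inverse)
  then show ?thesis using that iJ * by blast
qed

lemma conj_simple:
  assumes "w \<in> carrier G" "s \<in> S" "t \<in> S"
    "w \<bullet> simple_root s = simple_root t \<or> w \<bullet> simple_root s = (\<lambda>x. - simple_root t x)"
  shows "w \<otimes> s \<otimes> inv w = t"
  using assms refl_conj[of w "simple_root s"] refl_neg[of "simple_root t"] by auto

section \<open>Adjacency and components in the Coxeter graph\<close>

lemma entry_nonadjacent:
  assumes "s \<in> S" "t \<in> S" "s \<noteq> t" "\<not> cox_adj G s t"
  shows "cox_matrix_entry G s t = 0"
proof -
  have "cox_order G s t = 2"
    using assms cox_order_eq_1_iff[OF assms(1,2)] unfolding cox_adj_def by linarith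
  then show ?thesis by (simp add: cox_matrix_entry_def)
qed

lemma entry_adjacent:
  assumes "cox_adj G s t"
  shows "cox_matrix_entry G s t \<noteq> 0"
proof (cases "cox_order G s t = 0")
  case False
  then have m: "cox_order G s t \<ge> 3" using assms by (auto simp: cox_adj_def)
  have "0 < pi / real (cox_order G s t)" "pi / real (cox_order G s t) < pi / 2"
    using m by (auto simp: field_simps)
  then have "0 < cos (pi / real (cox_order G s t))" using cos_gt_zero by blast
  then show ?thesis by (simp add: cox_matrix_entry_def False)
qed (simp add: cox_matrix_entry_def)

lemma cox_adj_commute: "s \<in> S \<Longrightarrow> t \<in> S \<Longrightarrow> cox_adj G s t \<longleftrightarrow> cox_adj G t s"
  using cox_order_commute[of s t] by (auto simp: cox_adj_def)

lemma cox_connected_equiv: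
  assumes "J \<subseteq> S"
  shows "equiv J (cox_connected G J)"
proof (rule equivI)
  let ?r = "{(u, v). u \<in> J \<and> v \<in> J \<and> cox_adj G u v}"
  have "sym ?r" using assms cox_adj_commute by (auto simp: sym_def)
  then have "sym (?r\<^sup>*)" by (rule sym_rtrancl)
  then show "sym (cox_connected G J)" by (auto simp: cox_connected_def sym_def)
  show "trans (cox_connected G J)" by (auto simp: cox_connected_def trans_def)
  show "refl_on J (cox_connected G J)" by (auto simp: cox_connected_def refl_on_def)
qed (auto simp: cox_connected_def)

section \<open>The elementary conjugators\<close>

abbreviation comp_of :: "'a set \<Rightarrow> 'a \<Rightarrow> 'a set" where
  "comp_of J s \<equiv> components_meeting G J {s}"

lemma comp_of_eq:
  assumes "J \<subseteq> S" "s \<in> S"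
  shows "comp_of J s = cox_connected G (insert s J) `` {s}"
proof -
  let ?r = "cox_connected G (insert s J)"
  have eq: "equiv (insert s J) ?r" using assms by (intro cox_connected_equiv) auto
  have "s \<in> insert s J" by simp
  then have "{C \<in> insert s J // ?r. s \<in> C} = {?r `` {s}}"
  proof (intro equalityI subsetI)
    fix C assume "C \<in> {C \<in> insert s J // ?r. s \<in> C}"
    then obtain x where "C = ?r `` {x}" "(x, s) \<in> ?r" by (auto simp: quotient_def)
    then show "C \<in> {?r `` {s}}" using equiv_class_eq[OF eq] by simp
  qed (use equiv_class_self[OF eq] in \<open>auto simp: quotient_def\<close>)
  then show ?thesis by (simp add: components_meeting_def irreducible_components_def)
qed

lemma comp_of_subset: "J \<subseteq> S \<Longrightarrow> s \<in> S \<Longrightarrow> comp_of J s \<subseteq> insert s J"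
  by (simp add: comp_of_eq) (auto simp: cox_connected_def)

lemma comp_of_self: "J \<subseteq> S \<Longrightarrow> s \<in> S \<Longrightarrow> s \<in> comp_of J s"
  by (simp add: comp_of_eq cox_connected_def)

lemma comp_of_closed:
  assumes "J \<subseteq> S" "s \<in> S" "l \<in> comp_of J s" "k \<in> insert s J" "cox_adj G l k"
  shows "k \<in> comp_of J s"
  using assms by (auto simp: comp_of_eq cox_connected_def intro: rtrancl_into_rtrancl)

lemma comp_of_induct [consumes 3, case_names base step]:
  assumes "J \<subseteq> S" "s \<in> S" "l \<in> comp_of J s" "P s"
    "\<And>l k. l \<in> comp_of J s \<Longrightarrow> k \<in> comp_of J s \<Longrightarrow> P l \<Longrightarrow> cox_adj G l k \<Longrightarrow> P k"
  shows "P l"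
proof -
  have "(s, l) \<in> {(u, v). u \<in> insert s J \<and> v \<in> insert s J \<and> cox_adj G u v}\<^sup>*"
    using assms(1-3) by (auto simp: comp_of_eq cox_connected_def)
  then have "l \<in> comp_of J s \<and> P l"
  proof (induction rule: rtrancl_induct)
    case base
    then show ?case using assms comp_of_self by blast
  next
    case (step y z)
    then have "z \<in> comp_of J s" using comp_of_closed[OF assms(1,2), of y z] by auto
    then show ?case using step assms(5)[of y z] by auto
  qed
  then show ?thesis by blast
qed

lemma comp_of_orthogonal:
  assumes "J \<subseteq> S" "s \<in> S" "l \<in> comp_of J s" "k \<in> J" "k \<notin> comp_of J s"
  shows "cox_matrix_entry G l k = 0"
  using assms comp_of_closed[of J s l k] comp_of_subset[of J s]
  by (intro entry_nonadjacent) auto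

text \<open>Otherwise \<open>\<alpha>\<^sub>s\<close> would lie in the span of the \<open>\<alpha>\<^sub>m\<close>, so \<open>v \<alpha>\<^sub>s\<close> has a negative
  coefficient outside the simple roots \<open>v \<alpha>\<^sub>m\<close>.\<close>

lemma negative_outside:
  assumes "v \<in> carrier G" "s \<in> S" "M \<subseteq> S" "s \<notin> M"
    "\<And>m. m \<in> M \<Longrightarrow> \<exists>y\<in>S. v \<bullet> simple_root m = simple_root y"
    "nonpos_vec (v \<bullet> simple_root s)"
    "\<gamma> \<in> \<Phi>pos" "supp_in (insert s M) \<gamma>" "\<gamma> s \<noteq> 0"
  shows "nonpos_vec (v \<bullet> \<gamma>)"
proof -
  let ?c = "v \<bullet> simple_root s"
  have \<gamma>: "\<gamma> \<in> \<Phi>" "fin_supp \<gamma>" "nonneg_vec \<gamma>" using assms by (auto simp: pos_roots_iff)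
  have "\<exists>t. ?c t \<noteq> 0 \<and> (\<forall>m\<in>M. v \<bullet> simple_root m \<noteq> simple_root t)"
  proof (rule ccontr)
    assume "\<not> ?thesis"
    then have *: "\<exists>m\<in>M. v \<bullet> simple_root m = simple_root t" if "?c t \<noteq> 0" for t
      using that by blast
    have "inv v \<bullet> ?c = (\<lambda>x. \<Sum>t | ?c t \<noteq> 0. ?c t * (inv v \<bullet> simple_root t) x)"
      using assms by (intro act_supp) auto
    then have "(inv v \<bullet> ?c) s = (\<Sum>t | ?c t \<noteq> 0. ?c t * (inv v \<bullet> simple_root t) s)"
      by (rule fun_cong)
    also have "\<dots> = (\<Sum>t | ?c t \<noteq> 0. 0)"
    proof (rule sum.cong)
      fix t assume "t \<in> {t. ?c t \<noteq> 0}"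
      then obtain m where m: "m \<in> M" "v \<bullet> simple_root m = simple_root t" using * by blast
      then have "inv v \<bullet> simple_root t = simple_root m"
        using assms by (metis act_inv(1) fin_supp_simple_root)
      then show "?c t * (inv v \<bullet> simple_root t) s = 0"
        using m assms by (auto simp: simple_root_def)
    qed simp
    finally show False using assms by simp
  qed
  then obtain t where t: "?c t \<noteq> 0" "\<And>m. m \<in> M \<Longrightarrow> v \<bullet> simple_root m \<noteq> simple_root t" by blast
  have "(v \<bullet> \<gamma>) t = (\<Sum>l | \<gamma> l \<noteq> 0. \<gamma> l * (v \<bullet> simple_root l) t)"
    using act_supp[of v \<gamma>] assms \<gamma> by simp
  also have "\<dots> = (\<Sum>l\<in>{s}. \<gamma> l * (v \<bullet> simple_root l) t)"
  proof (rule sum.mono_neutral_right)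
    show "\<forall>i\<in>{t. \<gamma> t \<noteq> 0} - {s}. \<gamma> i * (v \<bullet> simple_root i) t = 0"
    proof
      fix i assume "i \<in> {t. \<gamma> t \<noteq> 0} - {s}"
      then have i: "i \<in> M" using assms by (auto simp: supp_in_def)
      then obtain y where "v \<bullet> simple_root i = simple_root y" using assms(5) by blast
      moreover have "y \<noteq> t" using calculation t(2)[OF i] by auto
      ultimately show "\<gamma> i * (v \<bullet> simple_root i) t = 0" by (simp add: simple_root_def)
    qed
  qed (use assms \<gamma> in \<open>auto simp: fin_supp_def\<close>)
  also have "\<dots> < 0"
  proof -
    have "0 < \<gamma> s" "?c t < 0"
      using t(1) assms(6,9) \<gamma>(3) by (simp_all add: nonpos_vec_def nonneg_vec_def order_less_le)
    then show ?thesis by (simp add: mult_pos_neg)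
  qed
  finally have "\<not> nonneg_vec (v \<bullet> \<gamma>)" by (auto simp: nonneg_vec_def not_le)
  then show ?thesis using root_sign[of "v \<bullet> \<gamma>"] assms \<gamma> by simp
qed

context
  fixes J :: "'a set" and s :: 'a
  assumes J: "J \<subseteq> S" and s: "s \<in> S" "s \<notin> J"
begin

definition edge_comp :: "'a set" where "edge_comp = comp_of J s"
definition edge_rest :: "'a set" where "edge_rest = edge_comp - {s}"

lemma edge_comp_facts: "edge_comp \<subseteq> S" "edge_rest \<subseteq> S" "edge_rest \<subseteq> J" "s \<in> edge_comp" "s \<notin> edge_rest" "edge_comp = insert s edge_rest" "edge_comp \<subseteq> insert s J"
  using comp_of_subset[OF J s(1)] comp_of_self[OF J s(1)] J s unfolding edge_rest_def edge_comp_def by auto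

lemma generate_rest_comp: "w \<in> generate G edge_rest \<Longrightarrow> w \<in> generate G edge_comp"
  using mono_generate[of edge_rest edge_comp] edge_comp_facts(6) by blast

text \<open>Let \<open>L\<close> be the component of \<open>s\<close> and \<open>M = L - {s}\<close>.  The group \<open>W\<^sub>M\<close> acts faithfully on the
  finite set \<open>R\<close> of positive roots of \<open>L\<close> involving \<open>\<alpha>\<^sub>s\<close>:
  the pointwise stabiliser \<open>N\<close> of \<open>R\<close> is normal in \<open>W\<^sub>M\<close>, hence its fixed space is stable
  under \<open>W\<^sub>M\<close>, and it contains \<open>\<alpha>\<^sub>s\<close>.\<close>

lemma comp_of_finite_type:
  assumes v: "v \<in> carrier G" "\<And>m. m \<in> edge_rest \<Longrightarrow> \<exists>y\<in>S. v \<bullet> simple_root m = simple_root y"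
    "nonpos_vec (v \<bullet> simple_root s)"
  shows "finite_type G edge_comp"
proof -
  define R where "R = {\<gamma> \<in> \<Phi>pos. supp_in edge_comp \<gamma> \<and> \<gamma> s \<noteq> 0}"
  have neg: "nonpos_vec (v \<bullet> \<gamma>)" if "\<gamma> \<in> R" for \<gamma>
    by (rule negative_outside[OF v(1) s(1) edge_comp_facts(2,5) v(2,3)])
      (use that edge_comp_facts(6) in \<open>simp_all add: R_def\<close>)
  then have "R \<subseteq> {\<gamma> \<in> \<Phi>pos. nonpos_vec (v \<bullet> \<gamma>)}" by (auto simp: R_def)
  then have finR: "finite R" using finite_inversions v(1) finite_subset by blast
  have sR: "simple_root s \<in> R" using s edge_comp_facts by (simp add: R_def pos_roots_iff)
  have gc: "w \<in> carrier G" if "w \<in> generate G edge_rest" for w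
    using that edge_comp_facts generate_closed by blast
  have fR: "fin_supp \<gamma>" "\<gamma> \<in> \<Phi>" if "\<gamma> \<in> R" for \<gamma> using that by (auto simp: R_def pos_roots_iff)
  have stab: "w \<bullet> \<gamma> \<in> R" if w: "w \<in> generate G edge_rest" and \<gamma>: "\<gamma> \<in> R" for w \<gamma>
  proof -
    have "(w \<bullet> \<gamma>) s = \<gamma> s" using w \<gamma> fR(1) by (intro act_coord[OF edge_comp_facts(2) _ edge_comp_facts(5)])
    moreover have g: "\<gamma> s > 0" using \<gamma> by (auto simp: R_def pos_roots_def order_less_le)
    ultimately have "\<not> nonpos_vec (w \<bullet> \<gamma>)" unfolding nonpos_vec_def by (metis not_le)
    then have "w \<bullet> \<gamma> \<in> \<Phi>pos" using pos_root_act_iff gc[OF w] fR[OF \<gamma>] by blast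
    moreover have "supp_in edge_comp (w \<bullet> \<gamma>)"
      using generate_rest_comp[OF w] edge_comp_facts(1) \<gamma> fR[OF \<gamma>] by (intro supp_in_act) (simp_all add: R_def)
    ultimately show ?thesis using \<open>(w \<bullet> \<gamma>) s = \<gamma> s\<close> g by (simp add: R_def)
  qed
  have finM: "finite (generate G edge_rest)"
  proof (rule finite_group_of_action[OF edge_comp_facts(2) finR])
    fix w assume w: "w \<in> generate G edge_rest" "\<And>\<gamma>. \<gamma> \<in> R \<Longrightarrow> w \<bullet> \<gamma> = \<gamma>"
    define N where "N = {w \<in> generate G edge_rest. \<forall>\<gamma>\<in>R. w \<bullet> \<gamma> = \<gamma>}"
    \<comment> \<open>Propagation along the component: if \<open>N\<close> fixes \<alpha>_l and
      \<open>k\<close> is adjacent to \<open>l\<close>, then \<open>N\<close> fixes the image of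
      \<alpha>_l under \<open>k\<close>, because \<open>k\<close> normalizes \<open>N\<close>, and
      hence also the difference from \<alpha>_l, a nonzero multiple of \<alpha>_k.\<close>
    have fixl: "\<forall>w\<in>N. w \<bullet> simple_root l = simple_root l" if "l \<in> comp_of J s" for l
      using J s(1) that
    proof (induction rule: comp_of_induct)
      case base
      show ?case using sR by (simp add: N_def)
    next
      case (step l k)
      show ?case
      proof (cases "k = s")
        case True
        then show ?thesis using sR by (simp add: N_def)
      next
        case False
        then have k: "k \<in> edge_rest" "k \<in> S" "l \<in> S" using step edge_comp_facts(1) by (auto simp: edge_rest_def edge_comp_def)
        show ?thesis
        proof
          fix w assume wN: "w \<in> N"
          then have wc: "w \<in> carrier G" "w \<in> generate G edge_rest" using gc by (auto simp: N_def)
          have kg: "k \<in> generate G edge_rest" using k by (auto intro: generate.incl)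
          have "k \<otimes> w \<otimes> k \<in> N"
          proof -
            have "(k \<otimes> w \<otimes> k) \<bullet> \<gamma> = \<gamma>" if "\<gamma> \<in> R" for \<gamma>
            proof -
              have "w \<bullet> k \<bullet> \<gamma> = k \<bullet> \<gamma>" using stab[OF kg that] wN by (simp add: N_def)
              then show ?thesis
                using k wc fR[OF that] by (simp add: act_mult) (simp add: act_mult[symmetric])
            qed
            then show ?thesis using kg wc by (auto simp: N_def intro: generate.eng)
          qed
          then have "(k \<otimes> w \<otimes> k) \<bullet> simple_root l = simple_root l" using step by blast
          then have "k \<bullet> (k \<otimes> w \<otimes> k) \<bullet> simple_root l = k \<bullet> simple_root l" by simp
          then have eq: "w \<bullet> k \<bullet> simple_root l = k \<bullet> simple_root l"
            using k wc by (simp add: act_mult[symmetric] m_assoc)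
          define e where "e = - 2 * cox_matrix_entry G k l"
          have e: "e \<noteq> 0" using entry_adjacent[OF step(3)] entry_commute[of k l] k by (simp add: e_def)
          have kl: "k \<bullet> simple_root l = (\<lambda>t. 1 * simple_root l t + e * simple_root k t)"
            using k by (simp add: act_gen simple_reflection_def e_def)
          have "w \<bullet> simple_root l = simple_root l" using step wN by blast
          then have "(\<lambda>t. 1 * simple_root l t + e * (w \<bullet> simple_root k) t) =
              (\<lambda>t. 1 * simple_root l t + e * simple_root k t)"
            using eq[unfolded kl] wc by (simp add: act_lin[of w "simple_root l" "simple_root k" 1 e, simplified])
          then show "w \<bullet> simple_root k = simple_root k" using e by (simp add: fun_eq_iff)
        qed
      qed
    qed
    show "w = \<one>"
    proof (rule parabolic_no_inversion[OF edge_comp_facts(2) w(1)])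
      fix j assume "j \<in> edge_rest"
      then have "j \<in> comp_of J s" using edge_comp_facts(6) edge_comp_def by auto
      moreover have "w \<in> N" using w by (simp add: N_def)
      ultimately show "nonneg_vec (w \<bullet> simple_root j)" using fixl by simp
    qed
  qed (use fR stab in auto)
  then have fM: "finite_type G edge_rest" by (simp add: finite_type_def)
  \<comment> \<open>\<open>v \<otimes> ?w\<close> makes the whole component negative: \<alpha>_s
    goes first to a root in \<open>R\<close>, which \<open>v\<close> makes negative, and the other
    simple roots go to negatives of simple roots.\<close>
  let ?w = "longest edge_rest"
  have wM: "?w \<in> carrier G" "?w \<in> generate G edge_rest"
    using longest_in[OF edge_comp_facts(2) fM] longest_closed[OF edge_comp_facts(2) fM] by auto
  show ?thesis
  proof (rule finite_type_if_negative[OF edge_comp_facts(1)])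
    show "v \<otimes> ?w \<in> carrier G" using v wM by simp
    fix l assume l: "l \<in> edge_comp"
    show "nonpos_vec ((v \<otimes> ?w) \<bullet> simple_root l)"
    proof (cases "l = s")
      case True
      then show ?thesis using neg[OF stab[OF wM(2) sR]] v wM by (simp add: act_mult)
    next
      case False
      then have lM: "l \<in> edge_rest" using l by (simp add: edge_rest_def)
      then obtain i where i: "i \<in> edge_rest" "?w \<bullet> simple_root l = (\<lambda>t. - simple_root i t)"
        using longest_perm[OF edge_comp_facts(2) fM lM] by blast
      obtain y where "v \<bullet> simple_root i = simple_root y" using v(2)[OF i(1)] by blast
      then show ?thesis using v(1) wM i(2) by (simp add: act_mult act_neg)
    qed
  qed
qed

definition edge_conj :: 'a where "edge_conj = longest edge_comp \<otimes> longest edge_rest"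

context
  assumes fL: "finite_type G edge_comp"
begin

lemma fM: "finite_type G edge_rest"
  using fL mono_generate[of edge_rest edge_comp] edge_comp_facts(6) finite_subset unfolding finite_type_def by blast

lemma edge_conj_facts:
  shows edge_conj_in: "edge_conj \<in> generate G edge_comp" and edge_conj_closed: "edge_conj \<in> carrier G"
    and wL: "longest edge_comp \<in> carrier G" and wM: "longest edge_rest \<in> carrier G"
    and edge_conj_inv: "inv edge_conj = longest edge_rest \<otimes> longest edge_comp"
proof -
  show wL: "longest edge_comp \<in> carrier G" "longest edge_rest \<in> carrier G"
    using longest_closed[OF edge_comp_facts(1) fL] longest_closed[OF edge_comp_facts(2) fM] by auto
  have "longest edge_rest \<in> generate G edge_comp" "longest edge_comp \<in> generate G edge_comp"
    using generate_rest_comp[OF longest_in[OF edge_comp_facts(2) fM]] longest_in[OF edge_comp_facts(1) fL] .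
  then show "edge_conj \<in> generate G edge_comp" unfolding edge_conj_def by (rule generate.eng[rotated])
  then show "edge_conj \<in> carrier G" using edge_comp_facts generate_closed by blast
  show "inv edge_conj = longest edge_rest \<otimes> longest edge_comp"
    unfolding edge_conj_def using wL longest_inv[OF edge_comp_facts(1) fL] longest_inv[OF edge_comp_facts(2) fM]
    by (simp add: inv_mult_group)
qed

lemma edge_conj_rest:
  assumes "m \<in> edge_rest"
  obtains y where "y \<in> edge_comp" "edge_conj \<bullet> simple_root m = simple_root y"
proof -
  obtain i where i: "i \<in> edge_rest" "longest edge_rest \<bullet> simple_root m = (\<lambda>t. - simple_root i t)"
    using longest_perm[OF edge_comp_facts(2) fM assms] by blast
  then have "i \<in> edge_comp" using edge_comp_facts by auto
  then obtain y where y: "y \<in> edge_comp" "longest edge_comp \<bullet> simple_root i = (\<lambda>t. - simple_root y t)"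
    using longest_perm[OF edge_comp_facts(1) fL] by blast
  have "edge_conj \<bullet> simple_root m = simple_root y"
    using i y wL wM by (simp add: edge_conj_def act_mult act_neg)
  then show ?thesis using that y by blast
qed

lemma edge_comp_orthogonal:
  assumes "x \<in> J" "x \<notin> edge_comp" "w \<in> generate G edge_comp"
  shows "w \<bullet> simple_root x = simple_root x"
  using assms comp_of_orthogonal[OF J s(1), of _ x]
  by (intro act_orthogonal[OF edge_comp_facts(1)]) (simp_all add: edge_comp_def)

text \<open>Supplies the entries of the head of an edge. Inside the component the signs of two
  oppositions cancel; outside it the element acts trivially.\<close>

lemma edge_conj_base:
  assumes "x \<in> J"
  obtains y where "y \<in> insert s J" "y \<in> S" "edge_conj \<bullet> simple_root x = simple_root y"
proof (cases "x \<in> edge_comp")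
  case True
  then have "x \<in> edge_rest" using assms s by (auto simp: edge_rest_def)
  then obtain y where "y \<in> edge_comp" "edge_conj \<bullet> simple_root x = simple_root y" by (rule edge_conj_rest)
  then show ?thesis using that[of y] edge_comp_facts(1,7) by blast
next
  case False
  then show ?thesis using edge_comp_orthogonal[OF assms False edge_conj_in] that assms J by auto
qed

lemma longest_rest_root: "longest edge_rest \<bullet> simple_root s \<in> \<Phi>pos" "supp_in edge_comp (longest edge_rest \<bullet> simple_root s)"
  "(longest edge_rest \<bullet> simple_root s) s = 1"
proof -
  show c: "(longest edge_rest \<bullet> simple_root s) s = 1"
    using act_coord[OF edge_comp_facts(2) longest_in[OF edge_comp_facts(2) fM] edge_comp_facts(5)] by simp
  then have "\<not> nonpos_vec (longest edge_rest \<bullet> simple_root s)" by (auto simp: nonpos_vec_def intro!: exI[of _ s])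
  then show "longest edge_rest \<bullet> simple_root s \<in> \<Phi>pos" using wM s by (simp add: pos_root_act_iff)
  show "supp_in edge_comp (longest edge_rest \<bullet> simple_root s)"
    using generate_rest_comp[OF longest_in[OF edge_comp_facts(2) fM]] edge_comp_facts(1,4) by (intro supp_in_act) simp_all
qed

text \<open>The opposition of \<open>edge_comp\<close> sends \<open>s\<close> to \<open>t\<close>,
  the one element of \<open>insert s J\<close> that is not hit by \<open>J\<close>. It labels the
  opposite edge, and the formula for the inverse shows that this edge makes \<alpha>_t
  negative.\<close>

lemma edge_conj_missing:
  obtains t where "t \<in> edge_comp" "inv edge_conj \<bullet> simple_root t = (\<lambda>x. - (longest edge_rest \<bullet> simple_root s) x)"
    "\<And>x. x \<in> J \<Longrightarrow> edge_conj \<bullet> simple_root x \<noteq> simple_root t"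
    "\<And>k. k \<in> insert s J \<Longrightarrow> k \<noteq> t \<Longrightarrow> \<exists>x\<in>J. edge_conj \<bullet> simple_root x = simple_root k"
    "longest edge_comp \<bullet> simple_root s = (\<lambda>x. - simple_root t x)"
    "longest edge_comp \<bullet> simple_root t = (\<lambda>x. - simple_root s x)"
proof -
  obtain t where t: "t \<in> edge_comp" "longest edge_comp \<bullet> simple_root s = (\<lambda>x. - simple_root t x)"
      "longest edge_comp \<bullet> simple_root t = (\<lambda>x. - simple_root s x)"
    using longest_perm[OF edge_comp_facts(1) fL edge_comp_facts(4)] by blast
  have inv: "inv edge_conj \<bullet> simple_root t = (\<lambda>x. - (longest edge_rest \<bullet> simple_root s) x)"
    using t wL wM by (simp add: edge_conj_inv act_mult act_neg)
  show ?thesis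
  proof (rule that[OF t(1) inv _ _ t(2,3)])
    fix x assume x: "x \<in> J"
    show "edge_conj \<bullet> simple_root x \<noteq> simple_root t"
    proof
      assume "edge_conj \<bullet> simple_root x = simple_root t"
      then have "simple_root x = (\<lambda>y. - (longest edge_rest \<bullet> simple_root s) y)"
        using inv act_inv(1)[OF edge_conj_closed, of "simple_root x"] by simp
      then have "nonneg_vec (\<lambda>y. - (longest edge_rest \<bullet> simple_root s) y)" by (metis nonneg_simple_root)
      then show False
        using longest_rest_root(1) root_not_both by (auto simp: pos_roots_iff)
    qed
  next
    fix k assume k: "k \<in> insert s J" "k \<noteq> t"
    show "\<exists>x\<in>J. edge_conj \<bullet> simple_root x = simple_root k"
    proof (cases "k \<in> edge_comp")
      case True
      then obtain i where i: "i \<in> edge_comp" "longest edge_comp \<bullet> simple_root i = (\<lambda>t. - simple_root k t)"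
        using longest_perm[OF edge_comp_facts(1) fL True] by blast
      then have "i \<noteq> s" using t k by (auto simp: fun_eq_iff dest!: spec[of _ k] simp: simple_root_def)
      then have "i \<in> edge_rest" using i by (simp add: edge_rest_def)
      then obtain m where m: "m \<in> edge_rest" "longest edge_rest \<bullet> simple_root m = (\<lambda>t. - simple_root i t)"
        using longest_perm[OF edge_comp_facts(2) fM] by blast
      have "edge_conj \<bullet> simple_root m = simple_root k"
        using i m wL wM by (simp add: edge_conj_def act_mult act_neg)
      then show ?thesis using m edge_comp_facts by blast
    next
      case False
      then have "k \<in> J" using k edge_comp_facts by auto
      then show ?thesis using edge_comp_orthogonal[OF _ False edge_conj_in] by blast
    qed
  qed
qed

end

text \<open>The quotient \<open>v \<otimes> inv edge_conj\<close> has no inversions: simple roots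
  other than \<alpha>_t pass through simple roots of \<open>J\<close>, and \<alpha>_t goes to the
  negative of a positive root involving \<alpha>_s, which \<open>v\<close> makes negative by
  \<open>negative_outside\<close>.\<close>

lemma edge_conj_unique:
  assumes v: "v \<in> generate G (insert s J)" "\<And>x. x \<in> J \<Longrightarrow> \<exists>y\<in>S. v \<bullet> simple_root x = simple_root y"
    "nonpos_vec (v \<bullet> simple_root s)"
  shows "v = edge_conj" "finite_type G edge_comp"
proof -
  have K: "insert s J \<subseteq> S" using J s by simp
  have vc: "v \<in> carrier G" using v K generate_closed by blast
  have vM: "\<exists>y\<in>S. v \<bullet> simple_root m = simple_root y" if "m \<in> edge_rest" for m using that v edge_comp_facts by blast
  show fL: "finite_type G edge_comp" by (rule comp_of_finite_type[OF vc vM v(3)])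
  obtain t where t: "t \<in> edge_comp" "inv edge_conj \<bullet> simple_root t = (\<lambda>x. - (longest edge_rest \<bullet> simple_root s) x)"
    "\<And>k. k \<in> insert s J \<Longrightarrow> k \<noteq> t \<Longrightarrow> \<exists>x\<in>J. edge_conj \<bullet> simple_root x = simple_root k"
    using edge_conj_missing[OF fL] by metis
  have "edge_conj \<in> generate G (insert s J)"
    using edge_conj_in[OF fL] mono_generate[of edge_comp "insert s J"] edge_comp_facts by auto
  then have g: "v \<otimes> inv edge_conj \<in> generate G (insert s J)"
    using v generate_subgroup[OF K] by (simp add: subgroup.m_closed subgroup.m_inv_closed)
  have c: "edge_conj \<in> carrier G" using edge_conj_closed[OF fL] .
  have "v \<otimes> inv edge_conj = \<one>"
  proof (rule parabolic_no_inversion[OF K g])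
    fix k assume k: "k \<in> insert s J"
    show "nonneg_vec ((v \<otimes> inv edge_conj) \<bullet> simple_root k)"
    proof (cases "k = t")
      case True
      have "nonpos_vec (v \<bullet> longest edge_rest \<bullet> simple_root s)"
        by (rule negative_outside[OF vc s(1) edge_comp_facts(2,5) vM v(3)])
          (use longest_rest_root[OF fL] edge_comp_facts(6) in simp_all)
      then show ?thesis
        using True t(2) vc c wM[OF fL] by (simp add: act_mult act_neg)
    next
      case False
      then obtain x where x: "x \<in> J" "edge_conj \<bullet> simple_root x = simple_root k" using t(3) k by blast
      then have "inv edge_conj \<bullet> simple_root k = simple_root x" using c by (metis act_inv(1) fin_supp_simple_root)
      then show ?thesis using v(2)[OF x(1)] vc c by (auto simp: act_mult)
    qed
  qed
  then have "v \<otimes> inv edge_conj \<otimes> edge_conj = edge_conj" using c by simp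
  then show "v = edge_conj" using vc c by (simp add: m_assoc)
qed

text \<open>By exchange \<gamma> is in the orbit of a simple root of the component, so
  \<open>refl \<gamma>\<close> lies in the parabolic subgroup where \<open>edge_conj_unique\<close>
  can identify it with \<open>edge_conj\<close>.\<close>

lemma edge_conj_fixes:
  assumes fL: "finite_type G edge_comp" and \<gamma>: "\<gamma> \<in> \<Phi>pos" "\<And>x. x \<in> J \<Longrightarrow> form G \<gamma> (simple_root x) = 0"
    and neg: "nonpos_vec (edge_conj \<bullet> \<gamma>)" and x: "x \<in> J"
  shows "edge_conj \<bullet> simple_root x = simple_root x"
proof -
  have \<gamma>r: "\<gamma> \<in> \<Phi>" "fin_supp \<gamma>" "supp_in S \<gamma>" using \<gamma> by (auto simp: pos_roots_iff)
  have K: "insert s J \<subseteq> S" using J s by simp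
  obtain ss where ss: "set ss \<subseteq> edge_comp" "edge_conj = word_prod G ss"
    using edge_conj_in[OF fL] generate_words[OF edge_comp_facts(1)] by blast
  then have "set ss \<subseteq> S" using edge_comp_facts by auto
  then obtain a l b where ab: "ss = a @ l # b" "word_prod G b \<bullet> \<gamma> = simple_root l"
    using exchange[of ss \<gamma>] \<gamma> neg ss by metis
  define u where "u = inv (word_prod G b)"
  have b: "word_prod G b \<in> generate G edge_comp" "l \<in> edge_comp" "l \<in> S"
    using ss ab edge_comp_facts(1) generate_words[OF edge_comp_facts(1)] by auto
  then have bc: "word_prod G b \<in> carrier G" using edge_comp_facts generate_closed by blast
  have u: "u \<in> generate G edge_comp" "u \<in> carrier G"
    using b bc generate_subgroup[OF edge_comp_facts(1)] by (auto simp: u_def subgroup.m_inv_closed)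
  have \<gamma>u: "\<gamma> = u \<bullet> simple_root l"
    using ab bc \<gamma>r by (simp add: u_def ab(2)[symmetric])
  have supp: "supp_in edge_comp \<gamma>" unfolding \<gamma>u using u b edge_comp_facts by (intro supp_in_act) auto
  have "refl \<gamma> = u \<otimes> l \<otimes> inv u" using \<gamma>u u b by (simp add: refl_eq)
  then have "refl \<gamma> \<in> generate G edge_comp"
    using u b generate_subgroup[OF edge_comp_facts(1)]
    by (simp add: subgroup.m_closed subgroup.m_inv_closed generate.incl)
  then have rg: "refl \<gamma> \<in> generate G (insert s J)"
    using mono_generate[of edge_comp "insert s J"] edge_comp_facts(7) by auto
  \<comment> \<open>\<gamma> is supported in the component and orthogonal to all of its simple roots
    except \<alpha>_s, so the norm 1 comes from the coordinate at \<open>s\<close> alone. The image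
    of \<alpha>_s under \<open>refl \<gamma>\<close> then has coordinate 1 - 2 at
    \<open>s\<close>.\<close>
  have 0: "\<gamma> t * form G \<gamma> (simple_root t) = 0" if "t \<noteq> s" for t
    using that supp \<gamma>(2)[of t] edge_comp_facts by (cases "\<gamma> t = 0") (auto simp: supp_in_def)
  have "1 = form G \<gamma> \<gamma>" using \<gamma>r by simp
  also have "\<dots> = (\<Sum>t | \<gamma> t \<noteq> 0. \<gamma> t * form G \<gamma> (simple_root t))" using form_supp \<gamma>r by blast
  also have "\<dots> = (\<Sum>t | \<gamma> t \<noteq> 0. if t = s then \<gamma> s * form G \<gamma> (simple_root s) else 0)"
    by (rule sum.cong) (use 0 in auto)
  also have "\<dots> = \<gamma> s * form G \<gamma> (simple_root s)"
    using \<gamma>r by (auto simp: fin_supp_def sum.delta')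
  finally have 1: "\<gamma> s * form G \<gamma> (simple_root s) = 1" ..
  have "(refl \<gamma> \<bullet> simple_root s) s = - 1"
    using 1 \<gamma>r s by (simp add: refl_act mult.commute)
  then have "\<not> nonneg_vec (refl \<gamma> \<bullet> simple_root s)" by (auto simp: nonneg_vec_def intro!: exI[of _ s])
  then have neg': "nonpos_vec (refl \<gamma> \<bullet> simple_root s)"
    using act_simple_sign[of "refl \<gamma>" s] \<gamma>r s by auto
  have fixX: "refl \<gamma> \<bullet> simple_root x = simple_root x" if "x \<in> J" for x
    using \<gamma>r \<gamma>(2)[OF that] that J by (intro refl_orthogonal) auto
  then have "refl \<gamma> = edge_conj" using J by (intro edge_conj_unique(1)[OF rg _ neg']) blast
  then show ?thesis using fixX x by simp
qed

end

end

section \<open>Trees in digraphs with reversible arcs\<close>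

context wf_digraph
begin

lemma awalk_append_ex: "awalk u (p @ q) v \<longleftrightarrow> (\<exists>w. awalk u p w \<and> awalk w q v)"
  by (metis awalk_appendI awalk_append_iff awalkE)

declare awalk_append_iff [simp del]

lemma awalk_snoc: "awalk u (p @ [e]) v \<longleftrightarrow> awalk u p (tail G e) \<and> e \<in> arcs G \<and> head G e = v"
  by (auto simp: awalk_append_ex awalk_Cons_iff awalk_Nil_iff)

end

text \<open>Separates the facts about trees from the Coxeter setting, where \<open>flip\<close>
  becomes \<open>edge_rev\<close>.\<close>

locale rev_digraph = wf_digraph G for G :: "('v, 'e) pre_digraph" +
  fixes flip :: "'e \<Rightarrow> 'e"
  assumes flip_arc: "e \<in> arcs G \<Longrightarrow> flip e \<in> arcs G"
    and tail_flip: "e \<in> arcs G \<Longrightarrow> tail G (flip e) = head G e"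
    and head_flip: "e \<in> arcs G \<Longrightarrow> head G (flip e) = tail G e"
    and flip_flip: "e \<in> arcs G \<Longrightarrow> flip (flip e) = e"
begin

text \<open>\<open>successively\<close> comes with rules for lists built by \<open>#\<close> and
  \<open>@\<close>; \<open>reduced_nth\<close> matches it with the indexwise
  \<open>non_backtracking\<close>.\<close>

definition reduced :: "'e list \<Rightarrow> bool" where
  "reduced = successively (\<lambda>e f. f \<noteq> flip e)"

lemma reduced_nth: "reduced es \<longleftrightarrow> (\<forall>i. Suc i < length es \<longrightarrow> es ! Suc i \<noteq> flip (es ! i))"
proof (induction es)
  case (Cons e es)
  show ?case
  proof (cases es)
    case (Cons f fs)
    then show ?thesis
      using Cons.IH by (auto simp: reduced_def nth_Cons' All_less_Suc2)
  qed (simp add: reduced_def)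
qed (simp add: reduced_def)

lemma reduced_Cons: "reduced (e # p) \<longleftrightarrow> reduced p \<and> (p = [] \<or> hd p \<noteq> flip e)"
  by (auto simp: reduced_def successively_Cons)

lemma reduced_append: "reduced (p @ q) \<longleftrightarrow> reduced p \<and> reduced q \<and> (p = [] \<or> q = [] \<or> hd q \<noteq> flip (last p))"
  by (simp add: reduced_def successively_append_iff)

lemma not_reduced:
  assumes "\<not> reduced p"
  obtains a e b where "p = a @ [e, flip e] @ b"
proof -
  have "\<exists>a e b. p = a @ [e, flip e] @ b"
    using assms
  proof (induction p)
    case (Cons e p)
    show ?case
    proof (cases "reduced p")
      case True
      then have "p \<noteq> []" "hd p = flip e" using Cons.prems by (auto simp: reduced_def successively_Cons)
      then have "e # p = [] @ [e, flip e] @ tl p" by (cases p) auto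
      then show ?thesis by blast
    next
      case False
      then obtain a f b where "p = a @ [f, flip f] @ b" using Cons.IH by blast
      then have "e # p = (e # a) @ [f, flip f] @ b" by simp
      then show ?thesis by blast
    qed
  qed (simp add: reduced_def)
  then show ?thesis using that by blast
qed

definition flip_walk :: "'e list \<Rightarrow> 'e list" where
  "flip_walk p = rev (map flip p)"

lemma reduced_flip_walk: "set p \<subseteq> arcs G \<Longrightarrow> reduced p \<Longrightarrow> reduced (flip_walk p)"
proof (induction p)
  case (Cons e p)
  then have nbp: "reduced (flip_walk p)" by (simp add: reduced_Cons)
  have ne: "flip e \<noteq> flip (last (flip_walk p))" if p0: "p \<noteq> []"
  proof -
    obtain f q where p: "p = f # q" using p0 by (cases p) auto
    then have "f \<noteq> flip e" "f \<in> arcs G" using Cons.prems by (auto simp: reduced_def)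
    then show ?thesis using p flip_flip[of f] by (auto simp: flip_walk_def)
  qed
  have "flip_walk (e # p) = flip_walk p @ [flip e]" "p = [] \<longleftrightarrow> flip_walk p = []"
    by (auto simp: flip_walk_def)
  moreover have "reduced [flip e]" by (simp add: reduced_def)
  ultimately show ?case using nbp ne reduced_append[of "flip_walk p" "[flip e]"] by auto
qed (simp add: reduced_def flip_walk_def)

definition rev_tree :: "('v, 'e) pre_digraph \<Rightarrow> bool" where
  "rev_tree H \<longleftrightarrow> (\<forall>e\<in>arcs H. flip e \<in> arcs H) \<and> strongly_connected H \<and>
     \<not> (\<exists>p. pre_digraph.cycle H p \<and> reduced p)"

end

section \<open>Uniqueness of reduced walks in a tree\<close>

locale rev_subtree = rev_digraph G flip for G :: "('v, 'e) pre_digraph" and flip +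
  fixes T :: "('v, 'e) pre_digraph"
  assumes sub: "subgraph T G" and tree: "rev_tree T"
begin

sublocale T: wf_digraph T
  using sub by (simp add: subgraph_def)

lemma tailT [simp]: "tail T = tail G" and headT [simp]: "head T = head G"
  using sub by (auto simp: subgraph_def compatible_def)

lemma arcsT: "arcs T \<subseteq> arcs G" and vertsT: "verts T \<subseteq> verts G"
  using sub by (auto simp: subgraph_def)

lemma flipT: "e \<in> arcs T \<Longrightarrow> flip e \<in> arcs T"
  using tree by (simp add: rev_tree_def)

lemma awalkT_arcs: "T.awalk u p v \<Longrightarrow> set p \<subseteq> arcs T"
  by (simp add: T.awalk_def)

lemma awalkT_awalk: "T.awalk u p v \<Longrightarrow> awalk u p v"
  using arcsT vertsT compatible_cas[of G T] sub
  by (auto simp: T.awalk_def awalk_def subgraph_def)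

lemma awalk_flip: "T.awalk u p v \<Longrightarrow> T.awalk v (flip_walk p) u"
proof (induction p arbitrary: u)
  case Nil
  then show ?case by (auto simp: flip_walk_def T.awalk_Nil_iff)
next
  case (Cons e p)
  then have e: "e \<in> arcs T" "u = tail G e" "T.awalk v (flip_walk p) (head G e)"
    by (auto simp: T.awalk_Cons_iff)
  have "flip_walk (e # p) = flip_walk p @ [flip e]" by (simp add: flip_walk_def)
  then show ?case
    using e flipT[OF e(1)] tail_flip[of e] head_flip[of e] arcsT by (auto simp: T.awalk_snoc)
qed

text \<open>A tree by definition excludes only reduced cycles with distinct vertices. In a shortest
  nonempty reduced closed walk no vertex repeats, as the segment between two visits would again be
  reduced and closed.\<close>

lemma closed_reduced_Nil:
  assumes "T.awalk u p u" "reduced p"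
  shows "p = []"
proof (rule ccontr)
  assume "p \<noteq> []"
  define P where "P p \<longleftrightarrow> p \<noteq> [] \<and> reduced p \<and> (\<exists>u. T.awalk u p u)" for p
  have "P p" using assms \<open>p \<noteq> []\<close> by (auto simp: P_def)
  then obtain q where q: "P q" "\<And>r. P r \<Longrightarrow> length q \<le> length r"
    using ex_has_least_nat[of P p length] by blast
  then obtain v where v: "T.awalk v q v" "q \<noteq> []" "reduced q" by (auto simp: P_def)
  have vs: "tl (T.awalk_verts v q) = map (head G) q"
    using v T.awalk_verts_conv'[of v q v] by (auto simp: T.awalk_def)
  have "distinct (map (head G) q)"
  proof (rule ccontr)
    assume "\<not> ?thesis"
    then obtain xs ys zs y where "map (head G) q = xs @ [y] @ ys @ [y] @ zs"
      using not_distinct_decomp by blast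
    then obtain a e b f c where q': "q = a @ [e] @ b @ [f] @ c" "head G e = y" "head G f = y"
      by (auto simp: map_eq_append_conv map_eq_Cons_conv Cons_eq_map_conv append_eq_map_conv)
    have "T.awalk y (b @ [f]) y"
      using v(1) unfolding q'(1)
      by (auto simp: T.awalk_append_ex T.awalk_Cons_iff T.awalk_Nil_iff q')
    moreover have "reduced (b @ [f])"
    proof -
      have "reduced ((a @ [e]) @ (b @ [f]) @ c)" using v(3) q'(1) by simp
      then show ?thesis unfolding reduced_append[of "a @ [e]"] reduced_append[of "b @ [f]"] by blast
    qed
    ultimately have "P (b @ [f])" by (auto simp: P_def)
    then show False using q(2)[of "b @ [f]"] q'(1) by simp
  qed
  then have "T.cycle q" unfolding T.cycle_def using v vs by metis
  then show False using tree v(3) by (auto simp: rev_tree_def)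
qed

text \<open>Equal last arcs are removed. If they differ, one walk followed by the reverse of the
  other is reduced, closed and nonempty.\<close>

lemma reduced_walk_unique:
  assumes "T.awalk u p v" "reduced p" "T.awalk u q v" "reduced q"
  shows "p = q"
  using assms
proof (induction p arbitrary: q v rule: rev_induct)
  case Nil
  then have "v = u" by (simp add: T.awalk_Nil_iff)
  then show ?case using closed_reduced_Nil[of u q] Nil by simp
next
  case (snoc e p)
  show ?case
  proof (cases q rule: rev_exhaust)
    case Nil
    then have "v = u" using snoc by (simp add: T.awalk_Nil_iff)
    then show ?thesis using closed_reduced_Nil[of u "p @ [e]"] snoc.prems Nil by simp
  next
    case (snoc q' f)
    have pe: "T.awalk u p (tail G e)" "e \<in> arcs T" "head G e = v" "reduced p"
      using snoc.prems by (auto simp: T.awalk_snoc reduced_append)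
    have qf: "T.awalk u q' (tail G f)" "f \<in> arcs T" "head G f = v" "reduced q'"
      using snoc.prems snoc by (auto simp: T.awalk_snoc reduced_append)
    show ?thesis
    proof (cases "e = f")
      case True
      then show ?thesis using snoc.IH[OF pe(1,4)] qf snoc by auto
    next
      case False
      let ?r = "(p @ [e]) @ flip_walk q"
      have "T.awalk u ?r u"
        using snoc.prems awalk_flip by (meson T.awalk_appendI)
      moreover have "reduced ?r"
      proof -
        have "set q \<subseteq> arcs G" using snoc.prems awalkT_arcs arcsT by blast
        then have "reduced (flip_walk q)" using reduced_flip_walk snoc.prems by blast
        moreover have "hd (flip_walk q) = flip f" using snoc by (simp add: flip_walk_def)
        moreover have "flip f \<noteq> flip e"
          using False flip_flip[of f] flip_flip[of e] pe(2) qf(2) arcsT by (metis subsetD)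
        ultimately show ?thesis using snoc.prems reduced_append[of "p @ [e]" "flip_walk q"] by simp
      qed
      ultimately show ?thesis using closed_reduced_Nil[of u ?r] by simp
    qed
  qed
qed

lemma reduced_walk_exists:
  assumes "u \<in> verts T" "v \<in> verts T"
  obtains p where "T.awalk u p v" "reduced p"
proof -
  have "u \<rightarrow>\<^sup>*\<^bsub>T\<^esub> v"
    using tree assms by (auto simp: rev_tree_def strongly_connected_def)
  then obtain p0 where "T.awalk u p0 v" using T.reachable_awalk by blast
  then obtain p where p: "T.awalk u p v" "\<And>q. T.awalk u q v \<Longrightarrow> length p \<le> length q"
    using ex_has_least_nat[of "\<lambda>p. T.awalk u p v" p0 length] by blast
  have "reduced p"
  proof (rule ccontr)
    assume "\<not> reduced p"
    then obtain a e b where ab: "p = a @ [e, flip e] @ b" by (rule not_reduced)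
    have "T.awalk u (a @ b) v"
    proof -
      have e: "T.awalk u a (tail G e)" "e \<in> arcs T" "T.awalk (head G (flip e)) b v"
        using p(1) unfolding ab by (auto simp: T.awalk_append_ex T.awalk_Cons_iff T.awalk_Nil_iff)
      moreover have "head G (flip e) = tail G e" using e(2) arcsT by (intro head_flip) blast
      ultimately show ?thesis by (auto simp: T.awalk_append_ex)
    qed
    then show False using p(2)[of "a @ b"] ab by simp
  qed
  then show ?thesis using that p by blast
qed

definition tpath :: "'v \<Rightarrow> 'v \<Rightarrow> 'e list" where
  "tpath v u = (THE p. T.awalk u p v \<and> reduced p)"

lemma tpath_eqI: "T.awalk u p v \<Longrightarrow> reduced p \<Longrightarrow> tpath v u = p"
  unfolding tpath_def using reduced_walk_unique by blast

lemma
  assumes "u \<in> verts T" "v \<in> verts T"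
  shows tpath_awalk: "T.awalk u (tpath v u) v" and tpath_reduced: "reduced (tpath v u)"
  using reduced_walk_exists[OF assms] tpath_eqI by metis+

lemma tpath_self: "u \<in> verts T \<Longrightarrow> tpath u u = []"
  by (rule tpath_eqI) (auto simp: T.awalk_Nil_iff reduced_def)

lemma tpath_flip: "u \<in> verts T \<Longrightarrow> v \<in> verts T \<Longrightarrow> tpath u v = flip_walk (tpath v u)"
  using awalkT_arcs arcsT
  by (intro tpath_eqI awalk_flip tpath_awalk reduced_flip_walk tpath_reduced) (blast dest: tpath_awalk)+

end

section \<open>Maximal trees span connected graphs\<close>

context rev_digraph
begin

text \<open>The new vertex is a leaf whose only arcs are \<open>a\<close> and \<open>flip a\<close>,
  so a reduced walk that enters it cannot continue.\<close>

lemma rev_tree_extend: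
  assumes "rev_subtree G flip T" "a \<in> arcs G" "tail G a \<in> verts T" "head G a \<notin> verts T"
  defines "T' \<equiv> \<lparr>verts = insert (head G a) (verts T), arcs = {a, flip a} \<union> arcs T,
    tail = tail T, head = head T\<rparr>"
  shows "subgraph T T'" "subgraph T' G" "rev_tree T'"
proof -
  interpret rev_subtree G flip T by fact
  let ?h = "head G a"
  have T': "verts T' = insert ?h (verts T)" "arcs T' = {a, flip a} \<union> arcs T"
    "tail T' = tail G" "head T' = head G"
    by (simp_all add: T'_def)
  have fa: "flip a \<in> arcs G" "tail G (flip a) = ?h" "head G (flip a) = tail G a" "flip (flip a) = a"
    using assms flip_arc tail_flip head_flip flip_flip by auto
  have wfT: "tail G e \<in> verts T" "head G e \<in> verts T" if "e \<in> arcs T" for e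
    using T.wellformed[OF that] by simp_all
  have wf': "wf_digraph T'"
    by unfold_locales (use T' assms fa wfT in auto)
  show "subgraph T T'"
    unfolding subgraph_def compatible_def using wf' T.wf_digraph_axioms by (auto simp: T')
  show sub': "subgraph T' G"
    unfolding subgraph_def compatible_def
    using wf' wf_digraph_axioms arcsT vertsT assms fa by (auto simp: T')
  interpret T': wf_digraph T' by (rule wf')
  have tail_h: "e = flip a" if "e \<in> arcs T'" "tail G e = ?h" for e
    using that assms(2-4) wfT[of e] by (auto simp: T')
  have head_h: "e = a" if "e \<in> arcs T'" "head G e = ?h" for e
    using that assms(2-4) wfT[of e] fa by (auto simp: T')
  have no_cycle: False if cyc: "T'.cycle p" and nbp: "reduced p" for p
  proof -
    obtain u where u: "T'.awalk u p u" "distinct (tl (T'.awalk_verts u p))" "p \<noteq> []"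
      using cyc by (auto simp: T'.cycle_def)
    have "tl (T'.awalk_verts u p) = map (head G) p"
      using u(1,3) T'.awalk_verts_conv'[of u p u] by (auto simp: T'.awalk_def T')
    then have dist: "distinct (map (head G) p)" using u by simp
    have arcs: "set p \<subseteq> arcs T'" using u by (simp add: T'.awalk_def)
    have w: "T'.awalk x q y" if "T'.awalk x (q @ r) y'" "y = tail G (hd r)" "r \<noteq> []" for x y q r y'
      using that by (cases r) (auto simp: T'.awalk_append_ex T'.awalk_Cons_iff T')
    \<comment> \<open>\<open>reduced\<close> imposes nothing at the base point of a closed walk, so
      a cycle based at the leaf needs its own argument: it visits the neighbour of the leaf after
      its first and before its last arc, against distinctness, unless it consists of two opposite
      arcs and backtracks.\<close>
    have start: "u \<noteq> ?h"
    proof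
      assume uh: "u = ?h"
      obtain e q where p: "p = e # q" using u by (cases p) auto
      have e: "e = flip a" using u(1) arcs uh unfolding p by (intro tail_h) (auto simp: T'.awalk_Cons_iff T')
      show False
      proof (cases q rule: rev_exhaust)
        case Nil
        then have "head G (flip a) = ?h" using u(1) uh p e by (auto simp: T'.awalk_simps T')
        then show False using fa assms by simp
      next
        case (snoc r f)
        have fr: "T'.awalk (tail G a) r (tail G f)" "f \<in> arcs T'" "head G f = ?h"
          using u(1) uh p e snoc fa by (auto simp: T'.awalk_Cons_iff T'.awalk_snoc T')
        then have f: "f = a" using head_h by blast
        show False
        proof (cases r rule: rev_exhaust)
          case Nil
          then have "p = [flip a, flip (flip a)]" using p e snoc f fa by simp
          then show False using nbp by (simp add: reduced_def)
        next
          case (snoc r' k)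
          then have "head G k = tail G a" using fr f by (simp add: T'.awalk_snoc T')
          moreover have "head G e = tail G a" using e fa by simp
          ultimately show False using dist p \<open>q = r @ [f]\<close> snoc by simp
        qed
      qed
    qed
    have na: "a \<notin> set p"
    proof
      assume "a \<in> set p"
      then obtain b c where p: "p = b @ a # c" by (meson split_list)
      show False
      proof (cases c)
        case Nil
        then show False using u(1) start p by (simp add: T'.awalk_snoc T')
      next
        case (Cons f d)
        then have "tail G f = ?h" "f \<in> arcs T'"
          using u(1) p by (auto simp: T'.awalk_append_ex T'.awalk_Cons_iff T')
        then have "f = flip a" using tail_h by blast
        then have "reduced (a # flip a # d)" using nbp p Cons by (simp add: reduced_append)
        then show False by (simp add: reduced_Cons)
      qed
    qed
    have nfa: "flip a \<notin> set p"
    proof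
      assume "flip a \<in> set p"
      then obtain b c where p: "p = b @ flip a # c" by (meson split_list)
      show False
      proof (cases b rule: rev_exhaust)
        case Nil
        then show False using u(1) start p fa by (simp add: T'.awalk_Cons_iff T')
      next
        case (snoc d f)
        then have "head G f = ?h" "f \<in> arcs T'"
          using u(1) p fa by (auto simp: T'.awalk_append_ex T'.awalk_Cons_iff T'.awalk_Nil_iff T')
        then have "f = a" using head_h by blast
        then show False using na p snoc by simp
      qed
    qed
    have "T.awalk u p u"
    proof -
      have "set p \<subseteq> arcs T" using arcs na nfa by (auto simp: T')
      moreover have "u \<in> verts T" using u(1) start by (auto simp: T'.awalk_def T')
      moreover have "T.cas u p u"
        using u(1) compatible_cas[of T T'] by (auto simp: T'.awalk_def compatible_def T')
      ultimately show ?thesis by (simp add: T.awalk_def)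
    qed
    then show False using closed_reduced_Nil nbp u by blast
  qed
  have "u \<rightarrow>\<^sup>*\<^bsub>T'\<^esub> v" if "u \<in> verts T'" "v \<in> verts T'" for u v
  proof -
    let ?t = "tail G a"
    have th: "?t \<rightarrow>\<^sup>*\<^bsub>T'\<^esub> ?h" "?h \<rightarrow>\<^sup>*\<^bsub>T'\<^esub> ?t"
      using T'.arc_implies_awalk[of a] T'.arc_implies_awalk[of "flip a"] fa
      by (auto simp: T'.reachable_awalk T')
    have conn: "x \<rightarrow>\<^sup>*\<^bsub>T'\<^esub> y" if "x \<in> verts T" "y \<in> verts T" for x y
    proof -
      have "x \<rightarrow>\<^sup>*\<^bsub>T\<^esub> y" using tree that by (simp add: rev_tree_def strongly_connected_def)
      then show ?thesis using \<open>subgraph T T'\<close> by (rule T'.reachable_mono)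
    qed
    have "u \<rightarrow>\<^sup>*\<^bsub>T'\<^esub> ?t" "?t \<rightarrow>\<^sup>*\<^bsub>T'\<^esub> v"
      using that th conn assms by (auto simp: T')
    then show ?thesis by (rule T'.reachable_trans)
  qed
  then have "strongly_connected T'" by (auto simp: strongly_connected_def T')
  then show "rev_tree T'"
    unfolding rev_tree_def using no_cycle fa flipT by (auto simp: T')
qed

text \<open>A walk towards a missing vertex leaves the tree along some arc, and adding this arc
  contradicts maximality.\<close>

lemma maximal_tree_spans:
  assumes "max_subgraph rev_tree T" "\<And>u v. u \<in> verts G \<Longrightarrow> v \<in> verts G \<Longrightarrow> \<exists>p. awalk u p v"
  shows "rev_subtree G flip T" "verts T = verts G"
proof -
  show st: "rev_subtree G flip T"
    using assms(1) by unfold_locales (auto simp: max_subgraph_def)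
  interpret rev_subtree G flip T by fact
  obtain z where z: "z \<in> verts T" using tree by (auto simp: rev_tree_def strongly_connected_def)
  have "x \<in> verts T" if x: "x \<in> verts G" for x
  proof (rule ccontr)
    assume nx: "x \<notin> verts T"
    obtain p where "awalk z p x" using assms(2) z vertsT x by blast
    then have "\<exists>a\<in>arcs G. tail G a \<in> verts T \<and> head G a \<notin> verts T"
      using z
    proof (induction p arbitrary: z)
      case Nil
      then show ?case using nx by (simp add: awalk_Nil_iff)
    next
      case (Cons e p)
      then show ?case by (cases "head G e \<in> verts T") (auto simp: awalk_Cons_iff)
    qed
    then obtain a where a: "a \<in> arcs G" "tail G a \<in> verts T" "head G a \<notin> verts T" by blast
    define T' where "T' = \<lparr>verts = insert (head G a) (verts T), arcs = {a, flip a} \<union> arcs T,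
      tail = tail T, head = head T\<rparr>"
    have "subgraph T T'" "subgraph T' G" "rev_tree T'"
      unfolding T'_def using rev_tree_extend[OF st a] by blast+
    moreover have "T' \<noteq> T"
    proof
      assume "T' = T"
      then have "head G a \<in> verts T" by (metis T'_def insertI1 pre_digraph.select_convs(1))
      then show False using a by simp
    qed
    ultimately show False using assms(1) by (auto simp: max_subgraph_def)
  qed
  then show "verts T = verts G" using vertsT by blast
qed

end

section \<open>The groupoids\<close>

locale coxeter_tuple = coxeter G S
  for G :: "('a, 'b) monoid_scheme" (structure) and S :: "'a set" +
  fixes \<Lambda> :: "'l set" and x0 :: "'l \<Rightarrow> 'a"
  assumes x0_inj: "x0 \<in> injections S \<Lambda>"
begin

abbreviation Chom :: "('l \<Rightarrow> 'a) \<Rightarrow> ('l \<Rightarrow> 'a) \<Rightarrow> 'a set" where "Chom \<equiv> C_hom G S \<Lambda>"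
abbreviation Yhom :: "('l \<Rightarrow> 'a) \<Rightarrow> ('l \<Rightarrow> 'a) \<Rightarrow> 'a set" where "Yhom \<equiv> Y_hom G S \<Lambda>"
abbreviation tuples :: "('l \<Rightarrow> 'a) set" where "tuples \<equiv> injections S \<Lambda>"
abbreviation V :: "('l \<Rightarrow> 'a) set" where "V \<equiv> C_verts G S \<Lambda> x0"
abbreviation eelt :: "('l \<Rightarrow> 'a) \<times> 'a \<Rightarrow> 'a" where "eelt \<equiv> edge_elt G S \<Lambda>"
abbreviation ehead :: "('l \<Rightarrow> 'a) \<times> 'a \<Rightarrow> 'l \<Rightarrow> 'a" where "ehead \<equiv> edge_head G S \<Lambda> x0"
abbreviation erev :: "('l \<Rightarrow> 'a) \<times> 'a \<Rightarrow> ('l \<Rightarrow> 'a) \<times> 'a" where "erev \<equiv> edge_rev G S \<Lambda> x0"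
abbreviation Cgraph where "Cgraph \<equiv> C_graph G S \<Lambda> x0"
abbreviation Ygraph where "Ygraph \<equiv> Y_graph G S \<Lambda> x0"

lemma tuple_S: "x \<in> tuples \<Longrightarrow> l \<in> \<Lambda> \<Longrightarrow> x l \<in> S"
  by (auto simp: injections_def)

lemma tuple_image: "x \<in> tuples \<Longrightarrow> x ` \<Lambda> \<subseteq> S"
  using tuple_S by blast

lemma tuple_ext: "x \<in> tuples \<Longrightarrow> y \<in> tuples \<Longrightarrow> (\<And>l. l \<in> \<Lambda> \<Longrightarrow> x l = y l) \<Longrightarrow> x = y"
  unfolding injections_def by (auto intro: PiE_ext)

lemma Chom_closed: "w \<in> Chom x y \<Longrightarrow> w \<in> carrier G"
  by (simp add: C_hom_def)

lemma Chom_act: "w \<in> Chom x y \<Longrightarrow> l \<in> \<Lambda> \<Longrightarrow> w \<bullet> simple_root (y l) = simple_root (x l)"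
  by (simp add: C_hom_def)

lemma ChomI:
  "w \<in> carrier G \<Longrightarrow> (\<And>l. l \<in> \<Lambda> \<Longrightarrow> w \<bullet> simple_root (y l) = simple_root (x l)) \<Longrightarrow> w \<in> Chom x y"
  by (simp add: C_hom_def)

lemma Chom_one: "\<one> \<in> Chom x x"
  by (intro ChomI) auto

lemma Chom_mult: "w \<in> Chom x y \<Longrightarrow> u \<in> Chom y z \<Longrightarrow> w \<otimes> u \<in> Chom x z"
  by (intro ChomI) (auto simp: Chom_closed act_mult Chom_act)

lemma Chom_inv: "w \<in> Chom x y \<Longrightarrow> inv w \<in> Chom y x"
proof (intro ChomI)
  fix l assume "w \<in> Chom x y" "l \<in> \<Lambda>"
  then show "inv w \<bullet> simple_root (x l) = simple_root (y l)"
    using act_inv(1)[of w "simple_root (y l)"] by (simp add: Chom_act Chom_closed)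
qed (simp add: Chom_closed)

lemma Chom_unique: "w \<in> Chom x z \<Longrightarrow> w \<in> Chom y z \<Longrightarrow> x \<in> tuples \<Longrightarrow> y \<in> tuples \<Longrightarrow> x = y"
  by (rule tuple_ext) (metis Chom_act simple_root_inject)+

lemma Chom_conj:
  assumes "w \<in> Chom x y" "x \<in> tuples" "y \<in> tuples" "l \<in> \<Lambda>"
  shows "w \<otimes> y l \<otimes> inv w = x l"
  using assms by (intro conj_simple) (auto simp: Chom_closed Chom_act tuple_S)

lemma V_tuple: "x \<in> V \<Longrightarrow> x \<in> tuples"
  by (simp add: C_verts_def)

lemma x0_V: "x0 \<in> V"
  using x0_inj Chom_one by (auto simp: C_verts_def)

lemma V_from_base:
  assumes "x \<in> V"
  obtains w where "w \<in> Chom x x0"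
  using assms by (auto simp: C_verts_def)

lemma V_step: "x \<in> V \<Longrightarrow> w \<in> Chom y x \<Longrightarrow> y \<in> tuples \<Longrightarrow> y \<in> V"
  using Chom_mult by (fastforce simp: C_verts_def)

lemma V_connected:
  assumes "x \<in> V" "y \<in> V"
  obtains w where "w \<in> Chom x y"
  using assms by (meson Chom_inv Chom_mult V_from_base)

lemma perp_rootsD:
  assumes "\<gamma> \<in> perp_roots G S J"
  shows "\<gamma> \<in> \<Phi>" "\<And>s. s \<in> J \<Longrightarrow> form G \<gamma> (simple_root s) = 0"
  using assms by (auto simp: perp_roots_def)

lemma perp_pos_iff: "\<gamma> \<in> perp_pos_roots G S J \<longleftrightarrow> \<gamma> \<in> perp_roots G S J \<and> \<gamma> \<in> \<Phi>pos"
  by (simp add: perp_pos_roots_def)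

lemma perp_neg: "\<gamma> \<in> perp_roots G S J \<Longrightarrow> (\<lambda>t. - \<gamma> t) \<in> perp_roots G S J"
  by (simp add: perp_roots_def form_neg_left)

text \<open>Signs are allowed so that elements of \<open>C_hom\<close> and of the centralizer are
  both covered.\<close>

lemma perp_act:
  assumes "w \<in> carrier G" "J \<subseteq> S" "K \<subseteq> S" "\<gamma> \<in> perp_roots G S J"
    "\<And>k. k \<in> K \<Longrightarrow> \<exists>j\<in>J. simple_root k = w \<bullet> simple_root j \<or> simple_root k = (\<lambda>t. - (w \<bullet> simple_root j) t)"
  shows "w \<bullet> \<gamma> \<in> perp_roots G S K"
  unfolding perp_roots_def
proof (intro CollectI conjI ballI)
  note \<gamma> = perp_rootsD[OF assms(4)]
  show "w \<bullet> \<gamma> \<in> \<Phi>" using assms(1) \<gamma> by simp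
  fix k assume "k \<in> K"
  then obtain j where j: "j \<in> J"
    "simple_root k = w \<bullet> simple_root j \<or> simple_root k = (\<lambda>t. - (w \<bullet> simple_root j) t)"
    using assms(5) by blast
  have "form G (w \<bullet> \<gamma>) (w \<bullet> simple_root j) = form G \<gamma> (simple_root j)"
    using \<gamma> assms j by (intro form_act) auto
  then have "form G (w \<bullet> \<gamma>) (w \<bullet> simple_root j) = 0" using \<gamma> j by simp
  then show "form G (w \<bullet> \<gamma>) (simple_root k) = 0" using j(2) by (auto simp: form_neg_right)
qed

lemma Chom_perp:
  assumes "w \<in> Chom x y" "x \<in> tuples" "y \<in> tuples" "\<gamma> \<in> perp_roots G S (y ` \<Lambda>)"
  shows "w \<bullet> \<gamma> \<in> perp_roots G S (x ` \<Lambda>)"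
proof (rule perp_act[OF Chom_closed tuple_image tuple_image assms(4)])
  fix k assume "k \<in> x ` \<Lambda>"
  then obtain l where "l \<in> \<Lambda>" "k = x l" by blast
  then show "\<exists>j\<in>y ` \<Lambda>. simple_root k = w \<bullet> simple_root j \<or>
      simple_root k = (\<lambda>t. - (w \<bullet> simple_root j) t)"
    using Chom_act[OF assms(1)] by (intro bexI[of _ "y l"]) auto
qed (use assms in auto)

lemma Yhom_Chom: "w \<in> Yhom x y \<Longrightarrow> w \<in> Chom x y"
  by (simp add: Y_hom_def)

lemma Yhom_pos: "w \<in> Yhom x y \<Longrightarrow> \<gamma> \<in> perp_pos_roots G S (y ` \<Lambda>) \<Longrightarrow> w \<bullet> \<gamma> \<in> \<Phi>pos"
  by (auto simp: Y_hom_def)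

lemma YhomI:
  "w \<in> Chom x y \<Longrightarrow> (\<And>\<gamma>. \<gamma> \<in> perp_pos_roots G S (y ` \<Lambda>) \<Longrightarrow> w \<bullet> \<gamma> \<in> \<Phi>pos) \<Longrightarrow> w \<in> Yhom x y"
  by (auto simp: Y_hom_def)

lemma Yhom_one: "\<one> \<in> Yhom x x"
  by (intro YhomI Chom_one) (auto simp: perp_pos_iff pos_roots_iff)

lemma Yhom_mult:
  assumes "w \<in> Yhom x y" "u \<in> Yhom y z" "y \<in> tuples" "z \<in> tuples"
  shows "w \<otimes> u \<in> Yhom x z"
proof (rule YhomI)
  show "w \<otimes> u \<in> Chom x z" using assms Yhom_Chom Chom_mult by blast
  fix \<gamma> assume \<gamma>: "\<gamma> \<in> perp_pos_roots G S (z ` \<Lambda>)"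
  then have "u \<bullet> \<gamma> \<in> perp_pos_roots G S (y ` \<Lambda>)"
    using assms Chom_perp[OF Yhom_Chom[OF assms(2)]] Yhom_pos by (simp add: perp_pos_iff)
  then have "w \<bullet> u \<bullet> \<gamma> \<in> \<Phi>pos" using assms Yhom_pos by blast
  moreover have "fin_supp \<gamma>" using \<gamma> by (simp add: perp_pos_iff pos_roots_iff)
  moreover have "w \<in> carrier G" "u \<in> carrier G" using assms Chom_closed Yhom_Chom by blast+
  ultimately show "(w \<otimes> u) \<bullet> \<gamma> \<in> \<Phi>pos" by (simp add: act_mult)
qed

section \<open>The graphs\<close>

lemma eelt_eq:
  assumes "x \<in> tuples" "s \<in> S" "s \<notin> x ` \<Lambda>"
  shows "eelt (x, s) = edge_conj (x ` \<Lambda>) s"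
proof -
  note A = tuple_image[OF assms(1)] assms(2,3)
  show ?thesis by (simp add: edge_elt_def edge_conj_def[OF A] edge_comp_def[OF A] edge_rest_def[OF A])
qed

lemma verts_Cgraph [simp]: "verts Cgraph = V" and tail_Cgraph [simp]: "tail Cgraph = fst"
  and head_Cgraph [simp]: "head Cgraph = ehead"
  by (simp_all add: C_graph_def)

lemma verts_Ygraph [simp]: "verts Ygraph = V" and tail_Ygraph [simp]: "tail Ygraph = fst"
  and head_Ygraph [simp]: "head Ygraph = ehead"
  by (simp_all add: Y_graph_def)

lemma arcs_Ygraph: "arcs Ygraph = {e \<in> arcs Cgraph. fst e \<noteq> ehead e}"
  by (simp add: Y_graph_def)

lemma arcs_Cgraph:
  "(x, s) \<in> arcs Cgraph \<longleftrightarrow> x \<in> V \<and> s \<in> S \<and> s \<notin> x ` \<Lambda> \<and> finite_type G (comp_of (x ` \<Lambda>) s)"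
  by (auto simp: C_graph_def)

lemma arcD:
  assumes "(x, s) \<in> arcs Cgraph"
  shows "x \<in> V" "x \<in> tuples" "x ` \<Lambda> \<subseteq> S" "s \<in> S" "s \<notin> x ` \<Lambda>"
    "finite_type G (edge_comp (x ` \<Lambda>) s)" "eelt (x, s) = edge_conj (x ` \<Lambda>) s" "eelt (x, s) \<in> carrier G"
proof -
  show *: "x \<in> V" "x \<in> tuples" "x ` \<Lambda> \<subseteq> S" "s \<in> S" "s \<notin> x ` \<Lambda>"
    using assms V_tuple tuple_image by (auto simp: arcs_Cgraph)
  then show f: "finite_type G (edge_comp (x ` \<Lambda>) s)" using assms by (simp add: arcs_Cgraph edge_comp_def)
  show "eelt (x, s) = edge_conj (x ` \<Lambda>) s" using * eelt_eq by blast
  then show "eelt (x, s) \<in> carrier G" using edge_conj_closed[OF *(3-5) f] by simp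
qed

lemma ehead_eqI:
  assumes "y \<in> V" "eelt e \<in> Chom y (fst e)"
  shows "ehead e = y"
  unfolding edge_head_def using assms Chom_unique V_tuple by blast

lemma ehead_props:
  assumes "e \<in> arcs Cgraph"
  shows "ehead e \<in> V" "eelt e \<in> Chom (ehead e) (fst e)"
proof -
  obtain x s where e: "e = (x, s)" by (cases e)
  note A = arcD[OF assms[unfolded e]]
  \<comment> \<open>The entries of the head are read off from the images of the simple roots; the
    restriction to \<open>\<Lambda>\<close> is the normal form required by
    \<open>injections\<close>.\<close>
  define y where "y = (\<lambda>l\<in>\<Lambda>. SOME z. z \<in> S \<and> eelt e \<bullet> simple_root (x l) = simple_root z)"
  have y: "y l \<in> S \<and> eelt e \<bullet> simple_root (x l) = simple_root (y l)" if l: "l \<in> \<Lambda>" for l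
  proof -
    obtain z where "z \<in> S" "edge_conj (x ` \<Lambda>) s \<bullet> simple_root (x l) = simple_root z"
      using edge_conj_base[OF A(3-6), of "x l"] l by blast
    then have "\<exists>z. z \<in> S \<and> eelt e \<bullet> simple_root (x l) = simple_root z" using e A(7) by auto
    from someI_ex[OF this] show ?thesis using that by (simp add: y_def)
  qed
  have "inj_on y \<Lambda>"
  proof (rule inj_onI)
    fix k l assume kl: "k \<in> \<Lambda>" "l \<in> \<Lambda>" "y k = y l"
    then have "eelt e \<bullet> simple_root (x k) = eelt e \<bullet> simple_root (x l)" using y by metis
    then have "simple_root (x k) = simple_root (x l)" using A(8) e by (auto dest: act_inject[rotated 3])
    then have "x k = x l" by simp
    then show "k = l" using A(2) kl by (auto simp: injections_def dest: inj_onD)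
  qed
  moreover have "y \<in> extensional \<Lambda>" by (simp add: y_def)
  ultimately have yt: "y \<in> tuples" using y by (auto simp: injections_def PiE_iff)
  have c: "eelt e \<in> Chom y x" using y A(8) e by (intro ChomI) auto
  then have "y \<in> V" using V_step A(1) yt by blast
  moreover have "ehead e = y" using calculation c e by (intro ehead_eqI) auto
  ultimately show "ehead e \<in> V" "eelt e \<in> Chom (ehead e) (fst e)" using c e by auto
qed

lemma comp_of_swap:
  assumes "insert s J = insert t K" "insert s J \<subseteq> S" "t \<in> comp_of J s"
  shows "comp_of K t = comp_of J s"
proof -
  have S: "J \<subseteq> S" "s \<in> S" "K \<subseteq> S" "t \<in> S" using assms(1,2) by auto
  have "(s, t) \<in> cox_connected G (insert s J)" using assms(3) S by (simp add: comp_of_eq)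
  then have "cox_connected G (insert s J) `` {s} = cox_connected G (insert s J) `` {t}"
    using cox_connected_equiv[OF assms(2)] equiv_class_eq by metis
  then show ?thesis using S assms(1) by (simp add: comp_of_eq)
qed

text \<open>The inverse of the edge element satisfies the conditions of
  \<open>edge_conj_unique\<close> at the head, with the missing element t in place of s; by
  \<open>comp_of_swap\<close> both orientations have the same component.\<close>

lemma erev_props:
  assumes "e \<in> arcs Cgraph"
  shows "erev e \<in> arcs Cgraph" "fst (erev e) = ehead e" "ehead (erev e) = fst e"
    "erev (erev e) = e" "eelt (erev e) = inv (eelt e)"
proof -
  obtain x s where e: "e = (x, s)" by (cases e)
  note A = arcD[OF assms[unfolded e]]
  note B = A(3-6)
  define y where "y = ehead e"
  have y: "y \<in> V" "y \<in> tuples" "eelt e \<in> Chom y x"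
    using ehead_props[OF assms] V_tuple by (auto simp: y_def e)
  have ye: "edge_conj (x ` \<Lambda>) s \<bullet> simple_root (x l) = simple_root (y l)" if "l \<in> \<Lambda>" for l
    using Chom_act[OF y(3) that] A(7) e by simp
  obtain t where t: "t \<in> edge_comp (x ` \<Lambda>) s"
    "inv (edge_conj (x ` \<Lambda>) s) \<bullet> simple_root t = (\<lambda>z. - (longest (edge_rest (x ` \<Lambda>) s) \<bullet> simple_root s) z)"
    "\<And>z. z \<in> x ` \<Lambda> \<Longrightarrow> edge_conj (x ` \<Lambda>) s \<bullet> simple_root z \<noteq> simple_root t"
    "\<And>k. k \<in> insert s (x ` \<Lambda>) \<Longrightarrow> k \<noteq> t \<Longrightarrow> \<exists>z\<in>x ` \<Lambda>. edge_conj (x ` \<Lambda>) s \<bullet> simple_root z = simple_root k"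
    "longest (edge_comp (x ` \<Lambda>) s) \<bullet> simple_root s = (\<lambda>x. - simple_root t x)"
    "longest (edge_comp (x ` \<Lambda>) s) \<bullet> simple_root t = (\<lambda>x. - simple_root s x)"
    by (rule edge_conj_missing[OF B]) (rule that)
  have tK: "t \<in> insert s (x ` \<Lambda>)" "t \<in> S" using t(1) edge_comp_facts(1,7)[OF A(3-5)] by auto
  have "y l \<in> insert s (x ` \<Lambda>)" "y l \<noteq> t" if "l \<in> \<Lambda>" for l
  proof -
    have "x l \<in> x ` \<Lambda>" using that by blast
    then obtain z where "z \<in> insert s (x ` \<Lambda>)" "z \<in> S"
        "edge_conj (x ` \<Lambda>) s \<bullet> simple_root (x l) = simple_root z"
      by (rule edge_conj_base[OF B])
    then show "y l \<in> insert s (x ` \<Lambda>)" using ye[OF that] by simp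
    show "y l \<noteq> t" using ye[OF that] t(3)[of "x l"] that by auto
  qed
  moreover have "\<exists>l\<in>\<Lambda>. k = y l" if "k \<in> insert s (x ` \<Lambda>)" "k \<noteq> t" for k
    using t(4)[OF that] ye by auto
  \<comment> \<open>The entries of the head exhaust the old entries and \<open>s\<close> except for
    \<open>t\<close>, which is what the definite description in \<open>edge_rev\<close> asks
    for.\<close>
  ultimately have yim: "y ` \<Lambda> = insert s (x ` \<Lambda>) - {t}" by blast
  then have K: "insert t (y ` \<Lambda>) = insert s (x ` \<Lambda>)" "t \<notin> y ` \<Lambda>" using tK by auto
  have rev: "erev e = (y, t)"
  proof -
    have "(fst e ` \<Lambda> \<union> {snd e}) - y ` \<Lambda> = {t}" unfolding yim using tK e by auto
    then show ?thesis by (simp add: edge_rev_def y_def[symmetric])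
  qed
  have comp: "comp_of (y ` \<Lambda>) t = edge_comp (x ` \<Lambda>) s"
    using comp_of_swap[of s "x ` \<Lambda>" t "y ` \<Lambda>"] K A t(1) by (simp add: edge_comp_def)
  show rarc: "erev e \<in> arcs Cgraph"
    using rev y tK K comp A by (simp add: arcs_Cgraph)
  note D = arcD[OF rarc[unfolded rev]]
  have "inv (edge_conj (x ` \<Lambda>) s) = edge_conj (y ` \<Lambda>) t"
  proof (rule edge_conj_unique(1)[OF D(3-5)])
    have "edge_conj (x ` \<Lambda>) s \<in> generate G (insert s (x ` \<Lambda>))"
      using edge_conj_in[OF B] mono_generate[of "edge_comp (x ` \<Lambda>) s" "insert s (x ` \<Lambda>)"] edge_comp_facts(7)[OF A(3-5)] by auto
    then show "inv (edge_conj (x ` \<Lambda>) s) \<in> generate G (insert t (y ` \<Lambda>))"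
      using generate_subgroup[of "insert s (x ` \<Lambda>)"] A K by (simp add: subgroup.m_inv_closed)
  next
    fix z assume "z \<in> y ` \<Lambda>"
    then obtain l where l: "l \<in> \<Lambda>" "z = y l" by blast
    then show "\<exists>r\<in>S. inv (edge_conj (x ` \<Lambda>) s) \<bullet> simple_root z = simple_root r"
      using Chom_act[OF Chom_inv[OF y(3)] l(1)] A(7) e tuple_S[OF A(2) l(1)] by auto
  next
    show "nonpos_vec (inv (edge_conj (x ` \<Lambda>) s) \<bullet> simple_root t)"
      using longest_rest_root(1)[OF B] by (simp add: t(2) pos_roots_iff)
  qed
  then show inv: "eelt (erev e) = inv (eelt e)" using D(7) A(7) e rev by simp
  show "fst (erev e) = ehead e" using rev y_def by simp
  show "ehead (erev e) = fst e"
    using inv rev y A e Chom_inv by (intro ehead_eqI) auto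
  then have h: "ehead (y, t) = x" using rev e by simp
  have "(y ` \<Lambda> \<union> {t}) - x ` \<Lambda> = {s}" using K A(5) by auto
  then have "erev (y, t) = (x, s)" unfolding edge_rev_def by (simp add: h)
  then show "erev (erev e) = e" using rev e by simp
qed

lemma wf_Ygraph: "wf_digraph Ygraph"
proof
  fix e assume "e \<in> arcs Ygraph"
  then show "tail Ygraph e \<in> verts Ygraph" "head Ygraph e \<in> verts Ygraph"
    using ehead_props by (cases e; auto simp: arcs_Ygraph arcs_Cgraph)+
qed

sublocale Y: rev_digraph Ygraph erev
proof (intro rev_digraph.intro wf_Ygraph, unfold_locales)
  fix e assume "e \<in> arcs Ygraph"
  then have e: "e \<in> arcs Cgraph" "fst e \<noteq> ehead e" by (auto simp: arcs_Ygraph)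
  show "erev e \<in> arcs Ygraph"
    unfolding arcs_Ygraph using erev_props[OF e(1)] e(2) by auto
  show "tail Ygraph (erev e) = head Ygraph e" "head Ygraph (erev e) = tail Ygraph e" "erev (erev e) = e"
    using erev_props[OF e(1)] by simp_all
qed

lemma Yarc_Cgraph: "e \<in> arcs Ygraph \<Longrightarrow> e \<in> arcs Cgraph"
  by (simp add: arcs_Ygraph)

text \<open>By \<open>edge_conj_fixes\<close>, an edge that makes an orthogonal positive root
  negative fixes the entries of its start, so it is a loop and not an arc of
  \<open>Ygraph\<close>.\<close>

lemma Yarc_Yhom:
  assumes "e \<in> arcs Ygraph"
  shows "eelt e \<in> Yhom (ehead e) (fst e)"
proof (rule YhomI)
  have e: "e \<in> arcs Cgraph" "fst e \<noteq> ehead e" using assms by (auto simp: arcs_Ygraph)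
  obtain x s where xs: "e = (x, s)" by (cases e)
  note A = arcD[OF e(1)[unfolded xs]]
  show c: "eelt e \<in> Chom (ehead e) (fst e)" using ehead_props[OF e(1)] by simp
  fix \<gamma> assume \<gamma>: "\<gamma> \<in> perp_pos_roots G S (fst e ` \<Lambda>)"
  show "eelt e \<bullet> \<gamma> \<in> \<Phi>pos"
  proof (rule ccontr)
    assume "\<not> ?thesis"
    then have neg: "nonpos_vec (edge_conj (x ` \<Lambda>) s \<bullet> \<gamma>)"
      using \<gamma> A(7,8) xs pos_root_act_iff by (auto simp: perp_pos_iff perp_roots_def)
    have "eelt e \<bullet> simple_root (x l) = simple_root (x l)" if "l \<in> \<Lambda>" for l
      using edge_conj_fixes[OF A(3-6) _ _ neg, of "x l"] \<gamma> that A(7) xs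
      by (auto simp: perp_pos_iff perp_roots_def)
    then have "eelt e \<in> Chom x x" using A(8) xs by (intro ChomI) auto
    then have "ehead e = x" using A(1) xs by (intro ehead_eqI) auto
    then show False using e(2) xs by simp
  qed
qed

section \<open>Elements represented by paths; connectedness\<close>

abbreviation pelt :: "(('l \<Rightarrow> 'a) \<times> 'a) list \<Rightarrow> 'a" where
  "pelt \<equiv> foldl (\<lambda>w e. eelt e \<otimes> w) \<one>"

lemma path_elt_eq: "path_elt G S \<Lambda> p = pelt (snd p)"
  by (simp add: path_elt_def)

lemma pelt_closed: "set es \<subseteq> arcs Cgraph \<Longrightarrow> pelt es \<in> carrier G"
proof (induction es rule: rev_induct)
  case (snoc e es)
  then show ?case using arcD(8)[of "fst e" "snd e"] by simp
qed simp

text \<open>Lists record arcs in the order of travel, whereas later arcs contribute factors on the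
  left.\<close>

lemma pelt_append:
  assumes "set es \<subseteq> arcs Cgraph" "set fs \<subseteq> arcs Cgraph"
  shows "pelt (es @ fs) = pelt fs \<otimes> pelt es"
  using assms(2)
proof (induction fs rule: rev_induct)
  case Nil
  then show ?case using pelt_closed[OF assms(1)] by simp
next
  case (snoc f fs)
  then have "eelt f \<in> carrier G" using arcD(8)[of "fst f" "snd f"] by simp
  then show ?case
    using snoc pelt_closed[OF assms(1)] pelt_closed[of fs]
    by (simp add: m_assoc append_assoc[symmetric] del: append_assoc)
qed

lemma pelt_flip:
  assumes "set es \<subseteq> arcs Cgraph"
  shows "pelt (Y.flip_walk es) = inv (pelt es)"
  using assms
proof (induction es)
  case Nil
  then show ?case by (simp add: Y.flip_walk_def)
next
  case (Cons e es)
  have e: "e \<in> arcs Cgraph" "eelt e \<in> carrier G" "set es \<subseteq> arcs Cgraph"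
    using Cons.prems arcD(8)[of "fst e" "snd e"] by auto
  have "set (Y.flip_walk es) \<subseteq> arcs Cgraph" using e erev_props by (auto simp: Y.flip_walk_def)
  then have "pelt (Y.flip_walk (e # es)) = inv (eelt e) \<otimes> pelt (Y.flip_walk es)"
    using erev_props[OF e(1)] by (simp add: Y.flip_walk_def)
  moreover have "pelt (e # es) = pelt es \<otimes> eelt e"
    using pelt_append[of "[e]" es] e by simp
  ultimately show ?case using Cons.IH e pelt_closed[of es] by (simp add: inv_mult_group)
qed

lemma Yarcs_Carcs: "set es \<subseteq> arcs Ygraph \<Longrightarrow> set es \<subseteq> arcs Cgraph"
  using Yarc_Cgraph by blast

lemma awalk_Yhom:
  assumes "Y.awalk y es z"
  shows "pelt es \<in> Yhom z y"
  using assms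
proof (induction es arbitrary: z rule: rev_induct)
  case Nil
  then show ?case using Yhom_one by (simp add: Y.awalk_Nil_iff)
next
  case (snoc e es)
  then have e: "e \<in> arcs Ygraph" "ehead e = z" "Y.awalk y es (fst e)" by (auto simp: Y.awalk_snoc)
  then have "fst e \<in> tuples" "y \<in> tuples"
    using Y.awalk_hd_in_verts[OF e(3)] Y.awalk_last_in_verts[OF e(3)] V_tuple by auto
  then show ?case using Yhom_mult[OF Yarc_Yhom[OF e(1)] snoc.IH[OF e(3)]] e(2) by simp
qed

text \<open>If \<open>w\<close> maps simple roots to simple roots and has a descent \<open>s\<close>, then its parabolic
  factor for \<open>[y] \<union> {s}\<close> is \<open>w\<^sub>y\<^sup>s\<close>, so an edge can be split off.\<close>

lemma Chom_awalk:
  assumes "x \<in> V" "y \<in> V" "w \<in> Chom x y"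
  shows "\<exists>es. Y.awalk y es x"
  using assms
proof (induction "len w" arbitrary: w y rule: less_induct)
  case less
  have xy: "x \<in> tuples" "y \<in> tuples" using less.prems V_tuple by auto
  have w: "w \<in> carrier G" using less.prems Chom_closed by blast
  show ?case
  proof (cases "w = \<one>")
    case True
    then have "x = y" using less.prems Chom_one Chom_unique xy by blast
    then show ?thesis using less.prems by (auto simp: Y.awalk_Nil_iff intro!: exI[of _ "[]"])
  next
    case False
    then obtain s where s: "s \<in> S" "\<not> nonneg_vec (w \<bullet> simple_root s)" using act_eq_one w by blast
    then have neg: "nonpos_vec (w \<bullet> simple_root s)" using act_simple_sign w by blast
    let ?J = "y ` \<Lambda>"
    have J: "?J \<subseteq> S" using xy tuple_image by blast
    have sJ: "s \<notin> ?J"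
      using s Chom_act[OF less.prems(3)] by auto
    let ?K = "insert s ?J"
    have K: "?K \<subseteq> S" using J s by simp
    obtain u v where uv: "u \<in> carrier G" "v \<in> generate G ?K" "w = u \<otimes> v"
      "\<And>k. k \<in> ?K \<Longrightarrow> nonneg_vec (u \<bullet> simple_root k)" "u = w \<or> len u < len w"
      using parabolic_decomposition[OF w K] by metis
    have v: "v \<in> carrier G" using uv K generate_closed by blast
    \<comment> \<open>\<open>u\<close> keeps \<alpha>_s nonnegative and \<open>w\<close> does not,
      so the two differ and \<open>u\<close> is the shorter one.\<close>
    have lt: "len u < len w" using uv(4)[of s] uv(5) s by auto
    have vK: "supp_in ?K (v \<bullet> simple_root k)" "v \<bullet> simple_root k \<in> \<Phi>" if "k \<in> ?K" for k
      using supp_in_act[OF uv(2) K] that K v by auto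
    have wuv: "w \<bullet> simple_root k = u \<bullet> v \<bullet> simple_root k" for k
      using uv v by (simp add: act_mult)
    have vneg: "nonpos_vec (v \<bullet> simple_root s)"
    proof (rule ccontr)
      assume "\<not> ?thesis"
      then have "nonneg_vec (v \<bullet> simple_root s)" using act_simple_sign v s by blast
      then have "nonneg_vec (u \<bullet> v \<bullet> simple_root s)"
        using nonneg_act[of u "v \<bullet> simple_root s" ?K] vK[of s] uv(1,4) by simp
      then show False using s wuv by simp
    qed
    \<comment> \<open>\<open>u\<close> preserves the sign of roots in the span of \<open>?K\<close>,
      so \<open>v\<close> must send the simple root of an entry to a positive root, and this root is
      simple by \<open>simple_preimage\<close>.\<close>
    have vsimple: "\<exists>k\<in>?K. v \<bullet> simple_root (y l) = simple_root k" if l: "l \<in> \<Lambda>" for l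
    proof -
      let ?\<beta> = "v \<bullet> simple_root (y l)"
      have yl: "y l \<in> ?K" using l by simp
      have u\<beta>: "u \<bullet> ?\<beta> = simple_root (x l)"
        using Chom_act[OF less.prems(3) l] wuv by simp
      have "nonneg_vec ?\<beta>"
      proof (rule ccontr)
        assume "\<not> ?thesis"
        then have "nonneg_vec (\<lambda>t. - ?\<beta> t)" using root_sign vK(2)[OF yl] by auto
        then have "nonneg_vec (u \<bullet> (\<lambda>t. - ?\<beta> t))"
          using nonneg_act[of u "\<lambda>t. - ?\<beta> t" ?K] vK[OF yl] uv(1,4) by simp
        then have "nonpos_vec (simple_root (x l))"
          using u\<beta> uv(1) vK[OF yl] by (simp add: act_neg)
        then show False
          using root_not_both[of "simple_root (x l)"] tuple_S[OF xy(1) l] by simp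
      qed
      then have "?\<beta> \<in> \<Phi>pos" using vK[OF yl] by (simp add: pos_roots_iff)
      then show ?thesis
        using simple_preimage[OF uv(1) K uv(4) _ vK(1)[OF yl] tuple_S[OF xy(1) l] u\<beta>] by blast
    qed
    have vJ: "\<exists>k\<in>S. v \<bullet> simple_root z = simple_root k" if "z \<in> ?J" for z
      using vsimple that K by blast
    have vee: "v = edge_conj ?J s" "finite_type G (edge_comp ?J s)"
      using edge_conj_unique[OF J s(1) sJ uv(2) vJ vneg] by blast+
    have arc: "(y, s) \<in> arcs Cgraph"
      using less.prems s sJ vee(2) edge_comp_def[OF J s(1) sJ] by (simp add: arcs_Cgraph)
    have ev: "eelt (y, s) = v" using arcD(7)[OF arc] vee by simp
    note h = ehead_props[OF arc]
    have "u = w \<otimes> inv v" using uv v by (simp add: m_assoc)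
    then have "u \<in> Chom x (ehead (y, s))"
      using Chom_mult[OF less.prems(3) Chom_inv[OF h(2)[simplified]]] ev by simp
    then obtain es where es: "Y.awalk (ehead (y, s)) es x"
      using less.hyps[OF lt less.prems(1) h(1)] by blast
    show ?thesis
    \<comment> \<open>A loop contributes no arc of \<open>Ygraph\<close>; in this case the walk
      obtained for \<open>u\<close> already starts at \<open>y\<close>.\<close>
    proof (cases "ehead (y, s) = y")
      case True
      then show ?thesis using es by auto
    next
      case False
      then have "(y, s) \<in> arcs Ygraph" using arc by (auto simp: arcs_Ygraph)
      then have "Y.awalk y ((y, s) # es) x" using es by (simp add: Y.awalk_Cons_iff)
      then show ?thesis by blast
    qed
  qed
qed

lemma Ygraph_connected: "u \<in> V \<Longrightarrow> v \<in> V \<Longrightarrow> \<exists>p. Y.awalk u p v"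
  using Chom_awalk V_connected by metis

lemma undirected_tree_eq: "undirected_tree G S \<Lambda> x0 = Y.rev_tree"
  by (simp add: fun_eq_iff undirected_tree_def Y.rev_tree_def non_backtracking_def Y.reduced_nth)

end

section \<open>Roots with equal reflections; unions of orthogonal sets and of components\<close>

context coxeter
begin

text \<open>Evaluating both reflections at \<gamma> gives \<gamma> = c\<delta>, and norm 1 forces c
  to be 1 or -1.\<close>

lemma refl_eq_imp:
  assumes "\<gamma> \<in> \<Phi>" "\<delta> \<in> \<Phi>" "refl \<gamma> = refl \<delta>"
  shows "\<gamma> = \<delta> \<or> \<gamma> = (\<lambda>t. - \<delta> t)"
proof -
  define c where "c = form G \<delta> \<gamma>"
  have "(\<lambda>t. - \<gamma> t) = (\<lambda>t. \<gamma> t - 2 * c * \<delta> t)"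
    using refl_self[OF assms(1)] refl_act[OF assms(2), of \<gamma>] assms by (simp add: c_def)
  then have "- \<gamma> t = \<gamma> t - 2 * c * \<delta> t" for t by (rule fun_cong)
  then have t: "\<gamma> t = c * \<delta> t" for t by (simp add: algebra_simps)
  then have \<gamma>: "(\<lambda>t. c * \<delta> t + 0 * \<delta> t) = \<gamma>" by (simp add: fun_eq_iff)
  have "form G (\<lambda>t. c * \<delta> t + 0 * \<delta> t) \<gamma> = c * form G \<delta> \<gamma> + 0 * form G \<delta> \<gamma>"
    by (rule form_lin_left) (use assms in auto)
  then have "form G \<gamma> \<gamma> = c * c" unfolding \<gamma> by (simp add: c_def)
  then have "c = 1 \<or> c = - 1" using assms by (simp add: square_eq_1_iff)
  then show ?thesis using t by auto
qed

text \<open>Each factor fixes the simple roots of the other set, so the product makes all of them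
  negative and \<open>longest_unique\<close> applies.\<close>

lemma longest_union:
  assumes "J \<subseteq> S" "K \<subseteq> S" "finite_type G J" "finite_type G K"
    "\<And>j k. j \<in> J \<Longrightarrow> k \<in> K \<Longrightarrow> cox_matrix_entry G j k = 0"
  shows "longest (J \<union> K) = longest J \<otimes> longest K"
proof -
  have "longest J \<in> generate G (J \<union> K)" "longest K \<in> generate G (J \<union> K)"
    using longest_in assms mono_generate[of J "J \<union> K"] mono_generate[of K "J \<union> K"] by auto
  then have "longest J \<otimes> longest K \<in> generate G (J \<union> K)" by (rule generate.eng)
  moreover have "nonpos_vec ((longest J \<otimes> longest K) \<bullet> simple_root i)" if i: "i \<in> J \<union> K" for i
  proof (cases "i \<in> K")
    case True
    obtain k where k: "k \<in> K" "longest K \<bullet> simple_root i = (\<lambda>t. - simple_root k t)"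
      using longest_perm[OF assms(2,4) True] by blast
    have "longest J \<bullet> simple_root k = simple_root k"
      using assms k by (intro act_orthogonal[OF assms(1) longest_in]) auto
    then show ?thesis using k longest_closed assms by (simp add: act_mult act_neg)
  next
    case False
    then have iJ: "i \<in> J" using i by blast
    have "cox_matrix_entry G k i = 0" if "k \<in> K" for k
      using assms(5)[OF iJ that] entry_commute[of i k] iJ that assms(1,2) by auto
    then have "longest K \<bullet> simple_root i = simple_root i"
      using assms by (intro act_orthogonal[OF assms(2) longest_in]) auto
    then show ?thesis using iJ longest_neg longest_closed assms by (simp add: act_mult)
  qed
  ultimately show ?thesis using longest_unique(1)[of "J \<union> K"] assms by simp
qed

lemma finite_type_subset: "finite_type G K \<Longrightarrow> J \<subseteq> K \<Longrightarrow> finite_type G J"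
  using mono_generate[of J K] finite_subset unfolding finite_type_def by blast

lemma union_of_components_orthogonal:
  assumes "J \<subseteq> S" "union_of_components G K J" "k \<in> K" "j \<in> J" "j \<notin> K"
  shows "cox_matrix_entry G k j = 0"
proof (rule entry_nonadjacent)
  let ?r = "cox_connected G J"
  have eq: "equiv J ?r" using assms(1) by (rule cox_connected_equiv)
  obtain F where F: "F \<subseteq> J // ?r" "K = \<Union>F"
    using assms(2) by (auto simp: union_of_components_def irreducible_components_def)
  then obtain C where C: "C \<in> F" "k \<in> C" "C \<in> J // ?r" using assms(3) by blast
  then have kJ: "k \<in> J" using eq by (auto simp: quotient_def cox_connected_def)
  then show "k \<in> S" "j \<in> S" "k \<noteq> j" using assms by auto
  show "\<not> cox_adj G k j"
  proof
    assume "cox_adj G k j"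
    then have "(k, j) \<in> ?r" using kJ assms(4) by (auto simp: cox_connected_def)
    then have "j \<in> C" using C eq by (metis Image_singleton_iff quotient_eq_iff quotientI in_quotient_imp_closed)
    then show False using C F assms(5) by blast
  qed
qed

lemma union_of_componentsI:
  assumes "K \<subseteq> J" "\<And>k j. k \<in> K \<Longrightarrow> j \<in> J \<Longrightarrow> cox_adj G k j \<Longrightarrow> j \<in> K"
  shows "union_of_components G K J"
  unfolding union_of_components_def irreducible_components_def
proof (intro exI conjI)
  let ?r = "cox_connected G J"
  show "(\<lambda>k. ?r `` {k}) ` K \<subseteq> J // ?r" using assms(1) by (auto simp: quotient_def)
  have "j \<in> K" if "k \<in> K" "(k, j) \<in> ?r" for k j
  proof -
    have "(k, j) \<in> {(u, v). u \<in> J \<and> v \<in> J \<and> cox_adj G u v}\<^sup>*"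
      using that by (auto simp: cox_connected_def)
    then show "j \<in> K" by (induction rule: rtrancl_induct) (use that assms in auto)
  qed
  moreover have "(k, k) \<in> ?r" if "k \<in> K" for k using that assms(1) by (auto simp: cox_connected_def)
  ultimately show "K = \<Union> ((\<lambda>k. ?r `` {k}) ` K)" by blast
qed

end

section \<open>The centralizer and the twisted tuples\<close>

context coxeter_tuple
begin

abbreviation base :: "'a set" where "base \<equiv> x0 ` \<Lambda>"
abbreviation Z :: "'a set" where "Z \<equiv> parabolic_centralizer G base"
abbreviation signs :: "'a \<Rightarrow> 'l set" where "signs \<equiv> A_map G S \<Lambda> x0"

lemma base_S: "base \<subseteq> S"
  using x0_inj tuple_image by blast

lemma x0_S: "l \<in> \<Lambda> \<Longrightarrow> x0 l \<in> S"
  using x0_inj tuple_S by blast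

lemma x0_eq_iff: "k \<in> \<Lambda> \<Longrightarrow> l \<in> \<Lambda> \<Longrightarrow> x0 k = x0 l \<longleftrightarrow> k = l"
  using x0_inj by (auto simp: injections_def dest: inj_onD)

lemma Z_closed: "w \<in> Z \<Longrightarrow> w \<in> carrier G"
  by (simp add: parabolic_centralizer_def)

text \<open>Commuting with \<open>x0 l\<close> means that the root and its image under
  \<open>w\<close> have the same reflection, and a reflection determines its root up to
  sign.\<close>

lemma Z_sign:
  assumes "w \<in> Z" "l \<in> \<Lambda>"
  shows "w \<bullet> simple_root (x0 l) = simple_root (x0 l) \<or>
    w \<bullet> simple_root (x0 l) = (\<lambda>t. - simple_root (x0 l) t)"
proof -
  have s: "x0 l \<in> S" "x0 l \<in> generate G base" using assms x0_S by (auto intro: generate.incl)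
  have w: "w \<in> carrier G" using assms Z_closed by blast
  have "w \<otimes> x0 l = x0 l \<otimes> w" using assms s by (simp add: parabolic_centralizer_def)
  then have "w \<otimes> x0 l \<otimes> inv w = x0 l" using w s by (simp add: m_assoc)
  then have "refl (w \<bullet> simple_root (x0 l)) = refl (simple_root (x0 l))" using w s by (simp add: refl_conj)
  then show ?thesis using w s by (intro refl_eq_imp) auto
qed

lemma ZI:
  assumes w: "w \<in> carrier G" and sign: "\<And>l. l \<in> \<Lambda> \<Longrightarrow> w \<bullet> simple_root (x0 l) = simple_root (x0 l) \<or>
    w \<bullet> simple_root (x0 l) = (\<lambda>t. - simple_root (x0 l) t)"
  shows "w \<in> Z"
proof -
  have comm: "w \<otimes> x0 l = x0 l \<otimes> w" if "l \<in> \<Lambda>" for l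
  proof -
    have "w \<otimes> x0 l \<otimes> inv w = x0 l" using conj_simple[OF w _ _ sign[OF that]] x0_S[OF that] by blast
    then have "w \<otimes> x0 l \<otimes> inv w \<otimes> w = x0 l \<otimes> w" by simp
    then show ?thesis using w x0_S[OF that] by (simp add: m_assoc)
  qed
  have "w \<otimes> word_prod G ss = word_prod G ss \<otimes> w" if "set ss \<subseteq> base" for ss
    using that
  proof (induction ss)
    case (Cons s ss)
    then obtain l where l: "l \<in> \<Lambda>" "s = x0 l" by auto
    have "set ss \<subseteq> S" "s \<in> S" using Cons.prems base_S by auto
    moreover have "w \<otimes> s = s \<otimes> w" using comm l by simp
    ultimately show ?case
      using Cons w by (simp add: m_assoc[symmetric]) (simp add: m_assoc)
  qed (use w in simp)
  then show ?thesis
    using w generate_words[OF base_S] by (auto simp: parabolic_centralizer_def)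
qed

lemma Z_mult: "w \<in> Z \<Longrightarrow> u \<in> Z \<Longrightarrow> w \<otimes> u \<in> Z"
proof (rule ZI)
  fix l assume "w \<in> Z" "u \<in> Z" "l \<in> \<Lambda>"
  then show "(w \<otimes> u) \<bullet> simple_root (x0 l) = simple_root (x0 l) \<or>
      (w \<otimes> u) \<bullet> simple_root (x0 l) = (\<lambda>t. - simple_root (x0 l) t)"
    using Z_sign[of w l] Z_sign[of u l] by (auto simp: Z_closed act_mult act_neg)
qed (simp add: Z_closed)

lemma Z_one: "\<one> \<in> Z"
  by (rule ZI) auto

lemma Z_inv: "w \<in> Z \<Longrightarrow> inv w \<in> Z"
proof (rule ZI)
  fix l assume w: "w \<in> Z" "l \<in> \<Lambda>"
  have "inv w \<bullet> w \<bullet> simple_root (x0 l) = simple_root (x0 l)" using w by (simp add: Z_closed)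
  then show "inv w \<bullet> simple_root (x0 l) = simple_root (x0 l) \<or>
      inv w \<bullet> simple_root (x0 l) = (\<lambda>t. - simple_root (x0 l) t)"
  proof (cases "w \<bullet> simple_root (x0 l) = simple_root (x0 l)")
    case False
    then have "inv w \<bullet> (\<lambda>t. - simple_root (x0 l) t) = simple_root (x0 l)"
      using Z_sign[OF w] \<open>inv w \<bullet> w \<bullet> simple_root (x0 l) = simple_root (x0 l)\<close> by simp
    then have "simple_root (x0 l) = (\<lambda>t. - (inv w \<bullet> simple_root (x0 l)) t)"
      using w by (simp add: Z_closed act_neg)
    then have "inv w \<bullet> simple_root (x0 l) = (\<lambda>t. - simple_root (x0 l) t)"
      by (simp add: fun_eq_iff)
    then show ?thesis by blast
  qed (use \<open>inv w \<bullet> w \<bullet> simple_root (x0 l) = simple_root (x0 l)\<close> in simp)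
qed (simp add: Z_closed)

lemma Z_subgroup: "subgroup Z G"
  by (intro subgroupI) (use Z_closed Z_one Z_inv Z_mult in auto)

lemma simple_root_ne_neg: "simple_root s \<noteq> (\<lambda>t. - simple_root s t)"
  by (auto simp: fun_eq_iff simple_root_def intro!: exI[of _ s])

lemma signs_iff: "l \<in> signs w \<longleftrightarrow> l \<in> \<Lambda> \<and> w \<bullet> simple_root (x0 l) = (\<lambda>t. - simple_root (x0 l) t)"
  by (simp add: A_map_def)

lemma signs_subset: "signs w \<subseteq> \<Lambda>"
  by (auto simp: signs_iff)

lemma Z_act:
  assumes "w \<in> Z" "l \<in> \<Lambda>"
  shows "w \<bullet> simple_root (x0 l) = (if l \<in> signs w then (\<lambda>t. - simple_root (x0 l) t) else simple_root (x0 l))"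
  using Z_sign[OF assms] assms(2) by (auto simp: signs_iff)

lemma signs_mult:
  assumes "w \<in> Z" "u \<in> Z"
  shows "signs (w \<otimes> u) = sym_diff (signs w) (signs u)"
proof -
  have c: "w \<in> carrier G" "u \<in> carrier G" using assms Z_closed by auto
  have "l \<in> signs (w \<otimes> u) \<longleftrightarrow> (l \<in> signs w \<longleftrightarrow> l \<notin> signs u)" if l: "l \<in> \<Lambda>" for l
  proof -
    have "(w \<otimes> u) \<bullet> simple_root (x0 l) = w \<bullet> u \<bullet> simple_root (x0 l)" using c by (simp add: act_mult)
    then have "(w \<otimes> u) \<bullet> simple_root (x0 l) =
        (if l \<in> signs w \<longleftrightarrow> l \<notin> signs u then (\<lambda>t. - simple_root (x0 l) t) else simple_root (x0 l))"
      using Z_act[OF assms(1) l] Z_act[OF assms(2) l] c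
      by (cases "l \<in> signs w"; cases "l \<in> signs u") (simp_all add: act_neg)
    then show ?thesis
      using l simple_root_ne_neg[of "x0 l"] signs_iff[of l "w \<otimes> u"]
      by (cases "l \<in> signs w \<longleftrightarrow> l \<notin> signs u") simp_all
  qed
  moreover have "l \<notin> signs w" "l \<notin> signs u" "l \<notin> signs (w \<otimes> u)" if "l \<notin> \<Lambda>" for l
    using that signs_subset by blast+
  ultimately have "l \<in> signs (w \<otimes> u) \<longleftrightarrow> l \<in> sym_diff (signs w) (signs u)" for l
    by (cases "l \<in> \<Lambda>") auto
  then show ?thesis by blast
qed

lemma signs_empty_iff: "w \<in> Z \<Longrightarrow> signs w = {} \<longleftrightarrow> w \<in> Chom x0 x0"
proof
  assume w: "w \<in> Z" "signs w = {}"
  then show "w \<in> Chom x0 x0" using Z_act[OF w(1)] by (intro ChomI) (auto simp: Z_closed)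
next
  assume "w \<in> Chom x0 x0"
  then have "l \<notin> signs w" for l
    using Chom_act[of w x0 x0 l] simple_root_ne_neg[of "x0 l"] by (auto simp: signs_iff)
  then show "signs w = {}" by blast
qed

lemma Chom_Z: "w \<in> Chom x0 x0 \<Longrightarrow> w \<in> Z"
  by (rule ZI) (auto simp: Chom_closed Chom_act)

lemma Z_perp:
  assumes "w \<in> Z" "\<gamma> \<in> perp_roots G S base"
  shows "w \<bullet> \<gamma> \<in> perp_roots G S base"
proof (rule perp_act[OF Z_closed[OF assms(1)] base_S base_S assms(2)])
  fix k assume "k \<in> base"
  then obtain l where l: "l \<in> \<Lambda>" "k = x0 l" by blast
  show "\<exists>j\<in>base. simple_root k = w \<bullet> simple_root j \<or> simple_root k = (\<lambda>t. - (w \<bullet> simple_root j) t)"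
    by (rule bexI[of _ k]) (use Z_sign[OF assms(1) l(1)] l in auto)
qed

text \<open>The part of membership in \<open>A_tilde\<close> that concerns the set alone; the
  condition that the twisted tuple is a vertex is kept apart.\<close>

definition admissible :: "'l set \<Rightarrow> bool" where
  "admissible A \<longleftrightarrow> A \<subseteq> \<Lambda> \<and> finite_type G (x0 ` A) \<and> union_of_components G (x0 ` A) base"

definition wA :: "'l set \<Rightarrow> 'a" where "wA A = longest (x0 ` A)"

abbreviation tw :: "'l set \<Rightarrow> ('l \<Rightarrow> 'a) \<Rightarrow> 'l \<Rightarrow> 'a" where "tw \<equiv> twist G S \<Lambda>"

lemma admissibleD:
  assumes "admissible A"
  shows "A \<subseteq> \<Lambda>" "x0 ` A \<subseteq> S" "finite_type G (x0 ` A)"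
    "\<And>k l. k \<in> A \<Longrightarrow> l \<in> \<Lambda> \<Longrightarrow> l \<notin> A \<Longrightarrow> cox_matrix_entry G (x0 k) (x0 l) = 0"
proof -
  show *: "A \<subseteq> \<Lambda>" "x0 ` A \<subseteq> S" "finite_type G (x0 ` A)"
    using assms x0_S by (auto simp: admissible_def)
  fix k l assume kl: "k \<in> A" "l \<in> \<Lambda>" "l \<notin> A"
  then have "x0 l \<notin> x0 ` A" using * x0_eq_iff by auto
  then show "cox_matrix_entry G (x0 k) (x0 l) = 0"
    using union_of_components_orthogonal[OF base_S, of "x0 ` A"] assms kl by (auto simp: admissible_def)
qed

lemma wA_facts:
  assumes "admissible A"
  shows wA_in: "wA A \<in> generate G (x0 ` A)" and wA_closed: "wA A \<in> carrier G"
    and wA_square: "wA A \<otimes> wA A = \<one>" and wA_inv: "inv (wA A) = wA A"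
  using admissibleD[OF assms] longest_in longest_closed longest_square longest_inv by (simp_all add: wA_def)

lemma wA_outside:
  assumes "admissible A" "l \<in> \<Lambda>" "l \<notin> A"
  shows "wA A \<bullet> simple_root (x0 l) = simple_root (x0 l)"
  using admissibleD[OF assms(1)] wA_in[OF assms(1)] assms
  by (intro act_orthogonal[OF admissibleD(2)[OF assms(1)]]) auto

lemma wA_inside:
  assumes "admissible A" "l \<in> A"
  obtains i where "i \<in> A" "wA A \<bullet> simple_root (x0 l) = (\<lambda>t. - simple_root (x0 i) t)"
    "wA A \<bullet> simple_root (x0 i) = (\<lambda>t. - simple_root (x0 l) t)"
  using longest_perm[OF admissibleD(2,3)[OF assms(1)], of "x0 l"] assms(2) unfolding wA_def by blast

lemma wA_perp:
  assumes "admissible A" "\<gamma> \<in> perp_roots G S base"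
  shows "wA A \<bullet> \<gamma> = \<gamma>"
proof (rule act_orthogonal[OF admissibleD(2)[OF assms(1)] wA_in[OF assms(1)]])
  note \<gamma> = perp_rootsD[OF assms(2)]
  show "fin_supp \<gamma>" using \<gamma> by simp
  fix j assume "j \<in> x0 ` A"
  then have j: "j \<in> base" "j \<in> S" using admissibleD[OF assms(1)] base_S by auto
  have "B j \<gamma> = form G \<gamma> (simple_root j)" using \<gamma>(1) j by (intro form_commute) auto
  then show "B j \<gamma> = 0" using \<gamma>(2) j by simp
qed

text \<open>Conjugation by \<open>w\<close> carries each entry of \<open>x\<close> to the entry of
  \<open>y\<close> with the same index, so the conjugate lies in the right parabolic subgroup; it
  makes the simple roots there negative, and \<open>longest_unique\<close> applies.\<close>

lemma longest_conj:
  assumes "w \<in> Chom y x" "x \<in> tuples" "y \<in> tuples" "A \<subseteq> \<Lambda>" "finite_type G (x ` A)"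
  shows "longest (y ` A) = w \<otimes> longest (x ` A) \<otimes> inv w"
proof -
  let ?u = "longest (x ` A)"
  have w: "w \<in> carrier G" using assms Chom_closed by blast
  have S: "x ` A \<subseteq> S" "y ` A \<subseteq> S" using assms tuple_S by auto
  have u: "?u \<in> carrier G" "?u \<in> generate G (x ` A)" using S assms longest_in longest_closed by auto
  have gen: "w \<otimes> word_prod G ss \<otimes> inv w \<in> generate G (y ` A)" if "set ss \<subseteq> x ` A" for ss
    using that
  proof (induction ss)
    case Nil
    then show ?case using w by (simp add: generate.one)
  next
    case (Cons s ss)
    then obtain l where l: "l \<in> A" "l \<in> \<Lambda>" "s = x l" using assms by auto
    have c: "s \<in> carrier G" "word_prod G ss \<in> carrier G" using Cons.prems S by auto
    have "w \<otimes> word_prod G (s # ss) \<otimes> inv w = (w \<otimes> s \<otimes> inv w) \<otimes> (w \<otimes> word_prod G ss \<otimes> inv w)"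
      using w c by (simp add: m_assoc)
    also have "w \<otimes> s \<otimes> inv w = y l" using Chom_conj[OF assms(1,3,2)] l by simp
    finally show ?case using Cons l by (auto intro: generate.intros)
  qed
  have "w \<otimes> ?u \<otimes> inv w = longest (y ` A)"
  proof (rule longest_unique(1)[OF S(2)])
    show "w \<otimes> ?u \<otimes> inv w \<in> generate G (y ` A)"
      using gen u(2) generate_words[OF S(1)] by auto
    fix j assume "j \<in> y ` A"
    then obtain l where l: "l \<in> A" "l \<in> \<Lambda>" "j = y l" using assms by auto
    obtain i where "i \<in> x ` A" "?u \<bullet> simple_root (x l) = (\<lambda>t. - simple_root i t)"
      using longest_perm[OF S(1) assms(5), of "x l"] l by blast
    then obtain k where k: "k \<in> \<Lambda>" "?u \<bullet> simple_root (x l) = (\<lambda>t. - simple_root (x k) t)"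
      using assms(4) by blast
    have "inv w \<bullet> simple_root j = simple_root (x l)"
      using Chom_act[OF Chom_inv[OF assms(1)] l(2)] l by simp
    then have "(w \<otimes> ?u \<otimes> inv w) \<bullet> simple_root j = w \<bullet> (\<lambda>t. - simple_root (x k) t)"
      using w u k by (simp add: act_mult)
    also have "\<dots> = (\<lambda>t. - simple_root (y k) t)"
      using w Chom_act[OF assms(1) k(1)] by (simp add: act_neg)
    finally show "nonpos_vec ((w \<otimes> ?u \<otimes> inv w) \<bullet> simple_root j)" by simp
  qed
  then show ?thesis ..
qed

section \<open>Twists of tuples, edges and paths\<close>

lemma tw_apply: "l \<in> \<Lambda> \<Longrightarrow> tw A y l = longest (y ` A) \<otimes> y l \<otimes> longest (y ` A)"
  by (simp add: twist_def)

text \<open>The index \<open>i\<close> is found at \<open>x0\<close> and serves every vertex, since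
  \<open>longest_conj\<close> transports the conjugation along the groupoid. This uniformity makes
  an element of \<open>C_hom\<close> also one between the twisted tuples
  (\<open>tw_Chom\<close>).\<close>

lemma tw_index:
  assumes A: "admissible A" and l: "l \<in> \<Lambda>"
  obtains i where "i \<in> \<Lambda>" "i \<in> A \<longleftrightarrow> l \<in> A" "\<And>y. y \<in> V \<Longrightarrow> tw A y l = y i" "\<And>y. y \<in> V \<Longrightarrow> tw A y i = y l"
    "wA A \<bullet> simple_root (x0 l) = (if l \<in> A then (\<lambda>t. - simple_root (x0 i) t) else simple_root (x0 i))"
proof -
  note D = admissibleD[OF A]
  note W = wA_facts[OF A]
  obtain i where i: "i \<in> \<Lambda>" "i \<in> A \<longleftrightarrow> l \<in> A"
    "wA A \<bullet> simple_root (x0 l) = (if l \<in> A then (\<lambda>t. - simple_root (x0 i) t) else simple_root (x0 i))"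
    "wA A \<bullet> simple_root (x0 i) = (if l \<in> A then (\<lambda>t. - simple_root (x0 l) t) else simple_root (x0 l))"
  proof (cases "l \<in> A")
    case True
    then obtain i where "i \<in> A" "wA A \<bullet> simple_root (x0 l) = (\<lambda>t. - simple_root (x0 i) t)"
      "wA A \<bullet> simple_root (x0 i) = (\<lambda>t. - simple_root (x0 l) t)" using wA_inside[OF A] by blast
    then show ?thesis using that[of i] True D(1) by auto
  next
    case False
    then show ?thesis using that[of l] wA_outside[OF A l] l by auto
  qed
  have conj: "wA A \<otimes> x0 l \<otimes> wA A = x0 i" "wA A \<otimes> x0 i \<otimes> wA A = x0 l"
    using conj_simple[OF W(2), of "x0 l" "x0 i"] conj_simple[OF W(2), of "x0 i" "x0 l"] i l x0_S W(4)
    by (auto split: if_splits)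
  have tw: "tw A y k = y j" if y: "y \<in> V" and kj: "k \<in> \<Lambda>" "j \<in> \<Lambda>" "wA A \<otimes> x0 k \<otimes> wA A = x0 j" for y k j
  proof -
    obtain w where w: "w \<in> Chom y x0" using y V_from_base by blast
    then have c: "w \<in> carrier G" using Chom_closed by blast
    have yt: "y \<in> tuples" using y V_tuple by blast
    have L: "longest (y ` A) = w \<otimes> wA A \<otimes> inv w"
      unfolding wA_def using longest_conj[OF w x0_inj yt D(1,3)] .
    have yk: "y k = w \<otimes> x0 k \<otimes> inv w" "y j = w \<otimes> x0 j \<otimes> inv w"
      using Chom_conj[OF w yt x0_inj] kj by simp_all
    have xk: "x0 k \<in> carrier G" using kj x0_S by simp
    have "tw A y k = w \<otimes> (wA A \<otimes> x0 k \<otimes> wA A) \<otimes> inv w"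
      using tw_apply[OF kj(1)] L yk(1) c W(2) xk by (simp add: m_assoc)
    then show ?thesis using kj yk by simp
  qed
  show ?thesis using that[of i] i l tw conj by blast
qed

lemma tw_tuple:
  assumes A: "admissible A" and y: "y \<in> V"
  shows "tw A y \<in> tuples" and "tw A y ` \<Lambda> = y ` \<Lambda>"
proof -
  have yt: "y \<in> tuples" using y V_tuple by blast
  have sub: "tw A y l \<in> y ` \<Lambda>" "y l \<in> tw A y ` \<Lambda>" if "l \<in> \<Lambda>" for l
    using tw_index[OF A that] y that by (metis image_eqI)+
  then show im: "tw A y ` \<Lambda> = y ` \<Lambda>" by blast
  have "inj_on (tw A y) \<Lambda>"
  proof (rule inj_onI)
    fix k l assume kl: "k \<in> \<Lambda>" "l \<in> \<Lambda>" "tw A y k = tw A y l"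
    obtain w where w: "w \<in> Chom y x0" using y V_from_base by blast
    have "longest (y ` A) = w \<otimes> wA A \<otimes> inv w"
      unfolding wA_def using longest_conj[OF w x0_inj yt admissibleD(1,3)[OF A]] .
    then have L: "longest (y ` A) \<in> carrier G" using w Chom_closed wA_closed[OF A] by auto
    have "y k = y l"
      using kl(3) L tuple_S[OF yt] kl(1,2) by (simp add: tw_apply)
    then show "k = l" using yt kl by (auto simp: injections_def dest: inj_onD)
  qed
  moreover have "tw A y \<in> extensional \<Lambda>" by (simp add: twist_def)
  moreover have "tw A y l \<in> S" if "l \<in> \<Lambda>" for l using sub(1)[OF that] tuple_S[OF yt] by auto
  ultimately show "tw A y \<in> tuples" by (auto simp: injections_def PiE_iff)
qed

lemma tw_Chom:
  assumes "admissible A" "z \<in> V" "y \<in> V" "w \<in> Chom z y"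
  shows "w \<in> Chom (tw A z) (tw A y)"
proof (rule ChomI[OF Chom_closed[OF assms(4)]])
  fix l assume "l \<in> \<Lambda>"
  then obtain i where "i \<in> \<Lambda>" "\<And>y. y \<in> V \<Longrightarrow> tw A y l = y i" using tw_index[OF assms(1)] by metis
  then show "w \<bullet> simple_root (tw A y l) = simple_root (tw A z l)"
    using assms Chom_act by simp
qed

lemma tw_V:
  assumes "admissible A" "tw A x0 \<in> V" "y \<in> V"
  shows "tw A y \<in> V"
proof -
  obtain w where "w \<in> Chom y x0" using assms V_from_base by blast
  then have "w \<in> Chom (tw A y) (tw A x0)" using tw_Chom assms x0_V by blast
  then show ?thesis using V_step assms tw_tuple by blast
qed

text \<open>A twist permutes the entries of a tuple, and the element of an edge depends only on
  their set.\<close>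

lemma tw_arc:
  assumes A: "admissible A" "tw A x0 \<in> V" and e: "(y, s) \<in> arcs Cgraph"
  shows "(tw A y, s) \<in> arcs Cgraph" "eelt (tw A y, s) = eelt (y, s)"
    "ehead (tw A y, s) = tw A (ehead (y, s))"
proof -
  have y: "y \<in> V" using e by (simp add: arcs_Cgraph)
  have im: "tw A y ` \<Lambda> = y ` \<Lambda>" using tw_tuple[OF A(1) y] by blast
  show "(tw A y, s) \<in> arcs Cgraph" using e tw_V[OF A y] by (simp add: arcs_Cgraph im)
  show eq: "eelt (tw A y, s) = eelt (y, s)" by (simp add: edge_elt_def im)
  have h: "ehead (y, s) \<in> V" "eelt (y, s) \<in> Chom (ehead (y, s)) y" using ehead_props[OF e] by auto
  show "ehead (tw A y, s) = tw A (ehead (y, s))"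
    using tw_V[OF A h(1)] tw_Chom[OF A(1) h(1) y h(2)] eq by (intro ehead_eqI) auto
qed

lemma tau_pelt:
  assumes A: "admissible A" "tw A x0 \<in> V" and es: "set es \<subseteq> arcs Cgraph"
  shows "snd (tau G S \<Lambda> A (y, es)) = map (\<lambda>(y, s). (tw A y, s)) es"
    "set (map (\<lambda>(y, s). (tw A y, s)) es) \<subseteq> arcs Cgraph"
    "pelt (map (\<lambda>(y, s). (tw A y, s)) es) = pelt es"
proof -
  show "snd (tau G S \<Lambda> A (y, es)) = map (\<lambda>(y, s). (tw A y, s)) es" by (simp add: tau_def)
  show "set (map (\<lambda>(y, s). (tw A y, s)) es) \<subseteq> arcs Cgraph" using es tw_arc(1)[OF A] by auto
  show "pelt (map (\<lambda>(y, s). (tw A y, s)) es) = pelt es"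
    using es tw_arc(2)[OF A] by (induction es rule: rev_induct) auto
qed

text \<open>The end of a nonempty path is the head of its last arc, and heads are compatible with
  twists by \<open>tw_arc\<close>.\<close>

lemma tau_path_end:
  assumes A: "admissible A" "tw A x0 \<in> V" and es: "Y.awalk y es z"
  shows "path_end G S \<Lambda> x0 (tau G S \<Lambda> A (y, es)) = tw A z"
proof (cases es rule: rev_exhaust)
  case Nil
  then show ?thesis using es by (simp add: path_end_def tau_def Y.awalk_verts_conv Y.awalk_Nil_iff)
next
  case (snoc fs e)
  then have e: "e \<in> arcs Cgraph" "ehead e = z" using es Yarc_Cgraph by (auto simp: Y.awalk_snoc)
  obtain x s where xs: "e = (x, s)" by (cases e)
  show ?thesis
    using snoc e tw_arc(3)[OF A, of x s] xs by (simp add: path_end_def tau_def Y.awalk_verts_conv)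
qed

text \<open>The entries with index in \<open>A - D\<close>, \<open>A \<inter> D\<close> and
  \<open>D - A\<close> are mutually orthogonal, so the two longest elements split as
  \<open>d \<otimes> e\<close> and \<open>e \<otimes> f\<close>, and the involution \<open>e\<close>
  cancels in the product.\<close>

lemma wA_product:
  assumes A: "admissible A" and D: "admissible D"
  shows "longest (x0 ` (sym_diff A D)) = wA A \<otimes> wA D"
    "wA A \<otimes> wA D = wA D \<otimes> wA A"
    "wA D = longest (x0 ` (A \<inter> D)) \<otimes> longest (x0 ` (D - A))"
proof -
  note DA = admissibleD[OF A] and DB = admissibleD[OF D]
  have fin: "finite_type G (x0 ` C)" "x0 ` C \<subseteq> S" if "C \<subseteq> A \<or> C \<subseteq> D" for C
    using that finite_type_subset[of "x0 ` A" "x0 ` C"] finite_type_subset[of "x0 ` D" "x0 ` C"] DA DB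
    by blast+
  have entry_sym: "cox_matrix_entry G (x0 k) (x0 l) = cox_matrix_entry G (x0 l) (x0 k)" if "k \<in> \<Lambda>" "l \<in> \<Lambda>" for k l
    using that x0_S entry_commute by blast
  have DE: "cox_matrix_entry G (x0 k) (x0 l) = 0" if "k \<in> A - D" "l \<in> A \<inter> D" for k l
    using DB(4)[of l k] entry_sym[of k l] that DA(1) by auto
  have EF: "cox_matrix_entry G (x0 k) (x0 l) = 0" if "k \<in> A \<inter> D" "l \<in> D - A" for k l
    using DA(4)[of k l] that DB(1) by auto
  have DF: "cox_matrix_entry G (x0 k) (x0 l) = 0" if "k \<in> A - D" "l \<in> D - A" for k l
    using DA(4)[of k l] that DB(1) by auto
  define d e f where "d = longest (x0 ` (A - D))" and "e = longest (x0 ` (A \<inter> D))"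
    and "f = longest (x0 ` (D - A))"
  have wa: "wA A = d \<otimes> e"
  proof -
    have "wA A = longest (x0 ` (A - D) \<union> x0 ` (A \<inter> D))"
      unfolding wA_def by (rule arg_cong[where f = longest]) blast
    also have "\<dots> = d \<otimes> e" unfolding d_def e_def by (rule longest_union) (use fin DE in blast)+
    finally show ?thesis .
  qed
  have wb: "wA D = e \<otimes> f"
  proof -
    have "wA D = longest (x0 ` (A \<inter> D) \<union> x0 ` (D - A))"
      unfolding wA_def by (rule arg_cong[where f = longest]) blast
    also have "\<dots> = e \<otimes> f" unfolding e_def f_def by (rule longest_union) (use fin EF in blast)+
    finally show ?thesis .
  qed
  show "wA D = longest (x0 ` (A \<inter> D)) \<otimes> longest (x0 ` (D - A))" using wb e_def f_def by simp
  have df: "longest (x0 ` (sym_diff A D)) = d \<otimes> f"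
  proof -
    have "longest (x0 ` (sym_diff A D)) = longest (x0 ` (A - D) \<union> x0 ` (D - A))"
      by (rule arg_cong[where f = longest]) blast
    also have "\<dots> = d \<otimes> f" unfolding d_def f_def by (rule longest_union) (use fin DF in blast)+
    finally show ?thesis .
  qed
  have c: "d \<in> carrier G" "e \<in> carrier G" "f \<in> carrier G" "e \<otimes> e = \<one>"
    unfolding d_def e_def f_def
    using longest_closed[OF fin(2,1), of "A - D"] longest_closed[OF fin(2,1), of "A \<inter> D"]
      longest_closed[OF fin(2,1), of "D - A"] longest_square[OF fin(2,1), of "A \<inter> D"] by auto
  then have "e \<otimes> (e \<otimes> f) = f" by (simp add: m_assoc[symmetric])
  then have p: "wA A \<otimes> wA D = d \<otimes> f" using wa wb c by (simp add: m_assoc)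
  then show "longest (x0 ` (sym_diff A D)) = wA A \<otimes> wA D" using df by simp
  have "d \<otimes> f = f \<otimes> d"
  proof -
    have "d \<otimes> f = longest (x0 ` (D - A) \<union> x0 ` (A - D))"
      unfolding df[symmetric] by (rule arg_cong[where f = longest]) blast
    also have "\<dots> = f \<otimes> d"
      unfolding d_def f_def
    proof (rule longest_union)
      fix j k assume "j \<in> x0 ` (D - A)" "k \<in> x0 ` (A - D)"
      then show "cox_matrix_entry G j k = 0" using DF entry_sym DA(1) DB(1) by fastforce
    qed (use fin in blast)+
    finally show ?thesis .
  qed
  \<comment> \<open>Inversion reverses a product of involutions, and \<open>d\<close> commutes with
    \<open>f\<close>; hence the order of the factors does not matter.\<close>
  moreover have "inv (wA A \<otimes> wA D) = wA D \<otimes> wA A"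
    using wA_facts[OF A] wA_facts[OF D] by (simp add: inv_mult_group)
  moreover have "inv (d \<otimes> f) = f \<otimes> d"
    using c longest_inv[OF fin(2,1), of "A - D"] longest_inv[OF fin(2,1), of "D - A"]
    unfolding d_def f_def by (simp add: inv_mult_group)
  ultimately show "wA A \<otimes> wA D = wA D \<otimes> wA A" using p by simp
qed

text \<open>In \<open>wA D\<close>, the factor for \<open>D - A\<close> fixes the simple roots with
  index in \<open>A\<close>, and the factor for \<open>A \<inter> D\<close> permutes those of the
  intersection up to sign.\<close>

lemma tw_image:
  assumes A: "admissible A" and D: "admissible D"
  shows "tw D x0 ` A = x0 ` A"
proof -
  note DA = admissibleD[OF A] and DB = admissibleD[OF D]
  have index: "i \<in> A" if l: "l \<in> A" and i: "i \<in> \<Lambda>" "i \<in> D \<longleftrightarrow> l \<in> D"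
    "wA D \<bullet> simple_root (x0 l) = (if l \<in> D then (\<lambda>t. - simple_root (x0 i) t) else simple_root (x0 i))" for l i
  proof (cases "l \<in> D")
    case False
    then have "simple_root (x0 i) = simple_root (x0 l)"
      using i wA_outside[OF D, of l] l DA(1) by auto
    then show ?thesis using l i x0_eq_iff[of i l] DA(1) by auto
  next
    case True
    let ?e = "longest (x0 ` (A \<inter> D))" and ?f = "longest (x0 ` (D - A))"
    have fin: "finite_type G (x0 ` C)" "x0 ` C \<subseteq> S" if "C \<subseteq> D" for C
      using that finite_type_subset[of "x0 ` D" "x0 ` C"] DB by blast+
    have c: "?e \<in> carrier G" "?f \<in> carrier G"
      using longest_closed[OF fin(2,1), of "A \<inter> D"] longest_closed[OF fin(2,1), of "D - A"] by auto
    have "cox_matrix_entry G j (x0 l) = 0" if jD: "j \<in> x0 ` (D - A)" for j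
    proof -
      obtain k where k: "k \<in> D" "k \<notin> A" "j = x0 k" using jD by blast
      then have "cox_matrix_entry G (x0 l) j = 0" using DA(4)[OF l, of k] DB(1) by auto
      then show ?thesis using entry_commute[of "x0 l" j] k DB(1) l DA(1) x0_S by auto
    qed
    then have "?f \<bullet> simple_root (x0 l) = simple_root (x0 l)"
      using fin[of "D - A"] longest_in by (intro act_orthogonal[of "x0 ` (D - A)"]) auto
    then have "wA D \<bullet> simple_root (x0 l) = ?e \<bullet> simple_root (x0 l)"
      using wA_product(3)[OF A D] c by (simp add: act_mult)
    moreover obtain j where j: "j \<in> x0 ` (A \<inter> D)" "?e \<bullet> simple_root (x0 l) = (\<lambda>t. - simple_root j t)"
      using longest_perm[OF fin(2,1), of "A \<inter> D" "x0 l"] True l by blast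
    ultimately have "(\<lambda>t. - simple_root (x0 i) t) = (\<lambda>t. - simple_root j t)" using i True by simp
    then have "simple_root (x0 i) = simple_root j" by (simp add: fun_eq_iff)
    then have "x0 i \<in> x0 ` A" using j by auto
    then show ?thesis using i x0_eq_iff DA(1) by auto
  qed
  have "tw D x0 l \<in> x0 ` A" "x0 l \<in> tw D x0 ` A" if l: "l \<in> A" for l
  proof -
    have "l \<in> \<Lambda>" using l DA by blast
    then obtain i where i: "i \<in> \<Lambda>" "i \<in> D \<longleftrightarrow> l \<in> D" "\<And>y. y \<in> V \<Longrightarrow> tw D y l = y i"
      "\<And>y. y \<in> V \<Longrightarrow> tw D y i = y l"
      "wA D \<bullet> simple_root (x0 l) = (if l \<in> D then (\<lambda>t. - simple_root (x0 i) t) else simple_root (x0 i))"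
      using tw_index[OF D] by metis
    have "i \<in> A" using index[OF l i(1,2,5)] .
    then show "tw D x0 l \<in> x0 ` A" "x0 l \<in> tw D x0 ` A" using i(3,4)[OF x0_V] by (metis image_eqI)+
  qed
  then show ?thesis by blast
qed

text \<open>Twisting permutes the entries within \<open>x\<^sub>A\<close>, so conjugation by \<open>w\<close> fixes \<open>w\<^sub>0(x\<^sub>A)\<close>.\<close>

lemma wA_commute:
  assumes A: "admissible A" and D: "admissible D" "tw D x0 \<in> V" and w: "w \<in> Chom x0 (tw D x0)"
  shows "w \<otimes> wA A = wA A \<otimes> w"
proof -
  have c: "w \<in> carrier G" using w Chom_closed by blast
  have im: "tw D x0 ` A = x0 ` A" using tw_image[OF A D(1)] .
  have "wA A = w \<otimes> wA A \<otimes> inv w"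
    unfolding wA_def
    using longest_conj[OF w V_tuple[OF D(2)] x0_inj admissibleD(1)[OF A]] admissibleD(3)[OF A] im by simp
  then have "wA A \<otimes> w = w \<otimes> wA A \<otimes> inv w \<otimes> w" by simp
  then show ?thesis using c wA_closed[OF A] by (simp add: m_assoc)
qed

lemma tw_empty: "admissible {}" "wA {} = \<one>" "tw {} x0 = x0"
proof -
  have g: "generate G {} = {\<one>}"
    using generate_words[of "{}"] by simp
  have f: "finite_type G {}" by (simp add: finite_type_def g)
  then show "admissible {}"
    by (auto simp: admissible_def union_of_components_def intro!: exI[of _ "{}"])
  have "longest {} \<in> generate G {}" using f longest_in by blast
  then have "longest {} = \<one>" using g by simp
  then show "wA {} = \<one>" by (simp add: wA_def)
  show "tw {} x0 = x0"
    using x0_inj \<open>longest {} = \<one>\<close> by (auto simp: twist_def injections_def PiE_iff extensional_def fun_eq_iff)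
qed

text \<open>\<open>A\<close> is of finite type since \<open>w\<close> makes all its simple roots negative, and \<open>w w\<^sub>0(x\<^sub>A)\<close>
  connects the base point with its twist.\<close>

lemma signs_admissible:
  assumes w: "w \<in> Z"
  shows "admissible (signs w)" "w \<otimes> wA (signs w) \<in> Chom (tw (signs w) x0) x0" "tw (signs w) x0 \<in> V"
proof -
  let ?A = "signs w"
  have c: "w \<in> carrier G" using w Z_closed by blast
  have sub: "?A \<subseteq> \<Lambda>" by (rule signs_subset)
  have S: "x0 ` ?A \<subseteq> S" using sub x0_S by blast
  have "finite_type G (x0 ` ?A)"
    by (rule finite_type_if_negative[OF S c]) (auto simp: signs_iff)
  moreover have "union_of_components G (x0 ` ?A) base"
  proof (rule union_of_componentsI)
    fix s t assume st: "s \<in> x0 ` ?A" "t \<in> base" "cox_adj G s t"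
    then obtain k l where k: "k \<in> ?A" "s = x0 k" "k \<in> \<Lambda>" and l: "l \<in> \<Lambda>" "t = x0 l" using sub by blast
    have xS: "x0 k \<in> S" "x0 l \<in> S" using k l x0_S by auto
    show "t \<in> x0 ` ?A"
    proof (rule ccontr)
      assume "t \<notin> x0 ` ?A"
      then have "l \<notin> ?A" using l by blast
      \<comment> \<open>Different signs at \<open>k\<close> and \<open>l\<close> would negate the
        value of the form on their simple roots, which \<open>w\<close> preserves; so the value is
        0, against adjacency.\<close>
      then have "form G (\<lambda>t. - simple_root (x0 k) t) (simple_root (x0 l)) =
          form G (w \<bullet> simple_root (x0 k)) (w \<bullet> simple_root (x0 l))"
        using Z_act[OF w k(3)] Z_act[OF w l(1)] k(1) by simp
      also have "\<dots> = form G (simple_root (x0 k)) (simple_root (x0 l))"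
        using c xS by (intro form_act) auto
      finally have "cox_matrix_entry G (x0 k) (x0 l) = 0" by (simp add: form_neg_left)
      then show False using entry_adjacent[OF st(3)] k(2) l(2) by simp
    qed
  qed (use sub in blast)
  ultimately show adm: "admissible ?A" using sub by (simp add: admissible_def)
  show hom: "w \<otimes> wA ?A \<in> Chom (tw ?A x0) x0"
  proof (rule ChomI)
    show "w \<otimes> wA ?A \<in> carrier G" using c wA_closed[OF adm] by simp
    fix l assume l: "l \<in> \<Lambda>"
    obtain i where i: "i \<in> \<Lambda>" "i \<in> ?A \<longleftrightarrow> l \<in> ?A" "\<And>y. y \<in> V \<Longrightarrow> tw ?A y l = y i"
      "wA ?A \<bullet> simple_root (x0 l) = (if l \<in> ?A then (\<lambda>t. - simple_root (x0 i) t) else simple_root (x0 i))"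
      using tw_index[OF adm l] by metis
    show "(w \<otimes> wA ?A) \<bullet> simple_root (x0 l) = simple_root (tw ?A x0 l)"
      using i(2-4) Z_act[OF w i(1)] c wA_closed[OF adm] x0_V by (simp add: act_mult act_neg)
  qed
  show "tw ?A x0 \<in> V" using V_step[OF x0_V hom tw_tuple(1)[OF adm x0_V]] .
qed

abbreviation At :: "'l set monoid" where "At \<equiv> A_tilde G S \<Lambda> x0"

lemma At_carrier: "A \<in> carrier At \<longleftrightarrow> admissible A \<and> tw A x0 \<in> V"
  by (auto simp: A_tilde_def admissible_def)

lemma At_mult [simp]: "A \<otimes>\<^bsub>At\<^esub> D = sym_diff A D"
  by (simp add: A_tilde_def)

lemma At_one [simp]: "\<one>\<^bsub>At\<^esub> = {}"
  by (simp add: A_tilde_def)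

lemma signs_At: "w \<in> Z \<Longrightarrow> signs w \<in> carrier At"
  using signs_admissible by (simp add: At_carrier)

end

section \<open>The complement of the orthogonal reflection subgroup\<close>

context coxeter_tuple
begin

abbreviation \<Psi> :: "('a \<Rightarrow> real) set" where "\<Psi> \<equiv> perp_roots G S base"
abbreviation \<Psi>pos :: "('a \<Rightarrow> real) set" where "\<Psi>pos \<equiv> perp_pos_roots G S base"
abbreviation W\<Psi> :: "'a set" where "W\<Psi> \<equiv> perp_group G S base"
abbreviation Bt :: "'a set" where "Bt \<equiv> B_tilde G S base"

lemma perp_refl_Z: "\<gamma> \<in> \<Psi> \<Longrightarrow> refl \<gamma> \<in> Z"
proof -
  assume "\<gamma> \<in> \<Psi>"
  note \<gamma> = perp_rootsD[OF this]
  have "refl \<gamma> \<in> Chom x0 x0"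
    by (rule ChomI) (use \<gamma> x0_S in \<open>auto intro!: refl_orthogonal\<close>)
  then show ?thesis by (rule Chom_Z)
qed

lemma perp_refl_stable: "refl_stable \<Psi>"
  unfolding refl_stable_def using Z_perp[OF perp_refl_Z] by (auto dest: perp_rootsD)

lemma perp_group_Z: "W\<Psi> \<subseteq> Z"
  unfolding perp_group_def using perp_refl_Z Z_subgroup by (intro generate_subgroup_incl) auto

lemma perp_group_subgroup: "subgroup W\<Psi> G"
  unfolding perp_group_def by (intro generate_is_subgroup) (auto dest: perp_rootsD)

lemma perp_refl_group: "\<gamma> \<in> \<Psi> \<Longrightarrow> refl \<gamma> \<in> W\<Psi>"
  unfolding perp_group_def by (auto intro: generate.incl)

text \<open>Conjugation turns the reflection in \<delta> into the reflection in
  \<open>w \<bullet> \<delta>\<close>, again orthogonal to the base by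
  \<open>Z_perp\<close>.\<close>

lemma perp_group_conj:
  assumes w: "w \<in> Z" and u: "u \<in> W\<Psi>"
  shows "w \<otimes> u \<otimes> inv w \<in> W\<Psi>"
proof -
  have c: "w \<in> carrier G" using w Z_closed by blast
  have \<Psi>: "\<Psi> \<subseteq> \<Phi>" by (auto dest: perp_rootsD)
  obtain ds where ds: "set ds \<subseteq> \<Psi>" "u = refl_prod ds"
    using u generate_refl[OF \<Psi>] unfolding perp_group_def by blast
  have "w \<otimes> refl_prod ds \<otimes> inv w \<in> W\<Psi>"
    using ds(1)
  proof (induction ds)
    case Nil
    then show ?case using c perp_group_subgroup by (simp add: subgroup.one_closed)
  next
    case (Cons \<delta> ds)
    have d: "\<delta> \<in> \<Phi>" "set ds \<subseteq> \<Phi>" using Cons.prems \<Psi> by auto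
    have "w \<otimes> refl_prod (\<delta> # ds) \<otimes> inv w = refl (w \<bullet> \<delta>) \<otimes> (w \<otimes> refl_prod ds \<otimes> inv w)"
      using c d by (simp add: refl_conj m_assoc)
    moreover have "refl (w \<bullet> \<delta>) \<in> W\<Psi>" using perp_refl_group Z_perp[OF w] Cons.prems by auto
    ultimately show ?case using Cons perp_group_subgroup by (simp add: subgroup.m_closed)
  qed
  then show ?thesis using ds by simp
qed

lemma Bt_Z: "w \<in> Bt \<Longrightarrow> w \<in> Z"
  by (simp add: B_tilde_def)

lemma Bt_act: "w \<in> Bt \<Longrightarrow> \<gamma> \<in> \<Psi>pos \<Longrightarrow> w \<bullet> \<gamma> \<in> \<Psi>pos"
  by (auto simp: B_tilde_def)

text \<open>One inclusion gives equality: the preimage of an orthogonal positive root is orthogonal,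
  and if it were negative, its negative would be a positive root sent to a negative one.\<close>

lemma BtI:
  assumes w: "w \<in> Z" and pos: "\<And>\<gamma>. \<gamma> \<in> \<Psi>pos \<Longrightarrow> w \<bullet> \<gamma> \<in> \<Phi>pos"
  shows "w \<in> Bt"
proof -
  have c: "w \<in> carrier G" using w Z_closed by blast
  have "\<gamma> \<in> (\<bullet>) w ` \<Psi>pos" if \<gamma>: "\<gamma> \<in> \<Psi>pos" for \<gamma>
  proof -
    have \<gamma>r: "\<gamma> \<in> \<Phi>" "\<gamma> \<in> \<Psi>" "\<gamma> \<in> \<Phi>pos" using \<gamma> by (auto simp: perp_pos_iff dest: perp_rootsD)
    define \<delta> where "\<delta> = inv w \<bullet> \<gamma>"
    have \<delta>: "\<delta> \<in> \<Psi>" "\<delta> \<in> \<Phi>" "w \<bullet> \<delta> = \<gamma>"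
      using Z_perp[OF Z_inv[OF w] \<gamma>r(2)] c \<gamma>r by (auto simp: \<delta>_def dest: perp_rootsD)
    have "\<not> nonpos_vec \<delta>"
    proof
      assume "nonpos_vec \<delta>"
      then have "(\<lambda>t. - \<delta> t) \<in> \<Psi>pos" using \<delta> perp_neg by (simp add: perp_pos_iff pos_roots_iff)
      then have "w \<bullet> (\<lambda>t. - \<delta> t) \<in> \<Phi>pos" by (rule pos)
      then have "nonpos_vec \<gamma>" using \<delta> c by (simp add: act_neg pos_roots_iff)
      then show False using \<gamma>r root_not_both by (auto simp: pos_roots_iff)
    qed
    then have "\<delta> \<in> \<Psi>pos" using \<delta> root_sign by (auto simp: perp_pos_iff pos_roots_iff)
    then show ?thesis using \<delta>(3) by blast
  qed
  moreover have "w \<bullet> \<gamma> \<in> \<Psi>pos" if "\<gamma> \<in> \<Psi>pos" for \<gamma>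
    using that pos Z_perp[OF w] by (simp add: perp_pos_iff)
  ultimately show ?thesis using w unfolding B_tilde_def by blast
qed

lemma Bt_inv: "w \<in> Bt \<Longrightarrow> inv w \<in> Bt"
proof (rule BtI)
  assume w: "w \<in> Bt"
  then show "inv w \<in> Z" using Bt_Z Z_inv by blast
  fix \<gamma> assume "\<gamma> \<in> \<Psi>pos"
  then obtain \<delta> where \<delta>: "\<delta> \<in> \<Psi>pos" "\<gamma> = w \<bullet> \<delta>" using w by (auto simp: B_tilde_def)
  then have "\<delta> \<in> \<Phi>pos" "fin_supp \<delta>" by (auto simp: perp_pos_iff dest: perp_rootsD)
  then show "inv w \<bullet> \<gamma> \<in> \<Phi>pos" using \<delta> w Bt_Z Z_closed by simp
qed

lemma Psi_pos_fin_supp: "\<gamma> \<in> \<Psi>pos \<Longrightarrow> fin_supp \<gamma>"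
  by (auto simp: perp_pos_iff dest: perp_rootsD)

lemma Bt_mult: "w \<in> Bt \<Longrightarrow> u \<in> Bt \<Longrightarrow> w \<otimes> u \<in> Bt"
proof (rule BtI)
  assume wu: "w \<in> Bt" "u \<in> Bt"
  then show "w \<otimes> u \<in> Z" using Bt_Z Z_mult by blast
  fix \<gamma> assume "\<gamma> \<in> \<Psi>pos"
  then have "w \<bullet> u \<bullet> \<gamma> \<in> \<Phi>pos" "fin_supp \<gamma>"
    using Bt_act wu Psi_pos_fin_supp by (auto simp: perp_pos_iff)
  then show "(w \<otimes> u) \<bullet> \<gamma> \<in> \<Phi>pos" using wu Bt_Z Z_closed by (simp add: act_mult)
qed

lemma Bt_one: "\<one> \<in> Bt"
  by (rule BtI) (use Z_one Psi_pos_fin_supp in \<open>auto simp: perp_pos_iff\<close>)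

lemma Bt_subgroup: "subgroup Bt G"
  by (intro subgroupI) (use Bt_Z Z_closed Bt_one Bt_inv Bt_mult in auto)

lemma perp_group_Int_Bt: "W\<Psi> \<inter> Bt = {\<one>}"
proof -
  have "w = \<one>" if "w \<in> W\<Psi>" "w \<in> Bt" for w
  proof (rule refl_stable_no_inversion[OF perp_refl_stable])
    show "w \<in> generate G (refl ` \<Psi>)" using that by (simp add: perp_group_def)
    fix \<gamma> assume "\<gamma> \<in> \<Psi>" "\<gamma> \<in> \<Phi>pos"
    then have "w \<bullet> \<gamma> \<in> \<Psi>pos" using that by (intro Bt_act) (simp_all add: perp_pos_iff)
    then show "nonneg_vec (w \<bullet> \<gamma>)" by (simp add: perp_pos_iff pos_roots_iff)
  qed
  then show ?thesis using Bt_one perp_group_subgroup by (auto simp: subgroup.one_closed)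
qed

text \<open>Outside \<open>Bt\<close> some orthogonal positive root is inverted, and multiplying by
  its reflection shortens \<open>w\<close>. In the decomposition of the shorter element the
  reflection is moved to the left past \<open>b\<close>, where it becomes a conjugate still in the
  normal factor.\<close>

lemma Z_decomposition:
  assumes "w \<in> Z"
  shows "\<exists>u\<in>W\<Psi>. \<exists>b\<in>Bt. w = u \<otimes> b"
  using assms
proof (induction "len w" arbitrary: w rule: less_induct)
  case less
  have c: "w \<in> carrier G" using less.prems Z_closed by blast
  show ?case
  proof (cases "w \<in> Bt")
    case True
    then show ?thesis using c perp_group_subgroup by (intro bexI[of _ \<one>] bexI[of _ w]) (auto simp: subgroup.one_closed)
  next
    case False
    then obtain \<gamma> where \<gamma>: "\<gamma> \<in> \<Psi>pos" "w \<bullet> \<gamma> \<notin> \<Phi>pos" using BtI[OF less.prems] by blast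
    then have \<gamma>r: "\<gamma> \<in> \<Psi>" "\<gamma> \<in> \<Phi>pos" "\<gamma> \<in> \<Phi>" by (auto simp: perp_pos_iff dest: perp_rootsD)
    then have "nonpos_vec (w \<bullet> \<gamma>)" using \<gamma> pos_root_act_iff[OF c] by blast
    then have "len (w \<otimes> refl \<gamma>) < len w" using len_refl c \<gamma>r by blast
    moreover have "w \<otimes> refl \<gamma> \<in> Z" using less.prems perp_refl_Z \<gamma>r Z_mult by blast
    ultimately obtain u b where ub: "u \<in> W\<Psi>" "b \<in> Bt" "w \<otimes> refl \<gamma> = u \<otimes> b"
      using less.hyps by blast
    have bc: "b \<in> Z" "b \<in> carrier G" "u \<in> carrier G"
      using ub Bt_Z Z_closed perp_group_Z by blast+
    let ?r = "b \<otimes> refl \<gamma> \<otimes> inv b"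
    have "?r \<in> W\<Psi>" using perp_group_conj[OF bc(1)] perp_refl_group \<gamma>r by blast
    then have ur: "u \<otimes> ?r \<in> W\<Psi>" using ub perp_group_subgroup by (simp add: subgroup.m_closed)
    have "w = w \<otimes> refl \<gamma> \<otimes> refl \<gamma>" using c \<gamma>r by (simp add: m_assoc)
    also have "\<dots> = u \<otimes> ?r \<otimes> b" unfolding ub using bc \<gamma>r by (simp add: m_assoc)
    finally show ?thesis using ur ub by blast
  qed
qed

section \<open>The semidirect product, its action on the generators, and exactness\<close>

lemma Z_group: "group (G\<lparr>carrier := Z\<rparr>)"
  using Z_subgroup by (rule subgroup.subgroup_is_group) (rule group_axioms)

lemma Z_semidirect: "internal_semidirect (G\<lparr>carrier := Z\<rparr>) W\<Psi> Bt"
  unfolding internal_semidirect_def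
proof (intro conjI)
  interpret Z: group "G\<lparr>carrier := Z\<rparr>" by (rule Z_group)
  have sub: "subgroup H (G\<lparr>carrier := Z\<rparr>)" if "subgroup H G" "H \<subseteq> Z" for H
    using subgroup_incl[OF that(1) Z_subgroup that(2)] .
  show "W\<Psi> \<lhd> G\<lparr>carrier := Z\<rparr>"
    unfolding Z.normal_inv_iff
    using sub[OF perp_group_subgroup perp_group_Z] perp_group_conj m_inv_consistent[OF Z_subgroup] by simp
  show "subgroup Bt (G\<lparr>carrier := Z\<rparr>)" using sub[OF Bt_subgroup] Bt_Z by blast
  show "W\<Psi> \<inter> Bt = {\<one>\<^bsub>G\<lparr>carrier := Z\<rparr>\<^esub>}" using perp_group_Int_Bt by simp
  show "W\<Psi> <#>\<^bsub>G\<lparr>carrier := Z\<rparr>\<^esub> Bt = carrier (G\<lparr>carrier := Z\<rparr>)"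
  proof (intro equalityI subsetI)
    fix w assume "w \<in> W\<Psi> <#>\<^bsub>G\<lparr>carrier := Z\<rparr>\<^esub> Bt"
    then obtain u b where "u \<in> W\<Psi>" "b \<in> Bt" "w = u \<otimes> b" by (auto simp: set_mult_def)
    then show "w \<in> carrier (G\<lparr>carrier := Z\<rparr>)" using Z_mult perp_group_Z Bt_Z by auto
  next
    fix w assume "w \<in> carrier (G\<lparr>carrier := Z\<rparr>)"
    then have "w \<in> Z" by simp
    from Z_decomposition[OF this] obtain u b where "u \<in> W\<Psi>" "b \<in> Bt" "w = u \<otimes> b" by blast
    then show "w \<in> W\<Psi> <#>\<^bsub>G\<lparr>carrier := Z\<rparr>\<^esub> Bt" by (auto simp: set_mult_def)
  qed
qed

text \<open>The generators are defined by indecomposability in the cone of orthogonal positive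
  roots. An element of \<open>Bt\<close> acts linearly and permutes these roots, so a decomposition
  of the image can be pulled back.\<close>

lemma perp_gens_conj:
  assumes w: "w \<in> Bt" and r: "r \<in> perp_gens G S base"
  shows "w \<otimes> r \<otimes> inv w \<in> perp_gens G S base"
proof -
  have c: "w \<in> carrier G" using w Bt_Z Z_closed by blast
  obtain \<gamma> where \<gamma>: "\<gamma> \<in> \<Psi>pos" "r = refl \<gamma>"
    and ind: "\<And>(n::nat) c \<beta>. (\<forall>i<n. c i > (0::real) \<and> \<beta> i \<in> \<Psi>pos) \<Longrightarrow>
      \<gamma> = (\<lambda>t. \<Sum>i<n. c i * \<beta> i t) \<Longrightarrow> (\<forall>i<n. \<beta> i = \<gamma>)"
    using r unfolding perp_gens_def by blast
  have \<gamma>r: "\<gamma> \<in> \<Phi>" using \<gamma> by (auto simp: perp_pos_iff dest: perp_rootsD)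
  have "\<beta> i = w \<bullet> \<gamma>" if a: "\<forall>i<n. c i > (0::real) \<and> \<beta> i \<in> \<Psi>pos" "w \<bullet> \<gamma> = (\<lambda>t. \<Sum>i<n. c i * \<beta> i t)"
    "i < n" for n :: nat and c \<beta> i
  proof -
    have f: "fin_supp (\<beta> i)" if "i < n" for i using a(1) that Psi_pos_fin_supp by blast
    have "\<gamma> = inv w \<bullet> w \<bullet> \<gamma>" using \<open>w \<in> carrier G\<close> \<gamma>r by simp
    also have "\<dots> = (\<lambda>t. \<Sum>i<n. c i * (inv w \<bullet> \<beta> i) t)"
      unfolding a(2) using \<open>w \<in> carrier G\<close> f by (intro act_sum) auto
    finally have "\<forall>i<n. inv w \<bullet> \<beta> i = \<gamma>"
      using a(1) Bt_act[OF Bt_inv[OF w]] by (intro ind) auto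
    then have "inv w \<bullet> \<beta> i = \<gamma>" using a(3) by blast
    then show ?thesis using \<open>w \<in> carrier G\<close> f[OF a(3)] by auto
  qed
  moreover have "w \<otimes> r \<otimes> inv w = refl (w \<bullet> \<gamma>)" using \<gamma> \<gamma>r c by (simp add: refl_conj)
  ultimately show ?thesis
    unfolding perp_gens_def using Bt_act[OF w \<gamma>(1)] by blast
qed

lemma conj_cancel: "w \<in> carrier G \<Longrightarrow> u \<in> carrier G \<Longrightarrow> w \<otimes> (inv w \<otimes> u \<otimes> w) \<otimes> inv w = u"
  by (simp add: m_assoc)

lemma Bt_coxeter_automorphism:
  assumes w: "w \<in> Bt"
  shows "coxeter_automorphism (G\<lparr>carrier := W\<Psi>\<rparr>) (perp_gens G S base) (\<lambda>u. w \<otimes> u \<otimes> inv w)"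
proof -
  let ?f = "\<lambda>u. w \<otimes> u \<otimes> inv w"
  have c: "w \<in> carrier G" and wZ: "w \<in> Z" using w Bt_Z Z_closed by auto
  have Wc: "u \<in> carrier G" if "u \<in> W\<Psi>" for u using that perp_group_Z Z_closed by blast
  have onto: "u \<in> ?f ` H" if "u \<in> H" "u \<in> carrier G" "\<And>u. u \<in> H \<Longrightarrow> inv w \<otimes> u \<otimes> inv (inv w) \<in> H" for u H
    using that(3)[OF that(1)] conj_cancel[OF c that(2)] c by (intro image_eqI[of _ _ "inv w \<otimes> u \<otimes> w"]) auto
  have "?f \<in> hom (G\<lparr>carrier := W\<Psi>\<rparr>) (G\<lparr>carrier := W\<Psi>\<rparr>)"
    by (rule homI) (use perp_group_conj[OF wZ] Wc c in \<open>auto simp: m_assoc\<close>)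
  moreover have "bij_betw ?f W\<Psi> W\<Psi>"
    unfolding bij_betw_def
  proof
    show "inj_on ?f W\<Psi>" using Wc c by (auto intro!: inj_onI)
    show "?f ` W\<Psi> = W\<Psi>"
      using perp_group_conj[OF wZ] onto[OF _ Wc perp_group_conj[OF Z_inv[OF wZ]]] by auto
  qed
  moreover have "?f ` perp_gens G S base = perp_gens G S base"
  proof -
    have "r \<in> carrier G" if "r \<in> perp_gens G S base" for r
      using that unfolding perp_gens_def by (auto simp: perp_pos_iff dest: perp_rootsD)
    then show ?thesis
      using perp_gens_conj[OF w] onto[OF _ _ perp_gens_conj[OF Bt_inv[OF w]]] by auto
  qed
  ultimately show ?thesis by (simp add: coxeter_automorphism_def iso_def)
qed

lemma Y_eq: "Yhom x0 x0 = {w \<in> Bt. w \<in> Chom x0 x0}"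
proof (intro equalityI subsetI)
  fix w assume "w \<in> Yhom x0 x0"
  then show "w \<in> {w \<in> Bt. w \<in> Chom x0 x0}"
    using Yhom_Chom Yhom_pos Chom_Z by (auto intro!: BtI)
next
  fix w assume "w \<in> {w \<in> Bt. w \<in> Chom x0 x0}"
  then show "w \<in> Yhom x0 x0" using Bt_act by (intro YhomI) (auto simp: perp_pos_iff)
qed

text \<open>Serves both sequences: \<open>H\<close> is the centralizer in one and \<open>Bt\<close>
  in the other, and only surjectivity differs.\<close>

lemma signs_short_exact:
  assumes H: "subgroup H G" "H \<subseteq> Z" and onto: "carrier At \<subseteq> signs ` H"
  shows "short_exact (G\<lparr>carrier := {w \<in> H. w \<in> Chom x0 x0}\<rparr>) (\<lambda>w. w) (G\<lparr>carrier := H\<rparr>) signs At"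
  unfolding short_exact_def
proof (intro conjI)
  let ?N = "{w \<in> H. w \<in> Chom x0 x0}"
  have N: "subgroup ?N G"
  proof (rule subgroupI)
    show "?N \<noteq> {}" using Chom_one subgroup.one_closed[OF H(1)] by blast
  qed (use H(1) Chom_closed Chom_inv Chom_mult in
      \<open>auto simp: subgroup.m_closed subgroup.m_inv_closed\<close>)
  show "group (G\<lparr>carrier := ?N\<rparr>)" using N by (rule subgroup.subgroup_is_group) (rule group_axioms)
  show "group (G\<lparr>carrier := H\<rparr>)" using H(1) by (rule subgroup.subgroup_is_group) (rule group_axioms)
  have image: "signs ` H = carrier At" using onto H(2) signs_At by blast
  \<comment> \<open>Closure under symmetric differences is inherited from \<open>H\<close>: every
    member of \<open>A_tilde\<close> is a sign set, and signs are multiplicative.\<close>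
  show "group At"
  proof (rule groupI)
    fix A D assume "A \<in> carrier At" "D \<in> carrier At"
    then obtain w u where "w \<in> H" "u \<in> H" "A = signs w" "D = signs u" using onto by blast
    then show "A \<otimes>\<^bsub>At\<^esub> D \<in> carrier At"
      using signs_mult[of w u] signs_At[OF Z_mult[of w u]] H(2) by auto
  next
    have "signs \<one> = {}" using signs_empty_iff[OF Z_one] Chom_one by blast
    then show "\<one>\<^bsub>At\<^esub> \<in> carrier At" using signs_At[OF Z_one] by simp
  next
    fix A assume "A \<in> carrier At"
    then show "\<exists>D\<in>carrier At. D \<otimes>\<^bsub>At\<^esub> A = \<one>\<^bsub>At\<^esub>" by (intro bexI[of _ A]) auto
  qed auto
  show "(\<lambda>w. w) \<in> mon (G\<lparr>carrier := ?N\<rparr>) (G\<lparr>carrier := H\<rparr>)"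
    by (auto simp: mon_def hom_def)
  show "signs \<in> epi (G\<lparr>carrier := H\<rparr>) At"
    using image signs_mult H(2) by (auto simp: epi_def hom_def subset_iff)
  show "kernel (G\<lparr>carrier := H\<rparr>) At signs = (\<lambda>w. w) ` carrier (G\<lparr>carrier := ?N\<rparr>)"
    using signs_empty_iff H(2) by (auto simp: kernel_def subset_iff)
qed

lemma tw_tw:
  assumes A: "admissible A" and D: "admissible D"
  shows "tw A (tw D x0) = tw (sym_diff A D) x0"
proof
  fix l
  show "tw A (tw D x0) l = tw (sym_diff A D) x0 l"
  proof (cases "l \<in> \<Lambda>")
    case True
    have c: "wA A \<in> carrier G" "wA D \<in> carrier G" "x0 l \<in> carrier G"
      using wA_closed A D x0_S True by auto
    have "tw A (tw D x0) l = wA A \<otimes> (wA D \<otimes> x0 l \<otimes> wA D) \<otimes> wA A"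
      using True tw_image[OF A D] by (simp add: tw_apply wA_def)
    also have "\<dots> = (wA A \<otimes> wA D) \<otimes> x0 l \<otimes> (wA D \<otimes> wA A)"
      using c by (simp add: m_assoc)
    also have "\<dots> = tw (sym_diff A D) x0 l"
      using True wA_product(1)[OF A D] wA_product(2)[OF A D] by (simp only: tw_apply)
    finally show ?thesis .
  qed (simp add: twist_def)
qed

end

section \<open>Paths in the maximal tree\<close>

locale coxeter_tree = coxeter_tuple G S \<Lambda> x0
  for G :: "('a, 'b) monoid_scheme" (structure) and S and \<Lambda> :: "'l set" and x0 +
  fixes T :: "('l \<Rightarrow> 'a, ('l \<Rightarrow> 'a) \<times> 'a) pre_digraph"
  assumes maximal: "maximal_tree G S \<Lambda> x0 T"
begin

lemma tree_spans: "rev_subtree Ygraph erev T" "verts T = V"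
proof -
  have "Y.max_subgraph Y.rev_tree T"
    using maximal by (simp add: maximal_tree_def undirected_tree_eq)
  then show "rev_subtree Ygraph erev T" "verts T = V"
    using Y.maximal_tree_spans[of T] Ygraph_connected by auto
qed

sublocale R: rev_subtree Ygraph erev T
  by (rule tree_spans(1))

lemma tree_path_eq: "tree_path G S \<Lambda> x0 T z y = (y, R.tpath z y)"
  by (simp add: tree_path_def R.tpath_def non_backtracking_def Y.reduced_nth)

abbreviation tree_elt :: "('l \<Rightarrow> 'a) \<Rightarrow> ('l \<Rightarrow> 'a) \<Rightarrow> 'a" where
  "tree_elt z y \<equiv> pelt (R.tpath z y)"

lemma tpath_arcs: "y \<in> V \<Longrightarrow> z \<in> V \<Longrightarrow> set (R.tpath z y) \<subseteq> arcs Cgraph"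
  using R.tpath_awalk[of y z] tree_spans(2) R.awalkT_arcs R.arcsT Yarcs_Carcs by blast

lemma tpath_Yawalk: "y \<in> V \<Longrightarrow> z \<in> V \<Longrightarrow> Y.awalk y (R.tpath z y) z"
  using R.tpath_awalk[of y z] tree_spans(2) R.awalkT_awalk by blast

lemma tree_elt_Yhom: "y \<in> V \<Longrightarrow> z \<in> V \<Longrightarrow> tree_elt z y \<in> Yhom z y"
  using tpath_Yawalk awalk_Yhom by blast

lemma tree_elt_closed: "y \<in> V \<Longrightarrow> z \<in> V \<Longrightarrow> tree_elt z y \<in> carrier G"
  using tree_elt_Yhom Yhom_Chom Chom_closed by blast

lemma tree_elt_self: "y \<in> V \<Longrightarrow> tree_elt y y = \<one>"
  using R.tpath_self[of y] tree_spans(2) by simp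

lemma tree_elt_inv: "y \<in> V \<Longrightarrow> z \<in> V \<Longrightarrow> tree_elt y z = inv (tree_elt z y)"
  using R.tpath_flip[of y z] pelt_flip[OF tpath_arcs, of y z] tree_spans(2) by simp

section \<open>The section and its equalities\<close>

abbreviation sect :: "'l set \<Rightarrow> 'a" where "sect \<equiv> g_elt G S \<Lambda> x0 T"

abbreviation tree_part :: "'l set \<Rightarrow> 'a" where "tree_part A \<equiv> tree_elt x0 (tw A x0)"

lemma sect_eq: "sect A = tree_part A \<otimes> wA A"
  by (simp add: g_elt_def tree_path_eq path_elt_eq wA_def)

text \<open>By \<open>tau_pelt\<close> the middle factor is the untwisted one; the twist shows only
  in the endpoints of the two connecting tree paths.\<close>

lemma loop_elt:
  assumes A: "admissible A" "tw A x0 \<in> V" and es: "Y.awalk y es z"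
  shows "path_elt G S \<Lambda> (based_loop G S \<Lambda> x0 T x0 (tau G S \<Lambda> A (y, es))) =
    tree_elt x0 (tw A z) \<otimes> pelt es \<otimes> tree_elt (tw A y) x0"
proof -
  have yz: "y \<in> V" "z \<in> V" "set es \<subseteq> arcs Cgraph"
    using Y.awalk_hd_in_verts[OF es] Y.awalk_last_in_verts[OF es] es Yarcs_Carcs
    by (auto simp: Y.awalk_def)
  note t = tau_pelt[OF A yz(3)]
  have tz: "tw A y \<in> V" "tw A z \<in> V" using tw_V[OF A] yz by auto
  have fst: "fst (tau G S \<Lambda> A (y, es)) = tw A y" by (simp add: tau_def)
  let ?es = "map (\<lambda>(y, s). (tw A y, s)) es"
  have "path_elt G S \<Lambda> (based_loop G S \<Lambda> x0 T x0 (tau G S \<Lambda> A (y, es))) =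
      pelt (R.tpath (tw A y) x0 @ (?es @ R.tpath x0 (tw A z)))"
    by (simp add: based_loop_def path_elt_eq tree_path_eq fst t(1) tau_path_end[OF A es])
  also have "\<dots> = (tree_elt x0 (tw A z) \<otimes> pelt ?es) \<otimes> tree_elt (tw A y) x0"
    using t(2) tpath_arcs[OF x0_V tz(1)] tpath_arcs[OF tz(2) x0_V]
    by (subst pelt_append; (subst pelt_append)?) auto
  finally show ?thesis by (simp add: t(3))
qed

lemma At_facts:
  assumes "A \<in> carrier At"
  shows "admissible A" "tw A x0 \<in> V" "tree_part A \<in> Yhom x0 (tw A x0)" "tree_part A \<in> Chom x0 (tw A x0)"
    "tree_part A \<in> carrier G" "wA A \<in> carrier G" "sect A \<in> carrier G"
proof -
  show A: "admissible A" "tw A x0 \<in> V" using assms by (simp_all add: At_carrier)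
  show "tree_part A \<in> Yhom x0 (tw A x0)" "tree_part A \<in> Chom x0 (tw A x0)" "tree_part A \<in> carrier G"
    using tree_elt_Yhom tree_elt_closed Yhom_Chom A(2) x0_V by blast+
  then show "wA A \<in> carrier G" "sect A \<in> carrier G" using wA_closed[OF A(1)] by (simp_all add: sect_eq)
qed

text \<open>\<open>wA A\<close> sends the simple root of an entry of \<open>x0\<close> to plus or
  minus that of the twisted entry, and the tree path carries the twisted tuple back to
  \<open>x0\<close>, so only the sign remains.\<close>

lemma sect_act:
  assumes A: "A \<in> carrier At" and l: "l \<in> \<Lambda>"
  shows "sect A \<bullet> simple_root (x0 l) = (if l \<in> A then (\<lambda>t. - simple_root (x0 l) t) else simple_root (x0 l))"
proof -
  note F = At_facts[OF A]
  obtain i where i: "\<And>y. y \<in> V \<Longrightarrow> tw A y l = y i"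
    "wA A \<bullet> simple_root (x0 l) = (if l \<in> A then (\<lambda>t. - simple_root (x0 i) t) else simple_root (x0 i))"
    using tw_index[OF F(1) l] by metis
  have "tree_part A \<bullet> simple_root (x0 i) = simple_root (x0 l)"
    using Chom_act[OF F(4) l] i(1)[OF x0_V] by simp
  then show ?thesis
    using i(2) F(5,6) by (simp add: sect_eq act_mult act_neg)
qed

lemma sect_Z: "A \<in> carrier At \<Longrightarrow> sect A \<in> Z"
  using sect_act by (intro ZI At_facts(7)) auto

lemma signs_sect: "A \<in> carrier At \<Longrightarrow> signs (sect A) = A"
proof -
  assume A: "A \<in> carrier At"
  have "l \<in> signs (sect A) \<longleftrightarrow> l \<in> A" if "l \<in> \<Lambda>" for l
    using that sect_act[OF A that] simple_root_ne_neg[of "x0 l"] by (simp add: signs_iff)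
  then show ?thesis using signs_subset admissibleD(1)[OF At_facts(1)[OF A]] by blast
qed

text \<open>\<open>wA A\<close> fixes all roots orthogonal to the base, and the tree path runs
  through arcs that keep the positive ones positive.\<close>

lemma sect_Bt:
  assumes A: "A \<in> carrier At"
  shows "sect A \<in> Bt"
proof (rule BtI[OF sect_Z[OF A]])
  note F = At_facts[OF A]
  fix \<gamma> assume \<gamma>: "\<gamma> \<in> \<Psi>pos"
  then have "wA A \<bullet> \<gamma> = \<gamma>" using wA_perp[OF F(1)] by (simp add: perp_pos_iff)
  moreover have "tree_part A \<bullet> \<gamma> \<in> \<Phi>pos"
    using Yhom_pos[OF F(3)] \<gamma> tw_tuple(2)[OF F(1) x0_V] by simp
  ultimately show "sect A \<bullet> \<gamma> \<in> \<Phi>pos" using Psi_pos_fin_supp[OF \<gamma>] F(5,6) by (simp add: sect_eq act_mult)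
qed

lemma At_sym_diff:
  assumes "A \<in> carrier At" "D \<in> carrier At"
  shows "sym_diff A D \<in> carrier At"
proof -
  have "signs (sect A \<otimes> sect D) = sym_diff A D"
    using signs_mult[OF sect_Z sect_Z] signs_sect assms by simp
  then show ?thesis using signs_At[OF Z_mult[OF sect_Z sect_Z]] assms by metis
qed

lemma wA_sym_diff: "A \<in> carrier At \<Longrightarrow> D \<in> carrier At \<Longrightarrow> wA (sym_diff A D) = wA A \<otimes> wA D"
  unfolding wA_def[of "sym_diff A D"] using wA_product(1) At_facts(1) by blast

lemma wA_tree_part_commute: "A \<in> carrier At \<Longrightarrow> D \<in> carrier At \<Longrightarrow> wA A \<otimes> tree_part D = tree_part D \<otimes> wA A"
  using wA_commute[of A D "tree_part D"] At_facts by metis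

text \<open>\<open>wA A\<close> commutes with the tree part of \<open>D\<close>, so the tree parts
  can be collected on the left, separate from the longest elements.\<close>

lemma sect_mult:
  assumes "A \<in> carrier At" "D \<in> carrier At"
  shows "sect A \<otimes> sect D = tree_part A \<otimes> tree_part D \<otimes> (wA A \<otimes> wA D)"
proof -
  note F = At_facts(5,6)[OF assms(1)] At_facts(5,6)[OF assms(2)]
  have "sect A \<otimes> sect D = tree_part A \<otimes> (wA A \<otimes> tree_part D) \<otimes> wA D" using F by (simp add: sect_eq m_assoc)
  then show ?thesis using F by (simp add: wA_tree_part_commute[OF assms] m_assoc)
qed

text \<open>The twisted tree path runs from the twist by both sets to the twist by \<open>A\<close>.
  Its element is still the tree part of \<open>D\<close>, and the two connecting paths give the
  outer factors.\<close>

lemma loop_forward: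
  assumes A: "A \<in> carrier At" and D: "D \<in> carrier At"
  shows "path_elt G S \<Lambda> (based_loop G S \<Lambda> x0 T x0 (tau G S \<Lambda> A (tree_path G S \<Lambda> x0 T x0 (tw D x0)))) =
    tree_part A \<otimes> tree_part D \<otimes> inv (tree_part (sym_diff A D))"
proof -
  note FA = At_facts[OF A] and FD = At_facts[OF D] and F = At_facts[OF At_sym_diff[OF A D]]
  show ?thesis
    using loop_elt[OF FA(1,2) tpath_Yawalk[OF FD(2) x0_V]] tree_elt_inv[OF F(2) x0_V] tw_tw[OF FA(1) FD(1)]
    by (simp add: tree_path_eq)
qed

lemma loop_backward:
  assumes A: "A \<in> carrier At" and D: "D \<in> carrier At"
  shows "path_elt G S \<Lambda> (based_loop G S \<Lambda> x0 T x0 (tau G S \<Lambda> D (tree_path G S \<Lambda> x0 T (tw A x0) x0))) =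
    tree_part (sym_diff A D) \<otimes> inv (tree_part A) \<otimes> inv (tree_part D)"
proof -
  note FA = At_facts[OF A] and FD = At_facts[OF D] and F = At_facts[OF At_sym_diff[OF A D]]
  have "tw D (tw A x0) = tw (sym_diff A D) x0"
    using tw_tw[OF FD(1) FA(1)] by (simp add: Un_commute)
  then show ?thesis
    using loop_elt[OF FD(1,2) tpath_Yawalk[OF x0_V FA(2)]] tree_elt_inv[OF FA(2) x0_V]
      tree_elt_inv[OF FD(2) x0_V]
    by (simp add: tree_path_eq)
qed

lemma sect_product:
  assumes A: "A \<in> carrier At" and D: "D \<in> carrier At"
  shows "sect A \<otimes> sect D =
    path_elt G S \<Lambda> (based_loop G S \<Lambda> x0 T x0 (tau G S \<Lambda> A (tree_path G S \<Lambda> x0 T x0 (tw D x0)))) \<otimes>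
      sect (sym_diff A D)"
proof -
  note FA = At_facts[OF A] and FD = At_facts[OF D] and F = At_facts[OF At_sym_diff[OF A D]]
  have "tree_part A \<otimes> tree_part D \<otimes> inv (tree_part (sym_diff A D)) \<otimes> sect (sym_diff A D) =
      tree_part A \<otimes> tree_part D \<otimes> (wA A \<otimes> wA D)"
    using FA(5,6) FD(5,6) F(5,6) by (simp add: sect_eq wA_sym_diff[OF A D] m_assoc)
  then show ?thesis using loop_forward[OF A D] sect_mult[OF A D] by simp
qed

lemma sect_empty: "sect {} = \<one>"
  using tw_empty tree_elt_self[OF x0_V] by (simp add: sect_eq)

lemma sect_commutator:
  assumes A: "A \<in> carrier At" and D: "D \<in> carrier At"
  shows "sect A \<otimes> sect D \<otimes> inv (sect A) \<otimes> inv (sect D) =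
    path_elt G S \<Lambda> (based_loop G S \<Lambda> x0 T x0 (tau G S \<Lambda> A (tree_path G S \<Lambda> x0 T x0 (tw D x0)))) \<otimes>
    path_elt G S \<Lambda> (based_loop G S \<Lambda> x0 T x0 (tau G S \<Lambda> D (tree_path G S \<Lambda> x0 T (tw A x0) x0)))"
proof -
  note FA = At_facts[OF A] and FD = At_facts[OF D] and F = At_facts[OF At_sym_diff[OF A D]]
  have "sect A \<otimes> sect D \<otimes> inv (sect A) \<otimes> inv (sect D) = (sect A \<otimes> sect D) \<otimes> inv (sect D \<otimes> sect A)"
    using FA(7) FD(7) by (simp add: inv_mult_group m_assoc)
  also have "\<dots> = tree_part A \<otimes> tree_part D \<otimes> (inv (tree_part A) \<otimes> inv (tree_part D))"
    using FA(5,6) FD(5,6)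
    by (simp add: sect_mult[OF A D] sect_mult[OF D A] wA_product(2)[OF FD(1) FA(1)] inv_mult_group m_assoc)
  \<comment> \<open>The inserted tree part belongs to the vertex twisted by both sets, at which the
    first loop enters its twisted path and the second leaves it.\<close>
  also have "\<dots> = (tree_part A \<otimes> tree_part D \<otimes> inv (tree_part (sym_diff A D))) \<otimes>
      (tree_part (sym_diff A D) \<otimes> inv (tree_part A) \<otimes> inv (tree_part D))"
    using FA(5) FD(5) F(5) by (simp add: m_assoc)
  finally show ?thesis using loop_forward[OF A D] loop_backward[OF A D] by simp
qed

lemma sect_conj:
  assumes A: "A \<in> carrier At" and p: "p \<in> paths G S \<Lambda> x0 x0 x0"
  shows "sect A \<otimes> path_elt G S \<Lambda> p \<otimes> inv (sect A) =
    path_elt G S \<Lambda> (based_loop G S \<Lambda> x0 T x0 (tau G S \<Lambda> A p))"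
proof -
  note F = At_facts[OF A]
  obtain es where es: "p = (x0, es)" "Y.awalk x0 es x0"
    using p by (cases p) (auto simp: paths_def)
  have q: "pelt es \<in> Chom x0 x0" using awalk_Yhom[OF es(2)] Yhom_Chom by blast
  then have qc: "pelt es \<in> carrier G" using Chom_closed by blast
  \<comment> \<open>The twist by the empty set is \<open>x0\<close> itself, so
    \<open>wA_commute\<close> also covers elements of closed paths at \<open>x0\<close>.\<close>
  have comm: "pelt es \<otimes> wA A = wA A \<otimes> pelt es"
    using wA_commute[OF F(1) tw_empty(1)] tw_empty(3) x0_V q by simp
  have "sect A \<otimes> pelt es \<otimes> inv (sect A) = tree_part A \<otimes> (wA A \<otimes> pelt es) \<otimes> (inv (wA A) \<otimes> inv (tree_part A))"
    using F(5,6) qc by (simp add: sect_eq inv_mult_group m_assoc)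
  also have "\<dots> = tree_part A \<otimes> pelt es \<otimes> inv (tree_part A)"
    using F(5,6) qc by (simp add: comm[symmetric] m_assoc)
  finally show ?thesis
    using loop_elt[OF F(1,2) es(2)] tree_elt_inv[OF F(2) x0_V] es(1) by (simp add: path_elt_eq)
qed

lemma pi1_paths: "P \<in> pi1 G S \<Lambda> x0 x0 \<Longrightarrow> p \<in> P \<Longrightarrow> p \<in> paths G S \<Lambda> x0 x0 x0"
  by (auto simp: pi1_def quotient_def)

end

theorem theorem5p1:
  fixes G :: "('a, 'b) monoid_scheme" (structure)
    and S I :: "'a set" and \<Lambda> :: "'l set" and x\<^sub>I :: "'l \<Rightarrow> 'a"
    and T :: "('l \<Rightarrow> 'a, ('l \<Rightarrow> 'a) \<times> 'a) pre_digraph"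
  assumes "coxeter_system G S" and "I \<subseteq> S"
    and "x\<^sub>I \<in> injections S \<Lambda>" and "x\<^sub>I ` \<Lambda> = I"
    and "maximal_tree G S \<Lambda> x\<^sub>I T"
  shows "let C\<^sub>I = C_hom G S \<Lambda> x\<^sub>I x\<^sub>I;
             Y\<^sub>I = Y_hom G S \<Lambda> x\<^sub>I x\<^sub>I;
             Z = parabolic_centralizer G I;
             B = B_tilde G S I;
             \<A> = A_tilde G S \<Lambda> x\<^sub>I;
             a = A_map G S \<Lambda> x\<^sub>I;
             g = g_elt G S \<Lambda> x\<^sub>I T;
             \<pi>\<^sub>1 = pi1 G S \<Lambda> x\<^sub>I x\<^sub>I;
             up = (\<lambda>A. twist G S \<Lambda> A x\<^sub>I);
             \<tau> = tau G S \<Lambda>;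
             path = tree_path G S \<Lambda> x\<^sub>I T;
             loop = (\<lambda>q. path_elt G S \<Lambda> (based_loop G S \<Lambda> x\<^sub>I T x\<^sub>I q))
         in short_exact (G\<lparr>carrier := C\<^sub>I\<rparr>) (\<lambda>w. w) (G\<lparr>carrier := Z\<rparr>) a \<A>
          \<and> g \<in> carrier \<A> \<rightarrow> Z
          \<and> (\<forall>A\<in>carrier \<A>. a (g A) = A)
          \<and> g ` carrier \<A> \<subseteq> B
          \<and> short_exact (G\<lparr>carrier := Y\<^sub>I\<rparr>) (\<lambda>w. w) (G\<lparr>carrier := B\<rparr>) a \<A>
          \<and> internal_semidirect (G\<lparr>carrier := Z\<rparr>) (perp_group G S I) B
          \<and> (\<forall>w\<in>B. coxeter_automorphism (G\<lparr>carrier := perp_group G S I\<rparr>) (perp_gens G S I)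
                       (\<lambda>u. w \<otimes> u \<otimes> inv w))
          \<and> (\<forall>P\<in>\<pi>\<^sub>1. \<forall>p\<in>P. \<forall>A\<in>carrier \<A>.
                g A \<otimes> path_elt G S \<Lambda> p \<otimes> inv (g A) = loop (\<tau> A p))
          \<and> (\<forall>A\<in>carrier \<A>. \<forall>A'\<in>carrier \<A>.
                g A \<otimes> g A' = loop (\<tau> A (path x\<^sub>I (up A'))) \<otimes> g (A \<otimes>\<^bsub>\<A>\<^esub> A'))
          \<and> (\<forall>A\<in>carrier \<A>. g A [^] (2::nat) = loop (\<tau> A (path x\<^sub>I (up A))))
          \<and> (\<forall>A\<in>carrier \<A>. \<forall>A'\<in>carrier \<A>.
                g A \<otimes> g A' \<otimes> inv (g A) \<otimes> inv (g A') =
                  loop (\<tau> A (path x\<^sub>I (up A'))) \<otimes> loop (\<tau> A' (path (up A) x\<^sub>I)))"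
proof -
  interpret coxeter_tree G S \<Lambda> x\<^sub>I T
    using assms by unfold_locales
  have I: "I = x\<^sub>I ` \<Lambda>" using assms(4) by simp
  have onto: "carrier At \<subseteq> signs ` Z" "carrier At \<subseteq> signs ` Bt"
    using signs_sect sect_Z sect_Bt by (metis image_eqI subsetI)+
  \<comment> \<open>Puts the fixing subgroup into the form in which \<open>signs_short_exact\<close>
    states the kernel.\<close>
  have Z_eq: "Chom x\<^sub>I x\<^sub>I = {w \<in> Z. w \<in> Chom x\<^sub>I x\<^sub>I}"
    using Chom_Z by blast
  \<comment> \<open>The product formula with both arguments equal: the symmetric difference is
    empty, and the section of the empty set is the identity.\<close>
  have square: "sect A [^] (2::nat) = path_elt G S \<Lambda> (based_loop G S \<Lambda> x\<^sub>I T x\<^sub>I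
      (tau G S \<Lambda> A (tree_path G S \<Lambda> x\<^sub>I T x\<^sub>I (tw A x\<^sub>I))))" if A: "A \<in> carrier At" for A
  proof -
    note F = At_facts[OF A]
    have "sect A [^] (2::nat) = sect A \<otimes> sect A" using F(7) by (simp add: numeral_2_eq_2)
    then show ?thesis
      using sect_product[OF A A] loop_forward[OF A A] F(5) At_facts(5)[OF At_sym_diff[OF A A]]
      by (simp add: sect_empty)
  qed
  show ?thesis
    unfolding Let_def I
  proof (intro conjI)
    show "short_exact (G\<lparr>carrier := Chom x\<^sub>I x\<^sub>I\<rparr>) (\<lambda>w. w) (G\<lparr>carrier := Z\<rparr>) signs At"
      using signs_short_exact[OF Z_subgroup subset_refl onto(1)] unfolding Z_eq[symmetric] .
    show "sect \<in> carrier At \<rightarrow> Z" using sect_Z by blast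
    show "\<forall>A\<in>carrier At. signs (sect A) = A" using signs_sect by blast
    show "sect ` carrier At \<subseteq> Bt" using sect_Bt by blast
    show "short_exact (G\<lparr>carrier := Yhom x\<^sub>I x\<^sub>I\<rparr>) (\<lambda>w. w) (G\<lparr>carrier := Bt\<rparr>) signs At"
      using signs_short_exact[OF Bt_subgroup _ onto(2)] Bt_Z unfolding Y_eq by blast
    show "internal_semidirect (G\<lparr>carrier := Z\<rparr>) W\<Psi> Bt" by (rule Z_semidirect)
    show "\<forall>w\<in>Bt. coxeter_automorphism (G\<lparr>carrier := W\<Psi>\<rparr>) (perp_gens G S base)
        (\<lambda>u. w \<otimes> u \<otimes> inv w)"
      using Bt_coxeter_automorphism by blast
  qed (use sect_conj pi1_paths sect_product sect_commutator square in \<open>simp_all\<close>)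
qed

end
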